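(* Suppose $\gamma>0$, $\alpha\in\mathbb{R}$ and $0<p<\infty$, and let $k$ be a positive integer such that $pk+\alpha>-1$. Then for any holomorphic function $f$ on $\mathbb{B}_n$, $f\in\mathcal{A}^p_\alpha$ if and only if $\mathrm{M}^{(k)}_\gamma(f)\in L^p(\mathbb{B}_n,dv_\alpha)$, where $$\mathrm{M}^{(k)}_\gamma(f)(z)=\sup_{w\in D(z,\gamma)}\left|(1-|w|^2)^k\mathcal{R}^kf(w)\right|,\qquad z\in\mathbb{B}_n.$$ Moreover, $$\|f-f(0)\|_{p,\alpha}\approx\left(\int_{\mathbb{B}_n}|\mathrm{M}^{(k)}_\gamma(f)|^p\,dv_\alpha\right)^{1/p},$$ where the constants implied by $\approx$ depend only on $\gamma,\alpha,p,k$ and $n$.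
   Context: Fix a positive integer $n$. $\mathbb{B}_n=\{z\in\mathbb{C}^n:|z|<1\}$ is the open unit ball, and $\mathcal{H}(\mathbb{B}_n)$ is the space of holomorphic functions on $\mathbb{B}_n$. $dv$ is Lebesgue measure on $\mathbb{B}_n$ normalized to be a probability measure. For $\alpha\in\mathbb{R}$, $dv_\alpha(z)=c_\alpha(1-|z|^2)^\alpha dv(z)$, with $c_\alpha=1$ if $\alpha\le-1$ and $c_\alpha=\Gamma(n+\alpha+1)/[n!\,\Gamma(\alpha+1)]$ if $\alpha>-1$. The radial derivative of $f\in\mathcal{H}(\mathbb{B}_n)$ is $\mathcal{R}f(z)=\sum_{j=1}^n z_j\frac{\partial f}{\partial z_j}(z)$, and $\mathcal{R}^k$ is its $k$-th iterate ($\mathcal{R}^0f=f$). For $0<p<\infty$ and $\alpha\in\mathbb{R}$, the generalized Bergman space $\mathcal{A}^p_\alpha$ is the space of all $f\in\mathcal{H}(\mathbb{B}_n)$ such that $(1-|z|^2)^m\mathcal{R}^mf\in L^p(\mathbb{B}_n,dv_\alpha)$, where $m$ is a fixed nonnegative integer with $pm+\alpha>-1$ (the space does not depend on the choice of $m$). Let $N$ be the smallest nonnegative integer with $pN+\alpha>-1$; the (quasi-)norm on $\mathcal{A}^p_\alpha$ is $$\|f\|_{p,\alpha}=|f(0)|+\left(\int_{\mathbb{B}_n}(1-|z|^2)^{pN}|\mathcal{R}^Nf(z)|^p\,dv_\alpha(z)\right)^{1/p}.$$ For $z\in\mathbb{B}_n$, $\varphi_z$ is the standard involutive automorphism of $\mathbb{B}_n$,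 a biholomorphic self-map with $\varphi_z(0)=z$, $\varphi_z(z)=0$, $\varphi_z\circ\varphi_z=\mathrm{id}$. The Bergman metric is $\beta(z,w)=\frac12\log\frac{1+|\varphi_z(w)|}{1-|\varphi_z(w)|}$ and $D(z,\gamma)=\{w\in\mathbb{B}_n:\beta(z,w)<\gamma\}$. For nonnegative (possibly infinite) quantities, $X\approx Y$ means $C^{-1}Y\le X\le CY$ for some constant $C>0$ not depending on $f$. *)

theory Defs
  imports "HOL-Analysis.Analysis"
begin

(* Functions on the unit ball of C^n (n = CARD('n)) are total functions on
   complex^'n; nothing below depends on their values outside ball 0 1. *)

definition holomorphic_ball :: "(complex^'n \<Rightarrow> complex) \<Rightarrow> bool" where
  "holomorphic_ball f \<longleftrightarrow>
     (\<forall>z\<in>ball 0 1. \<exists>f'. (f has_derivative f') (at z) \<and> (\<forall>c v. f' (c *s v) = c * f' v))"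

definition partial_deriv :: "'n \<Rightarrow> (complex^'n \<Rightarrow> complex) \<Rightarrow> complex^'n \<Rightarrow> complex" where
  "partial_deriv j f z = deriv (\<lambda>\<zeta>. f (z + axis j \<zeta>)) 0"

definition radial_deriv :: "(complex^'n \<Rightarrow> complex) \<Rightarrow> complex^'n \<Rightarrow> complex" where
  "radial_deriv f z = (\<Sum>j\<in>UNIV. z $ j * partial_deriv j f z)"

definition weighted_radial :: "nat \<Rightarrow> (complex^'n \<Rightarrow> complex) \<Rightarrow> complex^'n \<Rightarrow> complex" where
  "weighted_radial m f z = complex_of_real ((1 - (norm z)\<^sup>2) ^ m) * (radial_deriv ^^ m) f z"

definition ball_measure :: "(complex^'n) measure" where
  "ball_measure =
     scale_measure (inverse (emeasure lborel (ball (0::complex^'n) 1))) (restrict_space lborel (ball 0 1))"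

definition bergman_const :: "nat \<Rightarrow> real \<Rightarrow> real" where
  "bergman_const n \<alpha> =
     (if \<alpha> \<le> - 1 then 1 else Gamma (real n + \<alpha> + 1) / (fact n * Gamma (\<alpha> + 1)))"

definition weighted_measure :: "real \<Rightarrow> (complex^'n) measure" where
  "weighted_measure \<alpha> =
     density ball_measure
       (\<lambda>z. ennreal (bergman_const CARD('n) \<alpha> * (1 - (norm z)\<^sup>2) powr \<alpha>))"

definition in_Lp :: "real \<Rightarrow> 'a measure \<Rightarrow> ('a \<Rightarrow> 'b::real_normed_vector) \<Rightarrow> bool" where
  "in_Lp p M g \<longleftrightarrow>
     g \<in> borel_measurable M \<and> (\<integral>\<^sup>+x. ennreal (norm (g x) powr p) \<partial>M) < \<infinity>"

(* The auxiliary order m of the derivative is kept as a parameter; it is meant to be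
   used only for m with p * m + \<alpha> > -1. *)
definition bergman_space :: "nat \<Rightarrow> real \<Rightarrow> real \<Rightarrow> (complex^'n \<Rightarrow> complex) set" where
  "bergman_space m p \<alpha> =
     {f. holomorphic_ball f \<and> in_Lp p (weighted_measure \<alpha>) (weighted_radial m f)}"

definition min_order :: "real \<Rightarrow> real \<Rightarrow> nat" where
  "min_order p \<alpha> = (LEAST N. p * real N + \<alpha> > - 1)"

(* Real powers of extended nonnegative reals; only exponents a > 0 are intended. *)
definition ennreal_powr :: "ennreal \<Rightarrow> real \<Rightarrow> ennreal" where
  "ennreal_powr x a = (if x = \<infinity> then \<infinity> else ennreal (enn2real x powr a))"

(* Extended-valued: the value is infinite for holomorphic f outside the Bergman space. *)
definition bergman_norm :: "real \<Rightarrow> real \<Rightarrow> (complex^'n \<Rightarrow> complex) \<Rightarrow> ennreal" where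
  "bergman_norm p \<alpha> f =
     ennreal (norm (f 0)) +
     ennreal_powr
       (\<integral>\<^sup>+z. ennreal ((1 - (norm z)\<^sup>2) powr (p * real (min_order p \<alpha>)) *
                   norm ((radial_deriv ^^ min_order p \<alpha>) f z) powr p)
          \<partial>weighted_measure \<alpha>) (1 / p)"

definition herm :: "complex^'n \<Rightarrow> complex^'n \<Rightarrow> complex" where
  "herm z w = (\<Sum>j\<in>UNIV. z $ j * cnj (w $ j))"

(* Orthogonal projection onto the complex line spanned by a; it is 0 for a = 0,
   because division by zero yields 0. *)
definition line_proj :: "complex^'n \<Rightarrow> complex^'n \<Rightarrow> complex^'n" where
  "line_proj a w = (herm w a / herm a a) *s a"

(* The involution (a - P w - sqrt (1 - |a|^2) Q w) / (1 - <w,a>), with P = line_proj a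
   and Q = I - P; for a = 0 it is w \<mapsto> -w. *)
definition ball_involution :: "complex^'n \<Rightarrow> complex^'n \<Rightarrow> complex^'n" where
  "ball_involution a w =
     inverse (1 - herm w a) *s
       (a - line_proj a w - sqrt (1 - (norm a)\<^sup>2) *\<^sub>R (w - line_proj a w))"

definition bergman_dist :: "complex^'n \<Rightarrow> complex^'n \<Rightarrow> real" where
  "bergman_dist z w =
     1 / 2 * ln ((1 + norm (ball_involution z w)) / (1 - norm (ball_involution z w)))"

definition bergman_ball :: "complex^'n \<Rightarrow> real \<Rightarrow> (complex^'n) set" where
  "bergman_ball z \<gamma> = {w \<in> ball 0 1. bergman_dist z w < \<gamma>}"

(* For holomorphic f and z in ball 0 1 the supremum is that of a bounded nonempty set of
   reals, since Bergman balls are relatively compact in the unit ball. *)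
definition max_radial :: "nat \<Rightarrow> real \<Rightarrow> (complex^'n \<Rightarrow> complex) \<Rightarrow> complex^'n \<Rightarrow> real" where
  "max_radial k \<gamma> f z = (SUP w\<in>bergman_ball z \<gamma>. norm (weighted_radial k f w))"

end

theory Submission
  imports Defs "HOL-Complex_Analysis.Conformal_Mappings"
begin

text \<open>
  Write \<open>I m f\<close> for the integral of \<open>|(1 - |z|\<^sup>2)\<^sup>m \<R>\<^sup>m f|\<^sup>p\<close> over the unit ball with weight
  \<open>(1 - |z|\<^sup>2)\<^sup>\<alpha>\<close>.  The claim has two parts: for \<open>f 0 = 0\<close> the quantities \<open>I m f\<close> with \<open>p m + \<alpha> > -1\<close> are
  comparable, and replacing the integrand of \<open>I k f\<close> by its supremum over Bergman balls of a fixed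
  radius changes it by at most a constant factor.  The arguments below are uniform in
  \<open>0 < p < \<infinity>\<close>; in particular \<open>p < 1\<close> requires no separate treatment.

  Geometry.  The Bergman ball \<open>D(z,\<gamma>)\<close> is the set of \<open>w\<close> with
  \<open>|1 - \<langle>w,z\<rangle>|\<^sup>2 < K (1 - |z|\<^sup>2) (1 - |w|\<^sup>2)\<close> for \<open>K = (cosh \<gamma>)\<^sup>2\<close>
  (\<open>bergman_ball_eq\<close>).  This relation between \<open>z\<close> and \<open>w\<close> is symmetric, it is transitive up to an
  enlargement of \<open>K\<close>, and up to dilations \<open>D(z,\<gamma>)\<close> is a ball of an anisotropic norm attached to \<open>z\<close>.
  Hence the volumes of Bergman balls with nearby centres are comparable, without any of them being
  computed.

  Suprema.  The mean value inequality \<open>mean_value_inequality\<close> bounds \<open>|f (w)|\<^sup>p\<close> by the average of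
  \<open>|f|\<^sup>p\<close> over a small anisotropic ball.  Consequently one average over a larger Bergman ball about
  \<open>z\<close> bounds \<open>|f|\<^sup>p\<close> on all of \<open>D(z,\<gamma>)\<close> (\<open>pth_power_le_local_avg\<close>), and by Tonelli's theorem these
  averages integrate to at most a constant times the integral of \<open>|f|\<^sup>p\<close> for each power weight
  (\<open>nn_integral_local_avg_le\<close>).  This yields the statement on maximal functions, and, combined with
  Cauchy's estimate, that \<open>I (m + 1) f\<close> is at most a constant times \<open>I m f\<close>.

  Removing a derivative.  That \<open>I m f\<close> is at most a constant times \<open>I (m + 1) f\<close> is a Hardy
  inequality along rays.  A point \<open>r \<zeta>\<close> is compared with the point on the same ray whose distance to
  the boundary is \<open>\<Lambda>\<close> times as large.  The increment is controlled by the supremum of \<open>\<R> g\<close>, for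
  \<open>g = \<R>\<^sup>m f\<close>, over a Bergman ball, hence by an average as above, and because the weight exponent exceeds
  \<open>-1\<close>, the contribution of the comparison point is absorbed if \<open>\<Lambda>\<close> is large (\<open>ray_absorption\<close>).
\<close>

section \<open>The Hermitian form\<close>

lemma herm_add_left: "herm (u + v) w = herm u w + herm v w"
  by (simp add: herm_def distrib_right sum.distrib)

lemma herm_diff_left: "herm (u - v) w = herm u w - herm v w"
  by (simp add: herm_def left_diff_distrib sum_subtractf)

lemma herm_diff_right: "herm w (u - v) = herm w u - herm w v"
  by (simp add: herm_def right_diff_distrib sum_subtractf)

lemma herm_scale_left: "herm (c *s v) w = c * herm v w"
  by (simp add: herm_def sum_distrib_left mult.assoc)

lemma herm_commute: "herm v w = cnj (herm w v)"
  by (simp add: herm_def mult.commute)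

lemma norm_one_minus_herm_commute: "norm (1 - herm v w) = norm (1 - herm w v)"
  by (subst herm_commute) (metis complex_cnj_diff complex_cnj_one complex_mod_cnj)

lemma herm_zero [simp]: "herm 0 w = 0" "herm w 0 = 0"
  by (simp_all add: herm_def)

lemma Re_herm: "Re (herm v w) = v \<bullet> w"
  by (simp add: herm_def inner_vec_def inner_complex_def)

lemma herm_self: "herm v v = complex_of_real ((norm v)\<^sup>2)"
proof (rule complex_eqI)
  show "Re (herm v v) = Re (complex_of_real ((norm v)\<^sup>2))"
    by (simp add: Re_herm power2_norm_eq_inner)
  have "Im (herm v v) = Im (cnj (herm v v))" by (subst herm_commute) simp
  then show "Im (herm v v) = Im (complex_of_real ((norm v)\<^sup>2))" by simp
qed

lemma norm_cscale: "norm (c *s v) = norm c * norm (v :: complex^'n)"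
proof -
  have "(norm (c *s v))\<^sup>2 = (norm c * norm v)\<^sup>2"
    by (simp add: norm_vec_def L2_set_def norm_mult power_mult_distrib sum_nonneg
          flip: sum_distrib_left)
  then show ?thesis by simp
qed

lemma scaleR_eq_cscale: "r *\<^sub>R (v :: complex^'n) = complex_of_real r *s v"
  by (simp add: vec_eq_iff scaleR_conv_of_real[where 'a=complex])

lemma norm_herm_le: "norm (herm v w) \<le> norm v * norm w"
proof (cases "herm v w = 0")
  case False
  define c where "c = cnj (herm v w) / complex_of_real (norm (herm v w))"
  have c: "norm c = 1" using False by (simp add: c_def norm_divide)
  have "complex_of_real (norm (herm v w)) = c * herm v w"
    using False unfolding c_def
    by (simp add: mult.commute[of "cnj (herm v w)"] power2_eq_square flip: complex_norm_square)
  then have "norm (herm v w) = Re (herm (c *s v) w)"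
    by (metis Re_complex_of_real herm_scale_left)
  also have "\<dots> = (c *s v) \<bullet> w" by (rule Re_herm)
  also have "\<dots> \<le> norm (c *s v) * norm w" by (rule norm_cauchy_schwarz)
  finally show ?thesis by (simp add: norm_cscale c)
qed simp

lemma norm_diff_square_le:
  fixes u z :: "complex^'n"
  assumes "norm u < 1" "norm z < 1"
  shows "(norm (u - z))\<^sup>2 \<le> 2 * norm (1 - herm u z)"
proof -
  have "(norm (u - z))\<^sup>2 = (norm u)\<^sup>2 + (norm z)\<^sup>2 - 2 * Re (herm u z)"
    by (simp add: Re_herm power2_norm_eq_inner inner_diff inner_commute)
  also have "\<dots> \<le> 2 * Re (1 - herm u z)"
    using assms power_le_one[of "norm u" 2] power_le_one[of "norm z" 2] by simp
  also have "\<dots> \<le> 2 * norm (1 - herm u z)"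
    using complex_Re_le_cmod[of "1 - herm u z"] by linarith
  finally show ?thesis .
qed

lemma continuous_on_herm [continuous_intros]:
  fixes f g :: "'a::topological_space \<Rightarrow> complex^'n"
  assumes "continuous_on S f" "continuous_on S g"
  shows "continuous_on S (\<lambda>x. herm (f x) (g x))"
  unfolding herm_def by (intro continuous_intros assms)

lemma continuous_on_cscale [continuous_intros]:
  fixes f :: "'a::topological_space \<Rightarrow> complex" and g :: "'a \<Rightarrow> complex^'n"
  assumes "continuous_on S f" "continuous_on S g"
  shows "continuous_on S (\<lambda>x. f x *s g x)"
  unfolding vector_scalar_mult_def by (intro continuous_intros assms)

section \<open>Bergman balls\<close>

definition defect :: "complex^'n \<Rightarrow> real" where
  "defect z = 1 - (norm z)\<^sup>2"

lemma defect_pos: "norm z < 1 \<Longrightarrow> 0 < defect z"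
  by (simp add: defect_def power_less_one_iff)

lemma defect_le_1: "defect z \<le> 1"
  by (simp add: defect_def)

lemma defect_le_norm:
  assumes w: "norm w < 1" and z: "norm z < 1"
  shows "defect z \<le> 2 * norm (1 - herm w z)"
proof -
  have "norm (herm w z) \<le> norm z"
    using norm_herm_le[of w z] mult_right_mono[of "norm w" 1 "norm z"] w by simp
  then have a: "1 - norm z \<le> norm (1 - herm w z)"
    using norm_triangle_ineq2[of 1 "herm w z"] by simp
  have "defect z \<le> 2 * (1 - norm z)"
  proof -
    have "defect z = (1 - norm z) * (1 + norm z)"
      by (simp add: defect_def power2_eq_square algebra_simps)
    also have "\<dots> \<le> (1 - norm z) * 2" using z by (intro mult_left_mono) auto
    finally show ?thesis by (simp add: mult.commute)
  qed
  also have "\<dots> \<le> 2 * norm (1 - herm w z)" using a by (intro mult_left_mono) auto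
  finally show ?thesis .
qed

lemma line_proj_properties:
  fixes a w :: "complex^'n"
  assumes "a \<noteq> 0"
  defines "l \<equiv> herm w a / herm a a" and "q \<equiv> w - line_proj a w"
  shows "line_proj a w = l *s a" "herm q a = 0"
        "\<And>c s. (norm (c *s a + s *\<^sub>R q))\<^sup>2 = (norm c)\<^sup>2 * (norm a)\<^sup>2 + s\<^sup>2 * (norm q)\<^sup>2"
proof -
  show 1: "line_proj a w = l *s a" by (simp add: line_proj_def l_def)
  have "herm a a \<noteq> 0" using assms(1) by (simp add: herm_self)
  then show 2: "herm q a = 0"
    unfolding q_def 1 by (simp add: herm_diff_left herm_scale_left l_def)
  fix c :: complex and s :: real
  have "herm q (c *s a) = 0"
    using 2 herm_commute[of q "c *s a"] herm_commute[of a q] by (simp add: herm_scale_left)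
  then have "(c *s a) \<bullet> q = 0" by (metis Re_herm inner_commute zero_complex.simps(1))
  then have "orthogonal (c *s a) (s *\<^sub>R q)" by (simp add: orthogonal_def)
  then have "(norm (c *s a + s *\<^sub>R q))\<^sup>2 = (norm (c *s a))\<^sup>2 + (norm (s *\<^sub>R q))\<^sup>2"
    by (rule norm_add_Pythagorean)
  then show "(norm (c *s a + s *\<^sub>R q))\<^sup>2 = (norm c)\<^sup>2 * (norm a)\<^sup>2 + s\<^sup>2 * (norm q)\<^sup>2"
    by (simp add: norm_cscale power_mult_distrib)
qed

text \<open>
  With \<open>w = l a + q\<close> and \<open>q \<bottom> a\<close>, Pythagoras evaluates both \<open>|w|\<^sup>2\<close> and the numerator of the
  involution, and the two sides become polynomials in \<open>l\<close>, \<open>|a|\<^sup>2\<close> and \<open>|q|\<^sup>2\<close>.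
\<close>

lemma one_minus_norm_ball_involution:
  fixes a w :: "complex^'n"
  assumes a: "norm a < 1" and w: "norm w < 1"
  shows "1 - (norm (ball_involution a w))\<^sup>2 = defect a * defect w / (norm (1 - herm w a))\<^sup>2"
proof (cases "a = 0")
  case True
  then show ?thesis
    by (simp add: ball_involution_def line_proj_def defect_def)
next
  case False
  define l where "l = herm w a / herm a a"
  define q where "q = w - line_proj a w"
  note lp = line_proj_properties[OF False, where w = w, folded l_def q_def]
  have h: "herm w a = l * complex_of_real ((norm a)\<^sup>2)"
    using False by (simp add: l_def herm_self)
  define A where "A = (norm a)\<^sup>2"
  have nz: "norm (1 - herm w a) > 0"
    using defect_le_norm[OF w a] defect_pos[OF a] by linarith
  have nw: "(norm w)\<^sup>2 = (norm l)\<^sup>2 * A + (norm q)\<^sup>2"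
    using lp(3)[of l 1] lp(1) by (simp add: q_def A_def)
  have v: "a - line_proj a w - sqrt (1 - (norm a)\<^sup>2) *\<^sub>R (w - line_proj a w)
        = (1 - l) *s a + (- sqrt (1 - A)) *\<^sub>R q"
    unfolding lp(1) A_def
    by (simp add: q_def lp(1) vec_eq_iff scaleR_conv_of_real[where 'a=complex] ring_distribs)
  have s: "(- sqrt (1 - A))\<^sup>2 = 1 - A"
    using defect_pos[OF a] by (simp add: A_def defect_def)
  have nv: "(norm ((1 - l) *s a + (- sqrt (1 - A)) *\<^sub>R q))\<^sup>2 = (norm (1 - l))\<^sup>2 * A + (1 - A) * (norm q)\<^sup>2"
    unfolding lp(3) s by (simp add: A_def)
  have B: "(norm (ball_involution a w))\<^sup>2
     = ((norm (1 - l))\<^sup>2 * A + (1 - A) * (norm q)\<^sup>2) / (norm (1 - herm w a))\<^sup>2"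
    unfolding ball_involution_def v norm_cscale power_mult_distrib nv norm_inverse power_inverse
    by (simp only: divide_inverse mult.commute)
  have "(norm (1 - herm w a))\<^sup>2 - ((norm (1 - l))\<^sup>2 * A + (1 - A) * (norm q)\<^sup>2)
      = (1 - A) * (1 - (norm w)\<^sup>2)"
    unfolding nw h A_def[symmetric] cmod_power2 by (simp add: power2_eq_square algebra_simps)
  then have "(norm (1 - herm w a))\<^sup>2 * (1 - (norm (ball_involution a w))\<^sup>2)
      = (1 - A) * (1 - (norm w)\<^sup>2)"
    unfolding B using nz by (simp add: right_diff_distrib)
  then show ?thesis using nz by (simp add: A_def defect_def field_simps)
qed

text \<open>
  Written without the involution, the Bergman ball of radius \<open>\<gamma>\<close> is a region of the following
  shape with \<open>K = (cosh \<gamma>)\<^sup>2\<close>.  The triangle inequality of the Bergman metric is only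
  needed up to a change of \<open>K\<close>, and in this form it follows from the Cauchy--Schwarz inequality,
  without the automorphism group.
\<close>

definition bergman_region :: "real \<Rightarrow> complex^'n \<Rightarrow> (complex^'n) set" where
  "bergman_region K z = {w \<in> ball 0 1. (norm (1 - herm w z))\<^sup>2 < K * defect z * defect w}"

lemma bergman_regionD:
  assumes "w \<in> bergman_region K z"
  shows "norm w < 1" "(norm (1 - herm w z))\<^sup>2 < K * defect z * defect w"
  using assms by (auto simp: bergman_region_def)

lemma artanh_less_iff:
  fixes s \<gamma> :: real
  assumes "0 \<le> s" "s < 1" "\<gamma> > 0"
  shows "1 / 2 * ln ((1 + s) / (1 - s)) < \<gamma> \<longleftrightarrow> 1 < (cosh \<gamma>)\<^sup>2 * (1 - s\<^sup>2)"
proof -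
  define e where "e = exp (2 * \<gamma>)"
  have e: "e > 1" using assms(3) by (simp add: e_def)
  have q: "(1 + s) / (1 - s) > 0" using assms by simp
  have "1 / 2 * ln ((1 + s) / (1 - s)) < \<gamma> \<longleftrightarrow> ln ((1 + s) / (1 - s)) < 2 * \<gamma>" by linarith
  also have "\<dots> \<longleftrightarrow> (1 + s) / (1 - s) < e"
    using exp_less_cancel_iff[of "ln ((1 + s) / (1 - s))" "2 * \<gamma>"] unfolding exp_ln[OF q] e_def by simp
  also have "\<dots> \<longleftrightarrow> 1 + s < e * (1 - s)"
    using assms by (simp add: pos_divide_less_eq)
  also have "\<dots> \<longleftrightarrow> s * (e + 1) < e - 1" by (auto simp: algebra_simps)
  also have "\<dots> \<longleftrightarrow> (s * (e + 1))\<^sup>2 < (e - 1)\<^sup>2"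
    using assms(1) e by (intro iffI power_strict_mono) (auto intro: power2_less_imp_less)
  also have "\<dots> \<longleftrightarrow> 4 * e < (e + 1)\<^sup>2 * (1 - s\<^sup>2)" by (auto simp: power2_eq_square algebra_simps)
  also have "(e + 1)\<^sup>2 = 4 * e * (cosh \<gamma>)\<^sup>2"
  proof -
    have "e = exp \<gamma> * exp \<gamma>" unfolding e_def mult_2 exp_add ..
    then have "e + 1 = 2 * exp \<gamma> * cosh \<gamma>" "e = (exp \<gamma>)\<^sup>2"
      by (simp_all add: cosh_def distrib_left exp_minus power2_eq_square)
    then show ?thesis by (simp only: power_mult_distrib) simp
  qed
  also have "4 * e < 4 * e * (cosh \<gamma>)\<^sup>2 * (1 - s\<^sup>2) \<longleftrightarrow> 1 < (cosh \<gamma>)\<^sup>2 * (1 - s\<^sup>2)"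
    using e mult_less_cancel_left_pos[of "4 * e" 1] by (simp add: mult.assoc)
  finally show ?thesis .
qed

lemma bergman_ball_eq:
  fixes z :: "complex^'n"
  assumes z: "norm z < 1" and "\<gamma> > 0"
  shows "bergman_ball z \<gamma> = bergman_region ((cosh \<gamma>)\<^sup>2) z"
proof -
  have "bergman_dist z w < \<gamma> \<longleftrightarrow> (norm (1 - herm w z))\<^sup>2 < (cosh \<gamma>)\<^sup>2 * defect z * defect w"
    if w: "norm w < 1" for w
  proof -
    define s where "s = norm (ball_involution z w)"
    have id: "1 - s\<^sup>2 = defect z * defect w / (norm (1 - herm w z))\<^sup>2"
      unfolding s_def by (rule one_minus_norm_ball_involution[OF z w])
    have nz: "norm (1 - herm w z) > 0"
      using defect_le_norm[OF w z] defect_pos[OF z] by linarith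
    have "0 < 1 - s\<^sup>2" unfolding id
      using nz defect_pos[OF z] defect_pos[OF w] by simp
    then have "s < 1" by (simp add: abs_square_less_1)
    moreover have "0 \<le> s" by (simp add: s_def)
    ultimately have "bergman_dist z w < \<gamma> \<longleftrightarrow> 1 < (cosh \<gamma>)\<^sup>2 * (1 - s\<^sup>2)"
      unfolding bergman_dist_def s_def[symmetric] by (intro artanh_less_iff assms(2))
    also have "\<dots> \<longleftrightarrow> (norm (1 - herm w z))\<^sup>2 < (cosh \<gamma>)\<^sup>2 * defect z * defect w"
      unfolding id using nz by (simp add: pos_less_divide_eq mult.assoc)
    finally show ?thesis .
  qed
  then show ?thesis by (auto simp: bergman_ball_def bergman_region_def)
qed

lemma bergman_region_self:
  assumes "norm z < 1" "K > 1"
  shows "z \<in> bergman_region K z"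
proof -
  have "norm (1 - herm z z) = defect z"
  proof -
    have "1 - herm z z = complex_of_real (defect z)" by (simp add: herm_self defect_def)
    then show ?thesis using defect_pos[OF assms(1)] by (metis norm_of_real abs_of_pos)
  qed
  then show ?thesis using assms defect_pos[OF assms(1)]
    by (simp add: bergman_region_def power2_eq_square)
qed

lemma bergman_region_sym:
  assumes "w \<in> bergman_region K z" "norm z < 1"
  shows "z \<in> bergman_region K w"
  using assms by (auto simp: bergman_region_def norm_one_minus_herm_commute[of w z] mult_ac)

lemma bergman_region_pos:
  assumes "w \<in> bergman_region K z" "norm z < 1" shows "K > 0"
proof -
  have "0 < K * (defect z * defect w)"
    using bergman_regionD[OF assms(1)] zero_le_power2[of "norm (1 - herm w z)"]
    unfolding mult.assoc by linarith
  moreover have "0 < defect z * defect w"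
    using assms(2) bergman_regionD(1)[OF assms(1)] by (simp add: defect_pos)
  ultimately show ?thesis by (simp add: zero_less_mult_iff)
qed

lemma bergman_region_defect_le:
  assumes w: "w \<in> bergman_region K z" and z: "norm z < 1"
  shows "defect z \<le> 4 * K * defect w"
proof -
  note wD = bergman_regionD[OF w]
  have "(defect z)\<^sup>2 \<le> (2 * norm (1 - herm w z))\<^sup>2"
    using defect_le_norm[OF wD(1) z] defect_pos[OF z] by (intro power_mono) auto
  also have "\<dots> \<le> defect z * (4 * K * defect w)" using wD(2) by (simp add: power_mult_distrib mult_ac)
  finally have "defect z * defect z \<le> defect z * (4 * K * defect w)" by (simp add: power2_eq_square)
  then show ?thesis using defect_pos[OF z] by (simp add: mult_le_cancel_left_pos)
qed

lemma bergman_region_defect_ge: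
  assumes w: "w \<in> bergman_region K z" and z: "norm z < 1"
  shows "defect w \<le> 4 * K * defect z"
  using bergman_region_defect_le[OF bergman_region_sym[OF w z]] bergman_regionD[OF w] by simp

lemma bergman_region_norm_le:
  assumes w: "w \<in> bergman_region K z" and z: "norm z < 1"
  shows "norm (1 - herm w z) \<le> 2 * K * defect z"
proof -
  note wD = bergman_regionD[OF w]
  have K: "K > 0" by (rule bergman_region_pos[OF w z])
  have "(norm (1 - herm w z))\<^sup>2 \<le> K * defect z * (4 * K * defect z)"
    using wD(2) bergman_region_defect_ge[OF w z] K defect_pos[OF z]
      mult_left_mono[of "defect w" "4 * K * defect z" "K * defect z"]
    by (meson less_imp_le mult_nonneg_nonneg order_trans)
  also have "\<dots> = (2 * K * defect z)\<^sup>2" by (simp add: power2_eq_square)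
  finally show ?thesis using K defect_pos[OF z] by (simp add: power2_le_iff_abs_le)
qed

text \<open>
  The quasi-triangle inequality rests on
  \<open>1 - \<langle>z,w\<rangle> = (1 - \<langle>u,w\<rangle>) + \<langle>u - z,u\<rangle> + \<langle>u - z,w - u\<rangle>\<close>.  Each of the three terms is bounded by
  a multiple of \<open>1 - |u|\<^sup>2\<close>, the last one because \<open>|u - z|\<^sup>2 \<le> 2 |1 - \<langle>u,z\<rangle>|\<close> and likewise for \<open>w\<close>.
\<close>

lemma bergman_region_trans:
  assumes uz: "u \<in> bergman_region K z" and wu: "w \<in> bergman_region L u"
      and z: "norm z < 1" and K: "K \<ge> 1" and L: "L \<ge> 1"
  shows "w \<in> bergman_region (10000 * K^3 * L^3) z"
proof -
  note uD = bergman_regionD[OF uz] and wD = bergman_regionD[OF wu]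
  have zu: "z \<in> bergman_region K u" by (rule bergman_region_sym[OF uz z])
  define d where "d = defect u"
  have d: "d > 0" using defect_pos[OF uD(1)] by (simp add: d_def)
  have KL: "K \<le> K * L" "L \<le> K * L" "1 \<le> K * L" 
    using K L mult_mono[of 1 K 1 L] mult_left_mono[of 1 L K] mult_right_mono[of 1 K L] by auto
  define M where "M = K * L"
  have a1: "norm (1 - herm w u) \<le> 2 * M * d"
    using bergman_region_norm_le[OF wu uD(1)] mult_right_mono[OF KL(2), of d] d by (simp add: d_def M_def)
  have a2: "norm (1 - herm z u) \<le> 2 * M * d"
    using bergman_region_norm_le[OF zu uD(1)] mult_right_mono[OF KL(1), of d] d by (simp add: d_def M_def)
  have b1: "(norm (w - u))\<^sup>2 \<le> 4 * M * d"
    using norm_diff_square_le[OF wD(1) uD(1)] a1 by simp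
  have b2: "(norm (z - u))\<^sup>2 \<le> 4 * M * d"
    using norm_diff_square_le[OF z uD(1)] a2 by simp
  have "(norm (w - u) * norm (z - u))\<^sup>2 \<le> (4 * M * d)\<^sup>2"
    unfolding power_mult_distrib[of "norm (w - u)"] power2_eq_square[of "4 * M * d"]
    by (rule mult_mono[OF b1 b2]) (use d KL in \<open>auto simp: M_def\<close>)
  then have b: "norm (w - u) * norm (z - u) \<le> 4 * M * d"
    using d KL by (simp add: M_def power2_le_iff_abs_le abs_mult)
  have c: "norm (herm (u - z) u) \<le> 3 * M * d"
  proof -
    have "herm (u - z) u = (1 - herm z u) - complex_of_real d"
      by (simp add: herm_diff_left herm_self d_def defect_def)
    then have "norm (herm (u - z) u) \<le> norm (1 - herm z u) + d"
      using norm_triangle_ineq4[of "1 - herm z u" "complex_of_real d"] d by simp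
    moreover have "d \<le> M * d" using mult_right_mono[OF KL(3), of d] d by (simp add: M_def)
    ultimately show ?thesis using a2 by (simp add: mult.assoc)
  qed
  (* The constants are crude; all that matters is that they depend on K and L alone. *)
  have dec: "1 - herm z w = (1 - herm u w) + herm (u - z) u + herm (u - z) (w - u)"
    by (simp add: herm_diff_left herm_diff_right)
  have "norm (1 - herm z w) \<le> norm (1 - herm u w) + norm (herm (u - z) u) + norm (herm (u - z) (w - u))"
    unfolding dec by (intro order_trans[OF norm_triangle_ineq] add_right_mono norm_triangle_ineq)
  also have "norm (1 - herm u w) = norm (1 - herm w u)"
    by (rule norm_one_minus_herm_commute)
  also have "norm (herm (u - z) (w - u)) \<le> 4 * M * d"
    using norm_herm_le[of "u - z" "w - u"] b by (simp add: norm_minus_commute mult.commute)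
  finally have e: "norm (1 - herm z w) \<le> 9 * M * d" using a1 c by linarith
  have f: "norm (1 - herm w z) = norm (1 - herm z w)"
    by (rule norm_one_minus_herm_commute)
  have dz: "d \<le> 4 * K * defect z" unfolding d_def by (rule bergman_region_defect_ge[OF uz z])
  have dw: "d \<le> 4 * L * defect w" unfolding d_def by (rule bergman_region_defect_le[OF wu uD(1)])
  have "(norm (1 - herm w z))\<^sup>2 \<le> (9 * M * d)\<^sup>2"
    unfolding f using e by (intro power_mono) auto
  also have "\<dots> = 81 * M\<^sup>2 * (d * d)" by (simp add: power2_eq_square)
  also have "\<dots> \<le> 81 * M\<^sup>2 * ((4 * K * defect z) * (4 * L * defect w))"
    using dz dw d K L defect_pos[OF z] by (intro mult_left_mono mult_mono) auto
  also have "\<dots> = 1296 * (M^3 * defect z * defect w)"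
    by (simp add: M_def power2_eq_square power3_eq_cube)
  also have "\<dots> < 10000 * (M^3 * defect z * defect w)"
    using KL defect_pos[OF z] defect_pos[OF wD(1)] by (intro mult_strict_right_mono mult_pos_pos) (auto simp: M_def)
  also have "\<dots> = 10000 * K^3 * L^3 * defect z * defect w"
    by (simp add: M_def power_mult_distrib)
  finally show ?thesis using wD(1) by (simp add: bergman_region_def)
qed

section \<open>The anisotropic norms\<close>

text \<open>
  Seen from \<open>z\<close>, a Bergman ball extends by about \<open>1 - |z|\<^sup>2\<close> in the direction of \<open>z\<close> and by
  about \<open>\<surd>(1 - |z|\<^sup>2)\<close> in the orthogonal directions.  The following norm has such a set as its
  unit ball.  As it is a complex norm, one-variable estimates apply on the discs of its complex
  lines, and volumes of its balls scale, so that volumes of Bergman balls can be compared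
  without computing any of them.
\<close>

definition aniso :: "complex^'n \<Rightarrow> complex^'n \<Rightarrow> real" where
  "aniso z v = max (norm (herm v z) / defect z) (norm v / sqrt (defect z))"

lemma aniso_nonneg: "norm z < 1 \<Longrightarrow> 0 \<le> aniso z v"
  by (simp add: aniso_def le_max_iff_disj defect_pos less_imp_le)

lemma aniso_zero [simp]: "aniso z 0 = 0"
  by (simp add: aniso_def)

lemma aniso_cscale:
  assumes "norm z < 1" shows "aniso z (c *s v) = norm c * aniso z v"
  by (simp add: aniso_def herm_scale_left norm_cscale norm_mult max_mult_distrib_left)

lemma aniso_scaleR:
  assumes "norm z < 1" shows "aniso z (r *\<^sub>R v) = \<bar>r\<bar> * aniso z v"
  by (simp add: scaleR_eq_cscale aniso_cscale assms)

lemma aniso_triangle: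
  assumes "norm z < 1" shows "aniso z (u + v) \<le> aniso z u + aniso z v"
proof -
  have "norm (herm (u + v) z) / defect z \<le> norm (herm u z) / defect z + norm (herm v z) / defect z"
    using defect_pos[OF assms] norm_triangle_ineq[of "herm u z" "herm v z"]
    by (simp add: herm_add_left divide_right_mono flip: add_divide_distrib)
  moreover have "norm (u + v) / sqrt (defect z) \<le> norm u / sqrt (defect z) + norm v / sqrt (defect z)"
    using defect_pos[OF assms] norm_triangle_ineq[of u v]
    by (simp add: divide_right_mono flip: add_divide_distrib)
  ultimately show ?thesis unfolding aniso_def by linarith
qed

lemma norm_le_aniso:
  assumes "norm z < 1" shows "norm v \<le> aniso z v"
proof -
  have "norm v \<le> norm v / sqrt (defect z)"
    using defect_pos[OF assms] defect_le_1[of z] mult_left_mono[of "sqrt (defect z)" 1 "norm v"]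
    by (simp add: pos_le_divide_eq)
  then show ?thesis by (simp add: aniso_def)
qed

lemma aniso_le_norm:
  assumes "norm z < 1" shows "aniso z v \<le> norm v / defect z"
proof -
  have d: "0 < defect z" "defect z \<le> 1" using defect_pos[OF assms] defect_le_1 by auto
  have "norm (herm v z) / defect z \<le> norm v / defect z"
    using norm_herm_le[of v z] mult_left_mono[of "norm z" 1 "norm v"] assms d
    by (intro divide_right_mono) auto
  moreover have "norm v / sqrt (defect z) \<le> norm v / defect z"
    using d by (intro divide_left_mono) (auto simp: real_le_rsqrt power2_eq_square mult_left_le)
  ultimately show ?thesis unfolding aniso_def by simp
qed

lemma continuous_on_aniso: "norm z < 1 \<Longrightarrow> continuous_on S (aniso z)"
  unfolding aniso_def[abs_def] by (intro continuous_intros) (use defect_pos[of z] in auto)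

lemma borel_measurable_herm [measurable]:
  fixes f g :: "'a \<Rightarrow> complex^'n"
  assumes "f \<in> borel_measurable M" "g \<in> borel_measurable M"
  shows "(\<lambda>x. herm (f x) (g x)) \<in> borel_measurable M"
proof -
  have "(\<lambda>p. herm (fst p) (snd p) :: complex) \<in> borel_measurable (borel :: ((complex^'n) \<times> (complex^'n)) measure)"
    by (intro borel_measurable_continuous_onI continuous_intros)
  then have "(\<lambda>p. herm (fst p) (snd p) :: complex) \<in> borel_measurable (borel \<Otimes>\<^sub>M (borel :: (complex^'n) measure))"
    by (simp add: borel_prod)
  from measurable_compose[OF measurable_Pair[OF assms] this] show ?thesis by simp
qed

lemma borel_measurable_defect [measurable]: "defect \<in> borel_measurable borel"
  unfolding defect_def[abs_def] by measurable

lemma borel_measurable_aniso [measurable]: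
  fixes f g :: "'a \<Rightarrow> complex^'n"
  assumes [measurable]: "f \<in> borel_measurable M" "g \<in> borel_measurable M"
  shows "(\<lambda>x. aniso (f x) (g x)) \<in> borel_measurable M"
  unfolding aniso_def by measurable

text \<open>
  For \<open>\<parallel>v\<parallel> \<le> 1/4\<close> both \<open>|\<langle>v,z\<rangle>|\<close> and \<open>|v|\<^sup>2\<close> are small fractions of \<open>1 - |z|\<^sup>2\<close>, so that
  \<open>1 - |z + v|\<^sup>2\<close> and \<open>|1 - \<langle>z + v,z\<rangle>|\<close> both stay comparable to it.  Together with the reverse inclusion
  below, Bergman balls and anisotropic balls agree up to dilation.
\<close>

lemma region_of_aniso_le:
  assumes z: "norm z < 1" and v: "aniso z v \<le> 1/4"
  shows "z + v \<in> bergman_region 4 z"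
proof -
  define d where "d = defect z"
  have d: "0 < d" "d \<le> 1" using defect_pos[OF z] defect_le_1 by (auto simp: d_def)
  have h: "norm (herm v z) \<le> d / 4" and "norm v \<le> sqrt d / 4"
  proof -
    have "norm (herm v z) / d \<le> 1 / 4" "norm v / sqrt d \<le> 1 / 4"
      using v unfolding aniso_def d_def[symmetric] by linarith+
    then show "norm (herm v z) \<le> d / 4" "norm v \<le> sqrt d / 4"
      using d by (auto simp: field_simps)
  qed
  from this(2) have "(norm v)\<^sup>2 \<le> (sqrt d / 4)\<^sup>2" by (intro power_mono) auto
  then have nv: "(norm v)\<^sup>2 \<le> d / 16" using d by (simp add: power_divide)
  have "(norm (z + v))\<^sup>2 = (norm z)\<^sup>2 + 2 * Re (herm v z) + (norm v)\<^sup>2"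
    by (simp add: Re_herm power2_norm_eq_inner inner_add inner_commute)
  also have "\<dots> \<le> (1 - d) + 2 * (d / 4) + d / 16"
  proof -
    have "(norm z)\<^sup>2 = 1 - d" by (simp add: d_def defect_def)
    then show ?thesis using h nv complex_Re_le_cmod[of "herm v z"] by linarith
  qed
  finally have *: "7 / 16 * d \<le> defect (z + v)" by (simp add: defect_def)
  then have "0 < defect (z + v)" using d by linarith
  then have n1: "norm (z + v) < 1" by (simp add: defect_def abs_square_less_1)
  have "1 - herm (z + v) z = complex_of_real d - herm v z"
    by (simp add: herm_add_left herm_self d_def defect_def)
  then have "norm (1 - herm (z + v) z) \<le> 5 / 4 * d"
    using norm_triangle_ineq4[of "complex_of_real d" "herm v z"] h d by simp
  then have "(norm (1 - herm (z + v) z))\<^sup>2 \<le> (5 / 4 * d)\<^sup>2" by (intro power_mono) auto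
  also have "\<dots> = 25 / 16 * (d * d)" by (simp add: power2_eq_square)
  also have "\<dots> < 28 / 16 * (d * d)" using d by (intro mult_strict_right_mono) auto
  also have "\<dots> = 4 * d * (7 / 16 * d)" by simp
  also have "\<dots> \<le> 4 * d * defect (z + v)" using * d by (intro mult_left_mono) auto
  finally show ?thesis using n1 by (simp add: bergman_region_def d_def)
qed

lemma aniso_le_of_region:
  assumes w: "w \<in> bergman_region K z" and z: "norm z < 1" and K: "K \<ge> 1"
  shows "aniso z (w - z) \<le> 3 * K"
proof -
  define d where "d = defect z"
  have d: "0 < d" using defect_pos[OF z] by (auto simp: d_def)
  have n: "norm (1 - herm w z) \<le> 2 * K * d" using bergman_region_norm_le[OF w z] by (simp add: d_def)
  have "d \<le> K * d" using K d by simp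
  moreover have "herm (w - z) z = complex_of_real d - (1 - herm w z)"
    by (simp add: herm_diff_left herm_self d_def defect_def)
  then have "norm (herm (w - z) z) \<le> d + norm (1 - herm w z)"
    using norm_triangle_ineq4[of "complex_of_real d" "1 - herm w z"] d by simp
  ultimately have 1: "norm (herm (w - z) z) \<le> 3 * K * d" using n by (simp add: mult.assoc)
  have "(norm (w - z))\<^sup>2 \<le> 4 * K * d"
    using norm_diff_square_le[OF bergman_regionD(1)[OF w] z] n by simp
  also have "\<dots> \<le> (3 * K)\<^sup>2 * d"
    using d K mult_mono[of 4 "9 * K" K K] by (intro mult_right_mono) (auto simp: power2_eq_square)
  also have "\<dots> = (3 * K * sqrt d)\<^sup>2" using d by (simp add: power_mult_distrib)
  finally have 2: "norm (w - z) \<le> 3 * K * sqrt d" using K d by (simp add: power2_le_iff_abs_le)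
  show ?thesis using 1 2 d by (simp add: aniso_def d_def[symmetric] pos_divide_le_eq)
qed

section \<open>Volumes\<close>

lemma nn_integral_lborel_affine:
  fixes f :: "'a::euclidean_space \<Rightarrow> ennreal"
  assumes [measurable]: "f \<in> borel_measurable borel" and t: "t > 0"
  shows "(\<integral>\<^sup>+x. f x \<partial>lborel) = ennreal (t ^ DIM('a)) * (\<integral>\<^sup>+x. f (a + t *\<^sub>R x) \<partial>lborel)"
proof -
  have "(\<integral>\<^sup>+x. f x \<partial>lborel) = (\<integral>\<^sup>+x. f x \<partial>density (distr lborel borel (\<lambda>x. a + t *\<^sub>R x)) (\<lambda>_. \<bar>t\<bar> ^ DIM('a)))"
    using lborel_affine[of t a] t by simp
  also have "\<dots> = (\<integral>\<^sup>+x. ennreal (t ^ DIM('a)) * f (a + t *\<^sub>R x) \<partial>lborel)"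
    using t by (simp add: nn_integral_density nn_integral_distr)
  finally show ?thesis by (simp add: nn_integral_cmult)
qed

definition aniso_ball :: "complex^'n \<Rightarrow> complex^'n \<Rightarrow> real \<Rightarrow> (complex^'n) set" where
  "aniso_ball z a r = {w. aniso z (w - a) < r}"

definition aniso_vol :: "complex^'n \<Rightarrow> real" where
  "aniso_vol z = measure lborel (aniso_ball z 0 1)"

lemma sets_aniso_ball [measurable]: "aniso_ball z a r \<in> sets borel"
proof -
  have "{w \<in> space borel. aniso z (w - a) < r} \<in> sets borel" by measurable
  then show ?thesis by (simp add: aniso_ball_def)
qed

lemma emeasure_aniso_ball_1:
  fixes z :: "complex^'n"
  assumes z: "norm z < 1"
  shows "emeasure lborel (aniso_ball z 0 1) = ennreal (aniso_vol z)" "0 < aniso_vol z"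
proof -
  have "aniso_ball z 0 1 \<subseteq> ball 0 1"
  proof
    fix v assume "v \<in> aniso_ball z 0 1"
    then show "v \<in> ball 0 1" using norm_le_aniso[OF z, of v] by (simp add: aniso_ball_def)
  qed
  then have "emeasure lborel (aniso_ball z 0 1) \<le> emeasure lborel (ball (0::complex^'n) 1)"
    by (intro emeasure_mono) auto
  also have "\<dots> < \<infinity>" by (rule emeasure_lborel_ball_finite)
  finally have fin: "emeasure lborel (aniso_ball z 0 1) < \<infinity>" .
  then show *: "emeasure lborel (aniso_ball z 0 1) = ennreal (aniso_vol z)"
    by (simp add: aniso_vol_def emeasure_eq_ennreal_measure)
  have "ball 0 (defect z) \<subseteq> aniso_ball z 0 1"
  proof
    fix v :: "complex^'n" assume "v \<in> ball 0 (defect z)"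
    then have "norm v / defect z < 1" using defect_pos[OF z] by simp
    then show "v \<in> aniso_ball z 0 1" using aniso_le_norm[OF z, of v] by (simp add: aniso_ball_def)
  qed
  then have "emeasure lborel (ball (0::complex^'n) (defect z)) \<le> emeasure lborel (aniso_ball z 0 1)"
    by (intro emeasure_mono) auto
  moreover have "0 < emeasure lborel (ball (0::complex^'n) (defect z))"
    using content_ball_pos[OF defect_pos[OF z], of "0::complex^'n"]
    by (simp add: measure_def enn2real_positive_iff)
  ultimately have "0 < ennreal (aniso_vol z)" unfolding * by (rule less_le_trans[rotated])
  then show "0 < aniso_vol z" by simp
qed

text \<open>
  Any two anisotropic balls at the same base point are related by a translation and a dilation, which
  is all that volumes are ever compared by.
\<close>

lemma emeasure_aniso_ball:
  fixes z a :: "complex^'n"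
  assumes z: "norm z < 1" and r: "r > 0"
  shows "emeasure lborel (aniso_ball z a r) = ennreal (r ^ DIM(complex^'n) * aniso_vol z)"
proof -
  have "emeasure lborel (aniso_ball z a r) = (\<integral>\<^sup>+x. indicator (aniso_ball z a r) x \<partial>lborel)"
    by simp
  also have "\<dots> = ennreal (r ^ DIM(complex^'n)) * (\<integral>\<^sup>+x. indicator (aniso_ball z a r) (a + r *\<^sub>R x) \<partial>lborel)"
    by (rule nn_integral_lborel_affine) (use r in auto)
  also have "(\<lambda>x. indicator (aniso_ball z a r) (a + r *\<^sub>R x) :: ennreal) = indicator (aniso_ball z 0 1)"
    using r by (auto simp: fun_eq_iff indicator_def aniso_ball_def aniso_scaleR[OF z])
  finally show ?thesis
    using r emeasure_aniso_ball_1[OF z] by (simp add: ennreal_mult)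
qed

lemma sets_bergman_region [measurable]: "bergman_region K z \<in> sets borel"
proof -
  have "{w \<in> space borel. norm w < 1 \<and> (norm (1 - herm w z))\<^sup>2 < K * defect z * defect w} \<in> sets borel"
    by measurable
  then show ?thesis by (simp add: bergman_region_def)
qed

lemma region_subset_aniso_ball:
  assumes "norm z < 1" "K \<ge> 1"
  shows "bergman_region K z \<subseteq> aniso_ball z z (4 * K)"
  using aniso_le_of_region[OF _ assms] assms(2) by (force simp: aniso_ball_def)

lemma aniso_ball_subset_region:
  assumes "norm z < 1" "r \<le> 1 / 4"
  shows "aniso_ball z z r \<subseteq> bergman_region 4 z"
proof
  fix w assume "w \<in> aniso_ball z z r"
  then have "aniso z (w - z) \<le> 1/4" using assms by (simp add: aniso_ball_def)
  from region_of_aniso_le[OF assms(1) this] show "w \<in> bergman_region 4 z" by simp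
qed

lemma emeasure_bergman_region_le:
  fixes z :: "complex^'n"
  assumes z: "norm z < 1" and K: "K \<ge> 1"
  shows "emeasure lborel (bergman_region K z) \<le> ennreal ((4 * K) ^ DIM(complex^'n) * aniso_vol z)"
  using emeasure_mono[OF region_subset_aniso_ball[OF z K], of lborel] emeasure_aniso_ball[OF z, of "4 * K" z] K
  by simp

text \<open>
  A doubling argument: the anisotropic ball of radius \<open>1/4\<close> about \<open>w\<close> lies in a larger Bergman ball
  about \<open>z\<close>, which in turn lies in a dilate of the anisotropic ball at \<open>z\<close>.
\<close>

lemma aniso_vol_comparable:
  fixes z w :: "complex^'n"
  assumes w: "w \<in> bergman_region K z" and z: "norm z < 1" and K: "K \<ge> 1"
  shows "aniso_vol w \<le> (10240000 * K ^ 3) ^ DIM(complex^'n) * aniso_vol z"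
proof -
  note w1 = bergman_regionD(1)[OF w]
  define L where "L = 10000 * K^3 * 4^3"
  have L: "L \<ge> 1" using one_le_power[OF K, of 3] by (simp add: L_def)
  have "aniso_ball w w (1/4) \<subseteq> bergman_region L z"
    using aniso_ball_subset_region[OF w1, of "1/4"] bergman_region_trans[OF w _ z K, of _ 4]
    by (auto simp: L_def)
  then have "emeasure lborel (aniso_ball w w (1/4)) \<le> emeasure lborel (bergman_region L z)"
    by (intro emeasure_mono) auto
  also have "\<dots> \<le> ennreal ((4 * L) ^ DIM(complex^'n) * aniso_vol z)"
    by (rule emeasure_bergman_region_le[OF z L])
  finally have "(1/4) ^ DIM(complex^'n) * aniso_vol w \<le> (4 * L) ^ DIM(complex^'n) * aniso_vol z"
    using emeasure_aniso_ball[OF w1, of "1/4" w] L emeasure_aniso_ball_1(2)[OF z]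
    by (subst (asm) emeasure_aniso_ball[OF w1]) (auto simp: ennreal_le_iff)
  then have "4 ^ DIM(complex^'n) * ((1/4) ^ DIM(complex^'n) * aniso_vol w)
      \<le> 4 ^ DIM(complex^'n) * ((4 * L) ^ DIM(complex^'n) * aniso_vol z)"
    by (intro mult_left_mono) auto
  moreover have "4 ^ DIM(complex^'n) * ((1/4::real) ^ DIM(complex^'n) * aniso_vol w) = aniso_vol w"
    by (simp only: mult.assoc[symmetric] power_mult_distrib[symmetric]) simp
  ultimately have "aniso_vol w \<le> 4 ^ DIM(complex^'n) * ((4 * L) ^ DIM(complex^'n) * aniso_vol z)"
    by (simp only:)
  also have "\<dots> = (4 * (4 * L)) ^ DIM(complex^'n) * aniso_vol z"
    by (simp only: power_mult_distrib mult.assoc)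
  also have "4 * (4 * L) = 10240000 * K ^ 3" by (simp add: L_def)
  finally show ?thesis .
qed

lemma borel_measurable_aniso_vol [measurable]:
  "(aniso_vol :: complex^'n \<Rightarrow> real) \<in> borel_measurable borel"
proof -
  have "(\<lambda>z. enn2real (\<integral>\<^sup>+v. indicator {p. aniso (fst p) (snd p) < 1} (z, v) \<partial>lborel))
          \<in> borel_measurable (lborel :: (complex^'n) measure)"
  proof -
    have [measurable]: "{p. aniso (fst p) (snd p) < 1} \<in> sets (lborel \<Otimes>\<^sub>M (lborel :: (complex^'n) measure))"
    proof -
      have "{p \<in> space (lborel \<Otimes>\<^sub>M lborel). aniso (fst p) (snd p :: complex^'n) < 1} \<in> sets (lborel \<Otimes>\<^sub>M lborel)"
        by measurable
      then show ?thesis by (simp add: space_pair_measure)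
    qed
    show ?thesis by measurable
  qed
  also have "(\<lambda>z. enn2real (\<integral>\<^sup>+v. indicator {p. aniso (fst p) (snd p) < 1} (z, v) \<partial>lborel)) = (aniso_vol :: complex^'n \<Rightarrow> real)"
  proof
    fix z :: "complex^'n"
    have "(\<lambda>v. indicator {p. aniso (fst p) (snd p) < 1} (z, v) :: ennreal) = indicator (aniso_ball z 0 1)"
      by (auto simp: fun_eq_iff indicator_def aniso_ball_def)
    then show "enn2real (\<integral>\<^sup>+v. indicator {p. aniso (fst p) (snd p) < 1} (z, v) \<partial>lborel) = aniso_vol z"
      by (simp add: aniso_vol_def measure_def)
  qed
  finally show ?thesis by (simp only: measurable_lborel2 measurable_lborel1)
qed

section \<open>One-variable estimates\<close>

text \<open>
  Cauchy's inequality on the disc of radius \<open>r / 2\<close> about \<open>\<xi>\<close> gives the first bound; integrating it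
  along the segment from \<open>0\<close> to \<open>\<xi>\<close> gives the second one.
\<close>

lemma disc_bounds:
  fixes h :: "complex \<Rightarrow> complex"
  assumes h: "h holomorphic_on ball 0 r" and r: "r > 0"
      and M: "\<And>\<zeta>. norm \<zeta> < r \<Longrightarrow> norm (h \<zeta>) \<le> M"
      and \<xi>: "norm \<xi> < r / 2"
  shows "norm (deriv h \<xi>) \<le> 2 * M / r" "norm (h \<xi> - h 0) \<le> 2 * M / r * norm \<xi>"
proof -
  have d: "norm (deriv h \<eta>) \<le> 2 * M / r" if "norm \<eta> < r / 2" for \<eta>
  proof -
    have "cball \<eta> (r/2) \<subseteq> ball 0 r"
      using that by (auto simp: dist_norm) (smt (verit) norm_triangle_ineq2 norm_minus_commute field_sum_of_halves)
    then have "norm ((deriv ^^ 1) h \<eta>) \<le> fact 1 * M / (r/2) ^ 1"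
    proof (intro Cauchy_inequality)
      assume s: "cball \<eta> (r/2) \<subseteq> ball 0 r"
      show "h holomorphic_on ball \<eta> (r / 2)" "continuous_on (cball \<eta> (r / 2)) h"
        using s h by (auto intro: holomorphic_on_subset holomorphic_on_imp_continuous_on dest: subsetD[OF ball_subset_cball])
      show "norm (h x) \<le> M" if "norm (\<eta> - x) = r / 2" for x
        using s that by (intro M) (force simp: dist_norm)
    qed (use r in auto)
    then show ?thesis by (simp add: field_simps)
  qed
  then show "norm (deriv h \<xi>) \<le> 2 * M / r" using \<xi> .
  have "norm (h \<xi> - h 0) \<le> 2 * M / r * norm (\<xi> - 0)"
  proof (rule field_differentiable_bound[where S = "ball 0 (r/2)" and f' = "deriv h"])
    fix \<eta> :: complex assume "\<eta> \<in> ball 0 (r/2)"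
    then show "(h has_field_derivative deriv h \<eta>) (at \<eta> within ball 0 (r/2))"
      using r by (intro DERIV_subset[OF holomorphic_derivI[OF h]]) auto
    show "norm (deriv h \<eta>) \<le> 2 * M / r" using \<open>\<eta> \<in> ball 0 (r/2)\<close> by (intro d) simp
  qed (use \<xi> r in auto)
  then show "norm (h \<xi> - h 0) \<le> 2 * M / r * norm \<xi>" by simp
qed

text \<open>Cauchy's formula for the derivative at the centre of a circle, as an integral over \<open>[0,1]\<close>.\<close>

definition circle :: "real \<Rightarrow> real \<Rightarrow> complex" where
  "circle \<rho> t = \<rho> * exp (2 * of_real pi * \<i> * of_real t)"

lemma norm_circle: "\<rho> > 0 \<Longrightarrow> norm (circle \<rho> t) = \<rho>"
proof -
  assume "\<rho> > 0"
  have "exp (2 * of_real pi * \<i> * of_real t) = exp (\<i> * complex_of_real (2 * pi * t))"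
    by (simp add: mult_ac)
  then have "norm (exp (2 * of_real pi * \<i> * complex_of_real t)) = 1"
    by (simp only: norm_exp_i_times)
  then show ?thesis using \<open>\<rho> > 0\<close> by (simp add: circle_def norm_mult)
qed

lemma circle_nonzero: "\<rho> > 0 \<Longrightarrow> circle \<rho> t \<noteq> 0"
  by (simp add: circle_def)

lemma continuous_on_circle [continuous_intros]:
  "continuous_on S f \<Longrightarrow> continuous_on S (\<lambda>x. circle \<rho> (f x))"
  unfolding circle_def by (intro continuous_intros)

lemma deriv_eq_circle_integral:
  fixes h :: "complex \<Rightarrow> complex"
  assumes h: "h holomorphic_on ball 0 r" and \<rho>: "0 < \<rho>" "\<rho> < r"
  shows "deriv h 0 = integral {0..1} (\<lambda>t. h (circle \<rho> t) / circle \<rho> t)"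
proof -
  have sub: "cball 0 \<rho> \<subseteq> ball (0::complex) r" using \<rho> by auto
  have "contour_integral (circlepath 0 \<rho>) (\<lambda>u. h u / (u - 0)^2) = (2 * pi * \<i>) * deriv h 0"
    using sub h \<rho> by (intro Cauchy_contour_integral_circlepath_2)
      (auto intro: holomorphic_on_subset holomorphic_on_imp_continuous_on)
  also have "contour_integral (circlepath 0 \<rho>) (\<lambda>u. h u / (u - 0)^2)
      = integral {0..1} (\<lambda>t. (2 * pi * \<i>) * (h (circle \<rho> t) / circle \<rho> t))"
    unfolding contour_integral_integral
  proof (rule integral_cong)
    fix t :: real
    have "vector_derivative (circlepath 0 \<rho>) (at t) = 2 * pi * \<i> * circle \<rho> t"
      using has_vector_derivative_circlepath[of 0 \<rho> t UNIV]
      by (simp add: circle_def vector_derivative_at mult_ac)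
    moreover have "circlepath 0 \<rho> t = circle \<rho> t" by (simp add: circlepath circle_def)
    ultimately show "h (circlepath 0 \<rho> t) / (circlepath 0 \<rho> t - 0)\<^sup>2 * vector_derivative (circlepath 0 \<rho>) (at t)
        = (2 * pi * \<i>) * (h (circle \<rho> t) / circle \<rho> t)"
      using circle_nonzero[OF \<rho>(1), of t] by (simp add: power2_eq_square field_simps)
  qed
  also have "\<dots> = (2 * pi * \<i>) * integral {0..1} (\<lambda>t. h (circle \<rho> t) / circle \<rho> t)"
    by (rule integral_mult_right)
  finally show ?thesis by simp
qed

section \<open>Holomorphic functions on the ball\<close>

abbreviation total_deriv :: "(complex^'n \<Rightarrow> complex) \<Rightarrow> complex^'n \<Rightarrow> complex^'n \<Rightarrow> complex" where
  "total_deriv f z \<equiv> frechet_derivative f (at z)"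

lemma holomorphic_ball_total_deriv:
  assumes "holomorphic_ball f" "norm z < 1"
  shows "(f has_derivative total_deriv f z) (at z)" "total_deriv f z (c *s v) = c * total_deriv f z v"
proof -
  obtain f' where f': "(f has_derivative f') (at z)" "\<And>c v. f' (c *s v) = c * f' v"
    using bspec[OF assms(1)[unfolded holomorphic_ball_def], of z] assms(2) by auto
  have "total_deriv f z = f'" using frechet_derivative_at[OF f'(1)] by simp
  with f' show "(f has_derivative total_deriv f z) (at z)" "total_deriv f z (c *s v) = c * total_deriv f z v"
    by auto
qed

lemma holomorphic_ball_continuous_on:
  assumes "holomorphic_ball f" shows "continuous_on (ball 0 1) f"
  by (intro continuous_at_imp_continuous_on ballI)
     (auto intro: has_derivative_continuous[OF holomorphic_ball_total_deriv(1)[OF assms]])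

lemma line_has_field_derivative:
  assumes f: "holomorphic_ball f" and n: "norm (a + \<zeta> *s v) < 1"
  shows "((\<lambda>\<zeta>. f (a + \<zeta> *s v)) has_field_derivative total_deriv f (a + \<zeta> *s v) v) (at \<zeta>)"
proof -
  have bl: "bounded_linear (\<lambda>h. h *s v)"
    by (intro bounded_linear_intro[where K = "norm v"])
       (simp_all add: vec_eq_iff norm_cscale algebra_simps)
  have "((\<lambda>\<zeta>. a + \<zeta> *s v) has_derivative (\<lambda>h. h *s v)) (at \<zeta>)"
    using has_derivative_add_const[OF bounded_linear_imp_has_derivative[OF bl], of a] by (simp only: add.commute)
  from has_derivative_compose[OF this holomorphic_ball_total_deriv(1)[OF f n]]
  have "((\<lambda>\<zeta>. f (a + \<zeta> *s v)) has_derivative (\<lambda>h. total_deriv f (a + \<zeta> *s v) (h *s v))) (at \<zeta>)" .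
  moreover have "(\<lambda>h. total_deriv f (a + \<zeta> *s v) (h *s v)) = (*) (total_deriv f (a + \<zeta> *s v) v)"
    by (rule ext) (simp only: holomorphic_ball_total_deriv(2)[OF f n] mult.commute)
  ultimately show ?thesis by (simp only: has_field_derivative_def)
qed

lemma line_holomorphic_on:
  assumes f: "holomorphic_ball f" and n: "\<And>\<zeta>. \<zeta> \<in> S \<Longrightarrow> norm (a + \<zeta> *s v) < 1"
  shows "(\<lambda>\<zeta>. f (a + \<zeta> *s v)) holomorphic_on S"
  unfolding holomorphic_on_def field_differentiable_def
  using line_has_field_derivative[OF f n] has_field_derivative_at_within by blast

lemma deriv_line_0:
  assumes f: "holomorphic_ball f" and n: "norm z < 1"
  shows "deriv (\<lambda>\<zeta>. f (z + \<zeta> *s v)) 0 = total_deriv f z v"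
  using line_has_field_derivative[OF f, of z 0 v] n by (simp add: DERIV_imp_deriv)

lemma radial_deriv_eq_total_deriv:
  assumes f: "holomorphic_ball f" and n: "norm z < 1"
  shows "radial_deriv f z = total_deriv f z z"
proof -
  interpret linear "total_deriv f z"
    using holomorphic_ball_total_deriv(1)[OF f n] has_derivative_linear by blast
  have "partial_deriv j f z = total_deriv f z (axis j 1)" for j
  proof -
    have "(\<lambda>\<zeta>. f (z + axis j \<zeta>)) = (\<lambda>\<zeta>. f (z + \<zeta> *s axis j 1))"
      by (intro ext arg_cong[where f = f]) (simp add: vec_eq_iff axis_def)
    then show ?thesis
      unfolding partial_deriv_def using deriv_line_0[OF f n, of "axis j 1"] by (simp only:)
  qed
  then have "radial_deriv f z = (\<Sum>j\<in>UNIV. total_deriv f z (z $ j *s axis j 1))"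
    by (simp add: radial_deriv_def holomorphic_ball_total_deriv(2)[OF f n])
  also have "\<dots> = total_deriv f z (\<Sum>j\<in>UNIV. z $ j *s axis j 1)" by (simp add: sum)
  finally show ?thesis by (simp only: basis_expansion)
qed

lemma ray_has_field_derivative:
  assumes f: "holomorphic_ball f" and n: "norm (\<zeta> *s v) < 1" and "\<zeta> \<noteq> 0"
  shows "((\<lambda>\<zeta>. f (\<zeta> *s v)) has_field_derivative radial_deriv f (\<zeta> *s v) / \<zeta>) (at \<zeta>)"
  using line_has_field_derivative[OF f, of 0 \<zeta> v] n \<open>\<zeta> \<noteq> 0\<close>
  by (simp add: radial_deriv_eq_total_deriv[OF f n] holomorphic_ball_total_deriv(2)[OF f n])

lemma total_deriv_circle_integral:
  assumes f: "holomorphic_ball f" and \<rho>: "0 < \<rho>" "\<rho> < r"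
      and n: "\<And>\<zeta>. norm \<zeta> < r \<Longrightarrow> norm (z + \<zeta> *s v) < 1"
  shows "total_deriv f z v = integral {0..1} (\<lambda>t. f (z + circle \<rho> t *s v) / circle \<rho> t)"
proof -
  have "norm z < 1" using n[of 0] \<rho> by simp
  have "(\<lambda>\<zeta>. f (z + \<zeta> *s v)) holomorphic_on ball 0 r"
    by (intro line_holomorphic_on[OF f] n) auto
  from deriv_eq_circle_integral[OF this \<rho>] show ?thesis
    by (simp add: deriv_line_0[OF f \<open>norm z < 1\<close>])
qed

text \<open>
  By Cauchy's formula the derivative is locally an integral of \<open>f\<close> itself and so inherits its
  continuity.  Differentiability alone is assumed of a holomorphic function, whereas differentiation
  under the integral sign needs a continuous derivative.
\<close>

lemma continuous_on_total_deriv: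
  fixes v :: "complex^'n"
  assumes f: "holomorphic_ball f"
  shows "continuous_on (ball 0 1) (\<lambda>z. total_deriv f z v)"
proof (rule continuous_at_imp_continuous_on, rule ballI)
  fix z0 :: "complex^'n" assume z0: "z0 \<in> ball 0 1"
  define \<epsilon> where "\<epsilon> = (1 - norm z0) / 2"
  have \<epsilon>: "\<epsilon> > 0" using z0 by (simp add: \<epsilon>_def)
  define r where "r = \<epsilon> / (norm v + 1)"
  have r: "r > 0" "r * norm v \<le> \<epsilon>"
    using \<epsilon> by (auto simp: r_def field_simps add_pos_nonneg)
  have n: "norm (z + \<zeta> *s v) < 1" if "z \<in> ball z0 \<epsilon>" "norm \<zeta> < r" for z \<zeta>
  proof -
    have "norm (\<zeta> *s v) \<le> \<epsilon>"
      using r that mult_right_mono[of "norm \<zeta>" r "norm v"] by (simp add: norm_cscale)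
    moreover have "norm z < norm z0 + \<epsilon>"
      using that norm_triangle_ineq2[of z z0] by (simp add: dist_norm norm_minus_commute)
    ultimately show ?thesis using norm_triangle_ineq[of z "\<zeta> *s v"] unfolding \<epsilon>_def by (simp add: field_simps)
  qed
  have "continuous_on (ball z0 \<epsilon>) (\<lambda>z. integral (cbox 0 1) (\<lambda>t. f (z + circle (r/2) t *s v) / circle (r/2) t))"
  proof (rule integral_continuous_on_param)
    have "(\<lambda>(z, t). z + circle (r/2) t *s v) ` (ball z0 \<epsilon> \<times> cbox 0 1) \<subseteq> ball 0 1"
      using n r by (auto simp: norm_circle)
    then show "continuous_on (ball z0 \<epsilon> \<times> cbox 0 1) (\<lambda>(z, t). f (z + circle (r/2) t *s v) / circle (r/2) t)"
      unfolding case_prod_beta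
      by (intro continuous_intros continuous_on_compose2[OF holomorphic_ball_continuous_on[OF f]])
         (use r in \<open>auto simp: circle_nonzero case_prod_beta\<close>)
  qed
  then have "continuous_on (ball z0 \<epsilon>) (\<lambda>z. total_deriv f z v)"
    by (rule continuous_on_eq)
       (use r n in \<open>simp add: total_deriv_circle_integral[OF f, of "r/2" r]\<close>)
  then show "isCont (\<lambda>z. total_deriv f z v) z0"
    using \<epsilon> by (simp add: continuous_on_eq_continuous_at)
qed

text \<open>
  Near a point, \<open>\<R> f (z)\<close> is the average of \<open>f ((1 + u) z) / u\<close> over a small circle of \<open>u\<close>'s, and
  differentiation under this integral shows that \<open>\<R> f\<close> is again holomorphic.
\<close>

lemma holomorphic_radial_deriv:
  fixes f :: "complex^'n \<Rightarrow> complex"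
  assumes f: "holomorphic_ball f"
  shows "holomorphic_ball (radial_deriv f)"
  unfolding holomorphic_ball_def
proof
  fix z0 :: "complex^'n" assume z0: "z0 \<in> ball 0 1"
  define \<epsilon> where "\<epsilon> = (1 - norm z0) / 2"
  have \<epsilon>: "\<epsilon> > 0" using z0 by (simp add: \<epsilon>_def)
  define e where "e = circle (\<epsilon> / 2)"
  have e0: "e t \<noteq> 0" for t using circle_nonzero[of "\<epsilon>/2" t] \<epsilon> by (simp add: e_def)
  have e1: "norm (e t) < \<epsilon>" for t using norm_circle[of "\<epsilon>/2" t] \<epsilon> by (simp add: e_def)
  have e_cont [continuous_intros]: "continuous_on S (\<lambda>x. e (g x))" if "continuous_on S g" for S :: "'z::topological_space set" and g
    unfolding e_def by (intro continuous_intros that)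
  have n': "norm (z + \<zeta> *s z) < 1" if "z \<in> ball z0 \<epsilon>" "norm \<zeta> < \<epsilon>" for z \<zeta>
  proof -
    have 1: "norm z < norm z0 + \<epsilon>"
      using that norm_triangle_ineq2[of z z0] by (simp add: dist_norm norm_minus_commute)
    then have "norm z \<le> 1" unfolding \<epsilon>_def using z0 by (simp add: field_simps)
    then have "norm (\<zeta> *s z) \<le> \<epsilon>"
      using that \<epsilon> mult_mono[of "norm \<zeta>" \<epsilon> "norm z" 1] by (simp add: norm_cscale)
    with 1 show ?thesis using norm_triangle_ineq[of z "\<zeta> *s z"] unfolding \<epsilon>_def by (simp add: field_simps)
  qed
  have n1: "norm (z + e t *s z) < 1" if "z \<in> ball z0 \<epsilon>" for z t
    using n'[OF that e1] .
  define fx where "fx = (\<lambda>z t. Blinfun (\<lambda>v. total_deriv f (z + e t *s z) (v + e t *s v) / e t))"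
  have D: "((\<lambda>z. f (z + e t *s z) / e t) has_derivative
            (\<lambda>v. total_deriv f (z + e t *s z) (v + e t *s v) / e t)) (at z)"
    if "z \<in> ball z0 \<epsilon>" for z t
  proof -
    have bl: "bounded_linear (\<lambda>v. v + e t *s v :: complex^'n)"
      by (intro bounded_linear_intro[where K = "1 + norm (e t)"])
         (auto simp: vec_eq_iff norm_cscale algebra_simps intro: norm_triangle_ineq[THEN order_trans])
    from has_derivative_compose[OF bounded_linear_imp_has_derivative[OF bl]
           holomorphic_ball_total_deriv(1)[OF f n1[OF that, of t]]]
    have "((\<lambda>z. f (z + e t *s z)) has_derivative
            (\<lambda>v. total_deriv f (z + e t *s z) (v + e t *s v))) (at z)" .
    then show ?thesis
      by (rule bounded_linear.has_derivative[OF bounded_linear_divide])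
  qed
  have fx: "blinfun_apply (fx z t) = (\<lambda>v. total_deriv f (z + e t *s z) (v + e t *s v) / e t)"
    if "z \<in> ball z0 \<epsilon>" for z t
    unfolding fx_def using has_derivative_bounded_linear[OF D[OF that]] by (rule bounded_linear_Blinfun_apply)
  have fx': "blinfun_apply (fx z t) v = (1 + e t) / e t * total_deriv f (z + e t *s z) v"
    if "z \<in> ball z0 \<epsilon>" for z t v
  proof -
    have "v + e t *s v = (1 + e t) *s v" by (simp add: vec_eq_iff algebra_simps)
    then show ?thesis
      unfolding fx[OF that] by (simp only: holomorphic_ball_total_deriv(2)[OF f n1[OF that]] times_divide_eq_left)
  qed
  have maps: "(\<lambda>(z, t). z + e t *s z) ` (ball z0 \<epsilon> \<times> cbox 0 1) \<subseteq> ball 0 1"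
    using n1 by auto
  have cont: "continuous_on (ball z0 \<epsilon> \<times> cbox 0 1) (\<lambda>(z, t). fx z t)"
  proof (rule continuous_on_blinfun_componentwise)
    fix i :: "complex^'n"
    have "continuous_on (ball z0 \<epsilon> \<times> cbox 0 1)
       (\<lambda>p. (1 + e (snd p)) / e (snd p) * total_deriv f (fst p + e (snd p) *s fst p) i)"
      by (intro continuous_intros continuous_on_compose2[OF continuous_on_total_deriv[OF f]])
         (use maps e0 in \<open>auto simp: case_prod_beta\<close>)
    then show "continuous_on (ball z0 \<epsilon> \<times> cbox 0 1) (\<lambda>p. blinfun_apply (case p of (z, t) \<Rightarrow> fx z t) i)"
      by (rule continuous_on_eq) (auto simp: fx')
  qed
  have z0': "z0 \<in> ball z0 \<epsilon>" using \<epsilon> by simp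
  have int: "(\<lambda>t. f (z + e t *s z) / e t) integrable_on cbox 0 1" if "z \<in> ball z0 \<epsilon>" for z
    by (intro integrable_continuous continuous_intros continuous_on_compose2[OF holomorphic_ball_continuous_on[OF f]])
       (use e0 n1[OF that] in auto)
  have "((\<lambda>z. integral (cbox 0 1) (\<lambda>t. f (z + e t *s z) / e t)) has_derivative
         integral (cbox 0 1) (fx z0)) (at z0 within ball z0 \<epsilon>)"
    by (rule leibniz_rule[OF _ int cont z0'])
       (use D fx in \<open>auto intro: has_derivative_at_withinI\<close>)
  then have "((\<lambda>z. integral (cbox 0 1) (\<lambda>t. f (z + e t *s z) / e t)) has_derivative
         integral (cbox 0 1) (fx z0)) (at z0)"
    using z0' by (simp add: at_within_open[OF _ open_ball])
  then have "(radial_deriv f has_derivative integral (cbox 0 1) (fx z0)) (at z0)"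
  proof (rule has_derivative_transform_within_open[OF _ open_ball z0'])
    fix z assume z: "z \<in> ball z0 \<epsilon>"
    have "norm z < 1" using n'[OF z, of 0] \<epsilon> by simp
    then show "integral (cbox 0 1) (\<lambda>t. f (z + e t *s z) / e t) = radial_deriv f z"
      using total_deriv_circle_integral[OF f, of "\<epsilon>/2" \<epsilon> z z] n'[OF z] \<epsilon>
      by (simp add: radial_deriv_eq_total_deriv[OF f] e_def)
  qed
  moreover have "blinfun_apply (integral (cbox 0 1) (fx z0)) (c *s v) = c * blinfun_apply (integral (cbox 0 1) (fx z0)) v" for c v
  proof -
    have "fx z0 integrable_on cbox 0 1"
    proof (rule integrable_continuous)
      have "continuous_on (cbox 0 1) (\<lambda>t. (\<lambda>(z, t). fx z t) (z0, t))"
        by (rule continuous_on_compose2[OF cont]) (use z0' in \<open>auto intro!: continuous_intros\<close>)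
      then show "continuous_on (cbox 0 1) (fx z0)" by simp
    qed
    then show ?thesis
      by (simp add: blinfun_apply_integral fx'[OF z0'] n1[OF z0'] holomorphic_ball_total_deriv(2)[OF f] 
          mult.left_commute[of _ c] flip: integral_mult_right)
  qed
  ultimately show "\<exists>f'. (radial_deriv f has_derivative f') (at z0) \<and> (\<forall>c v. f' (c *s v) = c * f' v)"
    by blast
qed

lemma holomorphic_radial_deriv_iter:
  assumes "holomorphic_ball f" shows "holomorphic_ball ((radial_deriv ^^ m) f)"
  by (induction m) (auto intro: holomorphic_radial_deriv assms)

lemma radial_deriv_0 [simp]: "radial_deriv f 0 = 0"
  by (simp add: radial_deriv_def)

lemma radial_deriv_diff_const: "radial_deriv (\<lambda>z. f z - c) = radial_deriv f"
proof -
  have "deriv (\<lambda>\<zeta>. g \<zeta> - c) x = deriv g x" for g :: "complex \<Rightarrow> complex" and x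
  proof -
    have "((\<lambda>\<zeta>. g \<zeta> - c) has_field_derivative D) (at x) \<longleftrightarrow> (g has_field_derivative D) (at x)" for D
      using DERIV_diff[OF _ DERIV_const[of c]] DERIV_add[OF _ DERIV_const[of c], of "\<lambda>\<zeta>. g \<zeta> - c"] by auto
    then show ?thesis by (simp add: deriv_def)
  qed
  then show ?thesis
    by (simp add: radial_deriv_def[abs_def] partial_deriv_def[abs_def])
qed

lemma radial_deriv_iter_diff_const:
  assumes "m > 0" shows "(radial_deriv ^^ m) (\<lambda>z. f z - c) = (radial_deriv ^^ m) f"
  using assms by (cases m) (simp_all add: funpow_swap1 radial_deriv_diff_const)

lemma holomorphic_ball_diff_const:
  assumes "holomorphic_ball f" shows "holomorphic_ball (\<lambda>z. f z - c)"
  using assms unfolding holomorphic_ball_def by (fastforce intro: derivative_eq_intros)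

section \<open>A mean value inequality for all exponents\<close>

lemma powr_le_imp_le:
  fixes x y p :: real
  assumes "x powr p \<le> y powr p" "p > 0" "0 \<le> x" "0 \<le> y" shows "x \<le> y"
  using assms powr_less_mono2[of p y x] by force

lemma powr_le_comparable:
  fixes a b c \<alpha> :: real
  assumes "0 < a" "0 < b" "a \<le> c * b" "b \<le> c * a"
  shows "a powr \<alpha> \<le> c powr \<bar>\<alpha>\<bar> * b powr \<alpha>"
proof -
  have c: "c > 0" using assms by (metis less_le_trans zero_less_mult_pos2)
  show ?thesis
  proof (cases "\<alpha> \<ge> 0")
    case True
    then have "a powr \<alpha> \<le> (c * b) powr \<alpha>" using assms by (intro powr_mono2) auto
    then show ?thesis using True c assms by (simp add: powr_mult)
  next
    case False
    then have "a powr \<alpha> \<le> (b / c) powr \<alpha>"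
      using assms c by (intro powr_mono2') (auto simp: field_simps)
    also have "\<dots> = c powr \<bar>\<alpha>\<bar> * b powr \<alpha>"
      using False c assms by (simp add: powr_divide powr_minus_divide)
    finally show ?thesis .
  qed
qed

text \<open>
  The factor \<open>2 powr p\<close> accounts for halving \<open>|f|\<close>, and \<open>L = 2 powr (d / p)\<close> is the growth allowed on the
  inner ball, whose radius, and hence the \<open>d\<close>-th root of whose volume, shrinks in proportion to \<open>1 / L\<close>.
\<close>

definition mean_const :: "nat \<Rightarrow> real \<Rightarrow> real" where
  "mean_const d p = 2 powr p * (32 * 2 powr (real d / p)) ^ d"

lemma mean_const_pos: "mean_const d p > 0"
  unfolding mean_const_def by (intro mult_pos_pos zero_less_power) auto

text \<open>
  For \<open>p < 1\<close> the usual averaging argument is not available.  Instead let \<open>a\<close> maximise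
  \<open>|f (w + v)|\<^sup>p (1/4 - \<parallel>v\<parallel>)\<^sup>d\<close>, with the anisotropic norm at \<open>w\<close> and \<open>d\<close> the real dimension.  On the
  ball about \<open>a\<close> with half the remaining radius, \<open>f\<close> is at most a constant times \<open>|f (w + a)|\<close>, so that
  by Cauchy's estimate \<open>|f|\<close> stays above half of this value on a fixed fraction of the ball.  The
  volume of that smaller ball makes up for the factor \<open>(1/4 - \<parallel>a\<parallel>)\<^sup>d\<close>.
\<close>

lemma mean_value_inequality:
  fixes f :: "complex^'n \<Rightarrow> complex"
  assumes f: "holomorphic_ball f" and w: "norm w < 1" and p: "p > 0"
  shows "ennreal (norm (f w) powr p) \<le> ennreal (mean_const DIM(complex^'n) p / aniso_vol w) *
           (\<integral>\<^sup>+u. indicator (aniso_ball w w (1/4)) u * ennreal (norm (f u) powr p) \<partial>lborel)"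
proof (cases "f w = 0")
  case False
  define d where "d = DIM(complex^'n)"
  define N where "N = aniso w"
  have N0: "N 0 = 0" and Npos: "N v \<ge> 0" and Ntri: "N (u + v) \<le> N u + N v"
    and Nsc: "N (c *s v) = norm c * N v" for u v c
    using w by (simp_all add: N_def aniso_nonneg aniso_triangle aniso_cscale)
  have inball: "norm (w + v) < 1" if "N v \<le> 1/4" for v
    using region_of_aniso_le[OF w, of v] that bergman_regionD(1) unfolding N_def by blast
  define S where "S = {v. N v \<le> 1/4}"
  have "0 \<in> S" using N0 by (simp add: S_def)
  then have "S \<noteq> {}" by blast
  have "compact S"
    unfolding compact_eq_bounded_closed
  proof
    show "bounded S" unfolding bounded_iff S_def N_def
      using norm_le_aniso[OF w] order_trans by blast
    show "closed S"
      unfolding S_def N_def by (intro closed_Collect_le continuous_on_aniso w continuous_intros)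
  qed
  moreover have "continuous_on S (\<lambda>v. norm (f (w + v)) powr p * (1/4 - N v) ^ d)"
    unfolding N_def
    by (intro continuous_intros continuous_on_powr' continuous_on_aniso w
          continuous_on_compose2[OF holomorphic_ball_continuous_on[OF f]])
       (use inball p in \<open>auto simp: S_def\<close>)
  ultimately obtain a where a: "a \<in> S" and amax: "\<And>v. v \<in> S \<Longrightarrow>
      norm (f (w + v)) powr p * (1/4 - N v) ^ d \<le> norm (f (w + a)) powr p * (1/4 - N a) ^ d"
    using continuous_attains_sup[of S "\<lambda>v. norm (f (w + v)) powr p * (1/4 - N v) ^ d"] \<open>S \<noteq> {}\<close> by blast
  define F where "F = norm (f (w + a))"
  define s where "s = (1/4 - N a) / 2"
  have "d > 0" by (simp add: d_def)
  have s2: "1/4 - N a = 2 * s" by (simp add: s_def)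
  have m0: "norm (f w) powr p * (1/4) ^ d \<le> F powr p * (2 * s) ^ d"
    using amax[of 0] N0 by (simp add: S_def F_def s2)
  have "0 < norm (f w) powr p * (1/4) ^ d" using False p by simp
  then have nz: "F powr p * (2 * s) ^ d \<noteq> 0" using m0 by linarith
  have "s \<ge> 0" using a by (simp add: s_def S_def)
  moreover have "s \<noteq> 0" using nz \<open>d > 0\<close> by (metis mult_zero_right power_0_left less_irrefl)
  ultimately have s: "s > 0" by simp
  have "F \<noteq> 0" using nz by (metis mult_zero_left powr_0)
  then have F: "F > 0" by (simp add: F_def)
  (* Halving the distance to the boundary costs a factor 2^d in |f|^p, that is, L in |f|. *)
  define L where "L = 2 powr (real d / p)"
  have L: "L \<ge> 1" unfolding L_def using p by (intro ge_one_powr_ge_zero) auto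
  have Lp: "L powr p = 2 ^ d" using p by (simp add: L_def powr_powr powr_realpow)
  have upper: "norm (f (w + v)) \<le> L * F" if "N (v - a) < s" for v
  proof -
    have "N v < N a + s" using Ntri[of a "v - a"] that by simp
    then have Nv: "s < 1/4 - N v" using s2 by linarith
    have "norm (f (w + v)) powr p * s ^ d \<le> norm (f (w + v)) powr p * (1/4 - N v) ^ d"
      using Nv s by (intro mult_left_mono power_mono) auto
    also have "\<dots> \<le> F powr p * (2 * s) ^ d"
      using amax[of v] Nv s by (simp add: S_def F_def s2)
    also have "\<dots> = (L * F) powr p * s ^ d"
    proof -
      have "(L * F) powr p = 2 ^ d * F powr p" using L F by (simp only: powr_mult Lp)
      then show ?thesis by (simp only: power_mult_distrib mult_ac)
    qed
    finally have "norm (f (w + v)) powr p \<le> (L * F) powr p"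
      by (rule mult_right_le_imp_le) (use s in simp)
    from powr_le_imp_le[OF this p] show ?thesis using L F by simp
  qed
  have lower: "F / 2 \<le> norm (f (w + v))" if v: "N (v - a) < s / (4 * L)" for v
  proof (cases "N (v - a) = 0")
    case True
    then have "v = a" using norm_le_aniso[OF w, of "v - a"] by (simp add: N_def)
    then show ?thesis using F by (simp add: F_def)
  next
    case False
    define \<tau> where "\<tau> = N (v - a)"
    have \<tau>: "\<tau> > 0" using False Npos[of "v - a"] by (simp add: \<tau>_def)
    have \<tau>s: "4 * L * \<tau> < s" using v L by (simp add: \<tau>_def field_simps)
    moreover have "\<tau> \<le> L * \<tau>" using L \<tau> by simp
    ultimately have "4 * \<tau> < s" by (simp add: mult.assoc)
    define h where "h = (\<lambda>\<zeta>. f ((w + a) + \<zeta> *s (v - a)))"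
    have small: "N (\<zeta> *s (v - a)) < s" if "norm \<zeta> < s / \<tau>" for \<zeta>
      unfolding Nsc \<tau>_def[symmetric] using that \<tau> by (simp only: pos_less_divide_eq)
    have "h holomorphic_on ball 0 (s / \<tau>)"
      unfolding h_def
    proof (rule line_holomorphic_on[OF f])
      fix \<zeta> :: complex assume "\<zeta> \<in> ball 0 (s / \<tau>)"
      then have "N (a + \<zeta> *s (v - a)) \<le> 1/4"
        using small[of \<zeta>] Ntri[of a "\<zeta> *s (v - a)"] s s2 by auto
      from inball[OF this] show "norm (w + a + \<zeta> *s (v - a)) < 1" by (simp add: add.assoc)
    qed
    moreover have "norm (h \<zeta>) \<le> L * F" if "norm \<zeta> < s / \<tau>" for \<zeta>
      using upper[of "a + \<zeta> *s (v - a)"] small[OF that] by (simp add: h_def add.assoc)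
    ultimately have "norm (h 1 - h 0) \<le> 2 * (L * F) / (s / \<tau>) * norm (1::complex)"
      using s \<tau> \<open>4 * \<tau> < s\<close> by (intro disc_bounds(2)) (auto simp: field_simps)
    also have "\<dots> = (4 * L * \<tau>) * (F / (2 * s))" by simp
    also have "\<dots> \<le> s * (F / (2 * s))" using \<tau>s F s by (intro mult_right_mono) auto
    also have "\<dots> = F / 2" using s by simp
    finally have "norm (h 1 - h 0) \<le> F / 2" .
    moreover have "norm (h 0) = F" "h 1 = f (w + v)" by (simp_all add: h_def F_def)
    ultimately show ?thesis using norm_triangle_ineq2[of "h 0" "h 1"] by (simp add: norm_minus_commute)
  qed
  define B where "B = aniso_ball w (w + a) (s / (4 * L))"
  have [measurable]: "B \<in> sets borel" by (simp add: B_def)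
  have sub: "B \<subseteq> aniso_ball w w (1/4)"
  proof
    fix u assume "u \<in> B"
    then have "N (u - (w + a)) < s / (4 * L)" by (simp add: B_def aniso_ball_def N_def)
    also have "\<dots> \<le> s" using s L by (simp add: divide_le_eq mult_le_cancel_left1)
    finally have "N (u - w) < N a + s" using Ntri[of a "u - (w + a)"] by (simp add: algebra_simps)
    then show "u \<in> aniso_ball w w (1/4)" using s s2 by (simp add: aniso_ball_def N_def)
  qed
  have V: "aniso_vol w > 0" by (rule emeasure_aniso_ball_1(2)[OF w])
  have "ennreal ((F / 2) powr p * ((s / (4 * L)) ^ d * aniso_vol w)) = (\<integral>\<^sup>+u. ennreal ((F / 2) powr p) * indicator B u \<partial>lborel)"
    using emeasure_aniso_ball[OF w, of "s / (4 * L)" "w + a"] s L V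
    by (simp add: nn_integral_cmult B_def d_def ennreal_mult)
  also have "\<dots> \<le> (\<integral>\<^sup>+u. indicator (aniso_ball w w (1/4)) u * ennreal (norm (f u) powr p) \<partial>lborel)"
  proof (rule nn_integral_mono)
    fix u
    show "ennreal ((F / 2) powr p) * indicator B u \<le> indicator (aniso_ball w w (1/4)) u * ennreal (norm (f u) powr p)"
    proof (cases "u \<in> B")
      case True
      then have "N ((u - w) - a) < s / (4 * L)" by (simp add: B_def aniso_ball_def N_def diff_diff_eq)
      from lower[OF this] have "(F / 2) powr p \<le> norm (f u) powr p"
        using F p by (intro powr_mono2) auto
      then show ?thesis using True sub by (auto simp: indicator_def intro: ennreal_leI)
    qed auto
  qed
  finally have low: "ennreal ((F / 2) powr p * ((s / (4 * L)) ^ d * aniso_vol w))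
     \<le> (\<integral>\<^sup>+u. indicator (aniso_ball w w (1/4)) u * ennreal (norm (f u) powr p) \<partial>lborel)" .
  have e1: "(1/4::real) ^ d * 4 ^ d = 1" by (simp only: power_mult_distrib[symmetric]) simp
  have e2: "(2 * s) ^ d * 4 ^ d = (8 * s) ^ d" by (simp only: power_mult_distrib[symmetric]) simp
  have "32 * L * (s / (4 * L)) = 8 * s" using L by simp
  then have e3: "(32 * L) ^ d * (s / (4 * L)) ^ d = (8 * s) ^ d" by (simp only: power_mult_distrib[symmetric])
  have e4: "2 powr p * (F / 2) powr p = F powr p" using F by (simp add: powr_divide)
  have "norm (f w) powr p = norm (f w) powr p * (1/4) ^ d * 4 ^ d"
    by (simp only: mult.assoc e1 mult_1_right)
  also have "\<dots> \<le> F powr p * (2 * s) ^ d * 4 ^ d"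
    using m0 by (intro mult_right_mono) auto
  also have "\<dots> = F powr p * (8 * s) ^ d" by (simp only: mult.assoc e2)
  also have "\<dots> = (2 powr p * (F / 2) powr p) * ((32 * L) ^ d * (s / (4 * L)) ^ d) * (1 / aniso_vol w * aniso_vol w)"
    unfolding e3 e4 using V by simp
  also have "\<dots> = (2 powr p * (32 * L) ^ d / aniso_vol w) * ((F / 2) powr p * ((s / (4 * L)) ^ d * aniso_vol w))"
    by (simp only: divide_inverse mult_ac mult_1_left)
  finally have "ennreal (norm (f w) powr p) \<le> ennreal (2 powr p * (32 * L) ^ d / aniso_vol w) *
       ennreal ((F / 2) powr p * ((s / (4 * L)) ^ d * aniso_vol w))"
    using V L s by (subst ennreal_mult[symmetric]) (auto intro: ennreal_leI)
  also have "\<dots> \<le> ennreal (2 powr p * (32 * L) ^ d / aniso_vol w) *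
      (\<integral>\<^sup>+u. indicator (aniso_ball w w (1/4)) u * ennreal (norm (f u) powr p) \<partial>lborel)"
    by (intro mult_left_mono low) auto
  finally show ?thesis by (simp add: mean_const_def L_def d_def)
qed (use p in simp)

section \<open>Averages over Bergman balls\<close>

text \<open>
  Functions are unconstrained outside the ball; cutting off there makes \<open>|f|\<^sup>p\<close> Borel measurable on
  the whole space.
\<close>

definition pth_power :: "real \<Rightarrow> (complex^'n \<Rightarrow> complex) \<Rightarrow> complex^'n \<Rightarrow> ennreal" where
  "pth_power p f u = indicator (ball 0 1) u * ennreal (norm (f u) powr p)"

text \<open>
  The volume by which the average is normalised is that at the variable point \<open>u\<close>.  On a Bergman ball
  it is comparable to the volume at \<open>z\<close>, and under the integral it interchanges well.
\<close>

definition local_avg :: "real \<Rightarrow> (complex^'n \<Rightarrow> ennreal) \<Rightarrow> complex^'n \<Rightarrow> ennreal" where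
  "local_avg K G z = (\<integral>\<^sup>+u. indicator (bergman_region K z) u * (G u * ennreal (1 / aniso_vol u)) \<partial>lborel)"

lemma borel_measurable_holomorphic_ball:
  assumes "holomorphic_ball f"
  shows "(\<lambda>u. indicator (ball 0 1) u *\<^sub>R f u) \<in> borel_measurable borel"
  by (intro borel_measurable_continuous_on_indicator holomorphic_ball_continuous_on assms) auto

lemma borel_measurable_pth_power:
  fixes f :: "complex^'n \<Rightarrow> complex"
  assumes "holomorphic_ball f"
  shows "pth_power p f \<in> borel_measurable borel"
proof -
  define g where "g = (\<lambda>u. indicator (ball 0 1) u *\<^sub>R f u)"
  have [measurable]: "g \<in> borel_measurable borel" "ball (0 :: complex^'n) 1 \<in> sets borel"
    unfolding g_def by (auto intro: borel_measurable_holomorphic_ball[OF assms])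
  have "(\<lambda>u. indicator (ball 0 1) u * ennreal (norm (g u) powr p)) \<in> borel_measurable borel"
    by measurable
  also have "(\<lambda>u. indicator (ball 0 1) u * ennreal (norm (g u) powr p)) = pth_power p f"
    by (auto simp: fun_eq_iff pth_power_def g_def indicator_def)
  finally show ?thesis .
qed

lemma borel_measurable_bergman_region:
  "(\<lambda>(z, u). indicator (bergman_region K z) u :: ennreal) \<in> borel_measurable (borel \<Otimes>\<^sub>M borel)"
proof -
  have "{p \<in> space (borel \<Otimes>\<^sub>M borel). norm (snd p) < 1 \<and>
          (norm (1 - herm (snd p) (fst p)))\<^sup>2 < K * defect (fst p) * defect (snd p :: complex^'n)} \<in> sets (borel \<Otimes>\<^sub>M borel)"
    by measurable
  then have [measurable]: "{p. norm (snd p) < 1 \<and>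
          (norm (1 - herm (snd p) (fst p)))\<^sup>2 < K * defect (fst p) * defect (snd p :: complex^'n)} \<in> sets (borel \<Otimes>\<^sub>M borel)"
    by (simp add: space_pair_measure)
  have "indicator {p. norm (snd p) < 1 \<and>
          (norm (1 - herm (snd p) (fst p)))\<^sup>2 < K * defect (fst p) * defect (snd p :: complex^'n)}
          \<in> borel_measurable (borel \<Otimes>\<^sub>M borel)" by measurable
  also have "indicator {p. norm (snd p) < 1 \<and>
          (norm (1 - herm (snd p) (fst p)))\<^sup>2 < K * defect (fst p) * defect (snd p :: complex^'n)}
      = (\<lambda>(z, u). indicator (bergman_region K z) u :: ennreal)"
    by (auto simp: fun_eq_iff indicator_def bergman_region_def)
  finally show ?thesis .
qed

lemma borel_measurable_local_avg:
  fixes G :: "complex^'n \<Rightarrow> ennreal"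
  assumes [measurable]: "G \<in> borel_measurable borel"
  shows "local_avg K G \<in> borel_measurable borel"
proof -
  note [measurable] = borel_measurable_bergman_region[of K]
  have "(\<lambda>(z, u). (\<lambda>(z, u). indicator (bergman_region K z) u) (z, u) * (G u * ennreal (1 / aniso_vol u)))
          \<in> borel_measurable (borel \<Otimes>\<^sub>M lborel)" by measurable
  then have "(\<lambda>z. \<integral>\<^sup>+u. (\<lambda>(z, u). indicator (bergman_region K z) u) (z, u) * (G u * ennreal (1 / aniso_vol u)) \<partial>lborel)
          \<in> borel_measurable borel"
    by (intro lborel.borel_measurable_nn_integral) (simp add: case_prod_beta)
  then show ?thesis by (simp add: local_avg_def[abs_def])
qed

text \<open>
  The second factor bounds \<open>aniso_vol u / aniso_vol w\<close> for \<open>u\<close> in the region \<open>K = 4\<close> about \<open>w\<close>.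
\<close>

definition avg_const :: "nat \<Rightarrow> real \<Rightarrow> real" where
  "avg_const d p = mean_const d p * (10240000 * 4 ^ 3) ^ d"

lemma avg_const_pos: "avg_const d p > 0"
  by (simp add: avg_const_def mean_const_pos)

text \<open>
  One average at \<open>z\<close> controls \<open>|f|\<^sup>p\<close> at all points \<open>w\<close> of a Bergman ball about \<open>z\<close> simultaneously, since
  the anisotropic balls about these \<open>w\<close> lie in a common larger Bergman ball.  This is what replaces a
  supremum by an integral, to which Tonelli's theorem applies.
\<close>

lemma pth_power_le_local_avg:
  fixes f :: "complex^'n \<Rightarrow> complex"
  assumes f: "holomorphic_ball f" and p: "p > 0" and K: "K \<ge> 1"
      and z: "norm z < 1" and w: "w \<in> bergman_region K z"
  shows "ennreal (norm (f w) powr p) \<le> ennreal (avg_const DIM(complex^'n) p) * local_avg (640000 * K ^ 3) (pth_power p f) z"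
proof -
  define c where "c = (10240000 * 4 ^ 3 :: real) ^ DIM(complex^'n)"
  define C where "C = mean_const DIM(complex^'n) p"
  define L where "L = 10000 * K^3 * 4^3"
  have C: "C > 0" by (simp add: C_def mean_const_pos)
  have c: "c > 0" by (simp add: c_def)
  note w1 = bergman_regionD(1)[OF w]
  have Vw: "aniso_vol w > 0" by (rule emeasure_aniso_ball_1(2)[OF w1])
  note [measurable] = borel_measurable_pth_power[OF f, of p]
  have "ennreal (C / aniso_vol w) * (\<integral>\<^sup>+u. indicator (aniso_ball w w (1/4)) u * ennreal (norm (f u) powr p) \<partial>lborel)
     = ennreal (C / aniso_vol w) * (\<integral>\<^sup>+u. indicator (aniso_ball w w (1/4)) u * pth_power p f u \<partial>lborel)"
  proof (rule arg_cong2[where f="(*)", OF refl], rule nn_integral_cong)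
    fix u
    have "u \<in> aniso_ball w w (1/4) \<Longrightarrow> norm u < 1"
      using aniso_ball_subset_region[OF w1, of "1/4"] bergman_regionD(1)[of u 4 w] by auto
    then show "indicator (aniso_ball w w (1/4)) u * ennreal (norm (f u) powr p)
        = indicator (aniso_ball w w (1/4)) u * pth_power p f u"
      by (simp add: indicator_def pth_power_def)
  qed
  also have "\<dots> = (\<integral>\<^sup>+u. ennreal (C / aniso_vol w) * (indicator (aniso_ball w w (1/4)) u * pth_power p f u) \<partial>lborel)"
    by (rule nn_integral_cmult[symmetric]) measurable
  also have "\<dots> \<le> (\<integral>\<^sup>+u. ennreal (C * c) * (indicator (bergman_region L z) u * (pth_power p f u * ennreal (1 / aniso_vol u))) \<partial>lborel)"
  proof (rule nn_integral_mono)
    fix u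
    show "ennreal (C / aniso_vol w) * (indicator (aniso_ball w w (1/4)) u * pth_power p f u)
       \<le> ennreal (C * c) * (indicator (bergman_region L z) u * (pth_power p f u * ennreal (1 / aniso_vol u)))"
    proof (cases "u \<in> aniso_ball w w (1/4)")
      case True
      then have u4: "u \<in> bergman_region 4 w" using aniso_ball_subset_region[OF w1, of "1/4"] by auto
      then have uL: "u \<in> bergman_region L z"
        using bergman_region_trans[OF w u4 z K] by (simp add: L_def)
      have Vu: "aniso_vol u > 0" by (rule emeasure_aniso_ball_1(2)[OF bergman_regionD(1)[OF u4]])
      have "aniso_vol u \<le> c * aniso_vol w"
        using aniso_vol_comparable[OF u4 w1] by (simp add: c_def)
      then have "C / aniso_vol w \<le> (C * c) * (1 / aniso_vol u)"
        using Vu Vw C by (simp add: field_simps)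
      then have "ennreal (C / aniso_vol w) \<le> ennreal (C * c) * ennreal (1 / aniso_vol u)"
        using C c Vu by (subst ennreal_mult[symmetric]) (auto intro: ennreal_leI)
      from mult_right_mono[OF this, of "pth_power p f u"] show ?thesis
        using True uL by (simp add: mult_ac)
    qed auto
  qed
  also have "\<dots> = ennreal (C * c) * local_avg L (pth_power p f) z"
    unfolding local_avg_def by (intro nn_integral_cmult) measurable
  finally show ?thesis
    using mean_value_inequality[OF f w1 p] by (simp add: C_def c_def L_def avg_const_def)
qed

abbreviation ball_integral :: "real \<Rightarrow> (complex^'n \<Rightarrow> ennreal) \<Rightarrow> ennreal" where
  "ball_integral \<alpha> H \<equiv> (\<integral>\<^sup>+z. indicator (ball 0 1) z * ennreal (defect z powr \<alpha>) * H z \<partial>lborel)"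

text \<open>
  Interchanging the integrals leaves the integral of \<open>(1 - |z|\<^sup>2)\<^sup>\<alpha>\<close> over those \<open>z\<close> whose Bergman
  ball contains \<open>u\<close>, that is, over a Bergman ball about \<open>u\<close>.
\<close>

lemma nn_integral_local_avg_le:
  fixes \<alpha> K :: real
  assumes K: "K \<ge> 1"
  obtains C where "C > 0"
    "\<And>G :: complex^'n \<Rightarrow> ennreal. G \<in> borel_measurable borel \<Longrightarrow>
      ball_integral \<alpha> (local_avg K G)
       \<le> ennreal C * ball_integral \<alpha> G"
proof -
  define c where "c = (4 * K) powr \<bar>\<alpha>\<bar>"
  define V where "V = (4 * K) ^ DIM(complex^'n)"
  have c: "c > 0" and V: "V > 0" using K by (auto simp: c_def V_def)
  have "ball_integral \<alpha> (local_avg K G)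
       \<le> ennreal (c * V) * ball_integral \<alpha> G"
    if G [measurable]: "G \<in> borel_measurable borel" for G :: "complex^'n \<Rightarrow> ennreal"
  proof -
    note [measurable] = borel_measurable_bergman_region[of K]
    have [measurable]: "ball (0 :: complex^'n) 1 \<in> sets borel" by simp
    define I where "I = (\<lambda>(z :: complex^'n, u). indicator (bergman_region K z) u :: ennreal)"
    have I [measurable]: "I \<in> borel_measurable (borel \<Otimes>\<^sub>M (borel :: (complex^'n) measure))"
      unfolding I_def by measurable
    define H where "H = (\<lambda>z u. indicator (ball 0 1) z * ennreal (defect z powr \<alpha>) * (I (z, u) * (G u * ennreal (1 / aniso_vol u))))"
    have "ball_integral \<alpha> (local_avg K G)
        = (\<integral>\<^sup>+z. (\<integral>\<^sup>+u. H z u \<partial>lborel) \<partial>lborel)"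
      unfolding local_avg_def H_def
      by (intro nn_integral_cong) (subst nn_integral_cmult, auto simp: I_def)
    also have "\<dots> = (\<integral>\<^sup>+u. (\<integral>\<^sup>+z. H z u \<partial>lborel) \<partial>lborel)"
      unfolding H_def by (rule lborel_pair.Fubini'[symmetric]) measurable
    also have "\<dots> \<le> (\<integral>\<^sup>+u. ennreal (c * V) * (indicator (ball 0 1) u * ennreal (defect u powr \<alpha>) * G u) \<partial>lborel)"
    proof (rule nn_integral_mono)
      fix u :: "complex^'n"
      show "(\<integral>\<^sup>+z. H z u \<partial>lborel) \<le> ennreal (c * V) * (indicator (ball 0 1) u * ennreal (defect u powr \<alpha>) * G u)"
      proof (cases "norm u < 1")
        case False
        then have "H z u = 0" for z by (auto simp: H_def I_def indicator_def bergman_region_def)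
        then show ?thesis by simp
      next
        case True
        have Vu: "aniso_vol u > 0" by (rule emeasure_aniso_ball_1(2)[OF True])
        have "(\<integral>\<^sup>+z. H z u \<partial>lborel) \<le>
           (\<integral>\<^sup>+z. (ennreal (c * defect u powr \<alpha>) * (G u * ennreal (1 / aniso_vol u))) * indicator (bergman_region K u) z \<partial>lborel)"
        proof (rule nn_integral_mono)
          fix z
          show "H z u \<le> (ennreal (c * defect u powr \<alpha>) * (G u * ennreal (1 / aniso_vol u))) * indicator (bergman_region K u) z"
          proof (cases "norm z < 1 \<and> u \<in> bergman_region K z")
            case zu: True
            then have z: "z \<in> bergman_region K u" using bergman_region_sym by blast
            have "defect z powr \<alpha> \<le> c * defect u powr \<alpha>"
              unfolding c_def using zu True bergman_region_defect_le[of u K z] bergman_region_defect_ge[of u K z]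
              by (intro powr_le_comparable defect_pos) auto
            then have "ennreal (defect z powr \<alpha>) \<le> ennreal (c * defect u powr \<alpha>)" by (rule ennreal_leI)
            from mult_right_mono[OF this, of "G u * ennreal (1 / aniso_vol u)"]
            show ?thesis using zu z by (simp add: H_def I_def)
          qed (auto simp: H_def I_def indicator_def)
        qed
        also have "\<dots> = (ennreal (c * defect u powr \<alpha>) * (G u * ennreal (1 / aniso_vol u))) * emeasure lborel (bergman_region K u)"
          by (simp add: nn_integral_cmult)
        also have "\<dots> \<le> (ennreal (c * defect u powr \<alpha>) * (G u * ennreal (1 / aniso_vol u))) * ennreal (V * aniso_vol u)"
          unfolding V_def by (intro mult_left_mono emeasure_bergman_region_le True K) auto
        also have "\<dots> = (ennreal (c * defect u powr \<alpha>) * (ennreal (1 / aniso_vol u) * ennreal (V * aniso_vol u))) * G u"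
          by (simp add: mult_ac)
        also have "ennreal (c * defect u powr \<alpha>) * (ennreal (1 / aniso_vol u) * ennreal (V * aniso_vol u))
            = ennreal (c * V) * ennreal (defect u powr \<alpha>)"
          using Vu V c by (simp add: mult_ac flip: ennreal_mult)
        finally show ?thesis using True by (simp add: mult_ac)
      qed
    qed
    also have "\<dots> = ennreal (c * V) * ball_integral \<alpha> G"
      by (intro nn_integral_cmult) measurable
    finally show ?thesis .
  qed
  then show ?thesis using that[of "c * V"] c V by simp
qed

section \<open>Domination up to constants\<close>

text \<open>
  All estimates between integrals hold with a constant that is uniform over a class \<open>F\<close> of
  functions.  Both sides may be infinite.
\<close>

definition dominated :: "'f set \<Rightarrow> ('f \<Rightarrow> ennreal) \<Rightarrow> ('f \<Rightarrow> ennreal) \<Rightarrow> bool" where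
  "dominated F A B \<longleftrightarrow> (\<exists>C>0. \<forall>f\<in>F. A f \<le> ennreal C * B f)"

lemma dominatedI:
  assumes "C > 0" "\<And>f. f \<in> F \<Longrightarrow> A f \<le> ennreal C * B f" shows "dominated F A B"
  using assms unfolding dominated_def by blast

lemma dominated_refl: "dominated F A A"
  by (rule dominatedI[of 1]) auto

lemma dominated_trans:
  assumes "dominated F A B" "dominated F B D" shows "dominated F A D"
proof -
  obtain a b where a: "a > 0" "\<forall>f\<in>F. A f \<le> ennreal a * B f" and b: "b > 0" "\<forall>f\<in>F. B f \<le> ennreal b * D f"
    using assms unfolding dominated_def by blast
  have "A f \<le> ennreal (a * b) * D f" if "f \<in> F" for f
  proof -
    have "A f \<le> ennreal a * (ennreal b * D f)"
      using a b that by (meson mult_left_mono order_trans zero_le)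
    then show ?thesis using a b by (simp add: ennreal_mult mult.assoc)
  qed
  then show ?thesis using a b by (intro dominatedI[of "a * b"]) auto
qed

lemma dominated_compose:
  assumes "dominated F A B" "\<And>f. f \<in> G \<Longrightarrow> T f \<in> F"
  shows "dominated G (\<lambda>f. A (T f)) (\<lambda>f. B (T f))"
  using assms unfolding dominated_def by blast

lemma dominated_cmult:
  assumes "dominated F A B" "M > 0"
  shows "dominated F (\<lambda>f. ennreal M * A f) B" "dominated F A (\<lambda>f. ennreal M * B f)"
proof -
  obtain C where C: "C > 0" "\<forall>f\<in>F. A f \<le> ennreal C * B f" using assms unfolding dominated_def by blast
  have "ennreal M * A f \<le> ennreal (M * C) * B f" if "f \<in> F" for f
    using C that assms(2) by (simp add: ennreal_mult mult.assoc mult_left_mono)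
  then show "dominated F (\<lambda>f. ennreal M * A f) B" using C assms(2) by (intro dominatedI[of "M * C"]) auto
  have "ennreal (C / M) * (ennreal M * B f) = ennreal C * B f" for f
    using C assms(2) by (simp add: mult.assoc[symmetric] flip: ennreal_mult)
  then show "dominated F A (\<lambda>f. ennreal M * B f)" using C assms(2) by (intro dominatedI[of "C / M"]) auto
qed

lemma dominated_finite:
  assumes "dominated F A B" "f \<in> F" "B f < \<infinity>" shows "A f < \<infinity>"
proof -
  obtain C where "A f \<le> ennreal C * B f" using assms unfolding dominated_def by blast
  then show ?thesis using assms(3) by (auto simp: ennreal_mult_less_top elim!: le_less_trans)
qed

abbreviation holomorphic_functions :: "(complex^'n \<Rightarrow> complex) set" where
  "holomorphic_functions \<equiv> {f. holomorphic_ball f}"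

abbreviation holomorphic_functions0 :: "(complex^'n \<Rightarrow> complex) set" where
  "holomorphic_functions0 \<equiv> {f. holomorphic_ball f \<and> f 0 = 0}"

section \<open>Derivatives and maximal functions\<close>

definition bergman_integral :: "real \<Rightarrow> real \<Rightarrow> (complex^'n \<Rightarrow> complex) \<Rightarrow> ennreal" where
  "bergman_integral \<alpha> p f =
     ball_integral \<alpha> (pth_power p f)"

lemma borel_measurable_ball_integrand:
  fixes G :: "complex^'n \<Rightarrow> ennreal"
  assumes "G \<in> borel_measurable borel"
  shows "(\<lambda>z. indicator (ball 0 1) z * ennreal (defect z powr \<alpha>) * G z) \<in> borel_measurable borel"
proof -
  note [measurable] = assms
  have [measurable]: "ball (0 :: complex^'n) 1 \<in> sets borel" by simp
  show ?thesis by measurable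
qed

lemma ennreal_cases_finite:
  assumes "B < \<infinity>" obtains b where "b \<ge> 0" "B = ennreal b"
  using assms by (cases B) auto

text \<open>
  A common bound for the \<open>p\<close>-th powers of \<open>|g|\<close> on \<open>S\<close>, such as an average over a larger region,
  transfers to every quantity that is homogeneously bounded by the supremum of \<open>|g|\<close> over \<open>S\<close>.
\<close>

lemma powr_le_of_sup_bound:
  fixes g :: "'a \<Rightarrow> 'b::real_normed_vector" and p c x :: real
  assumes B: "\<And>w. w \<in> S \<Longrightarrow> ennreal (norm (g w) powr p) \<le> B"
      and p: "p > 0" and c: "c > 0" and x: "x \<ge> 0"
      and sup: "\<And>M. M \<ge> 0 \<Longrightarrow> (\<And>w. w \<in> S \<Longrightarrow> norm (g w) \<le> M) \<Longrightarrow> x \<le> c * M"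
  shows "ennreal (x powr p) \<le> ennreal (c powr p) * B"
proof (cases "B < \<infinity>")
  case True
  then obtain b where b: "b \<ge> 0" "B = ennreal b" by (rule ennreal_cases_finite)
  have "norm (g w) \<le> b powr (1 / p)" if "w \<in> S" for w
  proof -
    have "norm (g w) powr p \<le> b" using B[OF that] b by simp
    then have "(norm (g w) powr p) powr (1 / p) \<le> b powr (1 / p)" using p by (intro powr_mono2) auto
    then show ?thesis using p by (simp add: powr_powr)
  qed
  then have "x \<le> c * b powr (1 / p)" by (intro sup) auto
  then have "x powr p \<le> (c * b powr (1 / p)) powr p" using x p by (intro powr_mono2) auto
  also have "\<dots> = c powr p * b" using b c p by (simp add: powr_mult powr_powr)
  finally show ?thesis unfolding b(2) using b(1) by (simp add: ennreal_leI flip: ennreal_mult)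
next
  case False
  then show ?thesis using c by (simp add: less_top[symmetric] ennreal_mult_top)
qed

lemma nn_integral_le_of_local_avg:
  fixes \<alpha> L :: real
  assumes "L \<ge> 1"
  obtains C where "C > 0"
    "\<And>h p c (f :: complex^'n \<Rightarrow> complex). holomorphic_ball f \<Longrightarrow> c > 0 \<Longrightarrow>
       (\<And>z. norm z < 1 \<Longrightarrow> h z \<le> ennreal (defect z powr \<alpha>) * (ennreal c * local_avg L (pth_power p f) z)) \<Longrightarrow>
       (\<integral>\<^sup>+z. indicator (ball 0 1) z * h z \<partial>lborel) \<le> ennreal (c * C) * bergman_integral \<alpha> p f"
proof -
  obtain C where C: "C > 0" and ton: "\<And>G :: complex^'n \<Rightarrow> ennreal. G \<in> borel_measurable borel \<Longrightarrow>
      ball_integral \<alpha> (local_avg L G)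
       \<le> ennreal C * ball_integral \<alpha> G"
    using nn_integral_local_avg_le[OF assms] by blast
  have "(\<integral>\<^sup>+z. indicator (ball 0 1) z * h z \<partial>lborel) \<le> ennreal (c * C) * bergman_integral \<alpha> p f"
    if f: "holomorphic_ball f" and c: "c > 0"
      and h: "\<And>z. norm z < 1 \<Longrightarrow> h z \<le> ennreal (defect z powr \<alpha>) * (ennreal c * local_avg L (pth_power p f) z)"
    for h p c and f :: "complex^'n \<Rightarrow> complex"
  proof -
    define G where "G = pth_power p f"
    have G: "G \<in> borel_measurable borel" unfolding G_def by (rule borel_measurable_pth_power[OF f])
    have "(\<integral>\<^sup>+z. indicator (ball 0 1) z * h z \<partial>lborel)
       \<le> (\<integral>\<^sup>+z. ennreal c * (indicator (ball 0 1) z * ennreal (defect z powr \<alpha>) * local_avg L G z) \<partial>lborel)"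
    proof (rule nn_integral_mono)
      fix z :: "complex^'n"
      show "indicator (ball 0 1) z * h z
         \<le> ennreal c * (indicator (ball 0 1) z * ennreal (defect z powr \<alpha>) * local_avg L G z)"
        using h[of z] by (cases "norm z < 1") (simp_all add: G_def mult.left_commute)
    qed
    also have "\<dots> = ennreal c * ball_integral \<alpha> (local_avg L G)"
      using borel_measurable_ball_integrand[OF borel_measurable_local_avg[OF G]]
      by (intro nn_integral_cmult) simp
    also have "\<dots> \<le> ennreal c * (ennreal C * bergman_integral \<alpha> p f)"
      unfolding bergman_integral_def G_def[symmetric] by (intro mult_left_mono ton G) auto
    also have "\<dots> = ennreal (c * C) * bergman_integral \<alpha> p f"
      using c C by (simp add: ennreal_mult mult.assoc)
    finally show ?thesis .
  qed
  then show ?thesis using that C by blast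
qed

lemma defect_power_powr:
  assumes "norm z < 1" shows "(defect z ^ k) powr p = defect z powr (p * real k)"
  using defect_pos[OF assms] by (simp add: powr_powr mult.commute flip: powr_realpow)

text \<open>
  \<open>\<R> f (z)\<close> is the derivative at \<open>0\<close> of \<open>\<zeta> \<mapsto> f (z + \<zeta> z)\<close>.  For \<open>|\<zeta>| < (1 - |z|\<^sup>2) / 4\<close> the argument stays in
  the Bergman region, and Cauchy's inequality gains exactly the factor \<open>1 - |z|\<^sup>2\<close>.
\<close>

lemma radial_deriv_le_sup:
  fixes z :: "complex^'n"
  assumes f: "holomorphic_ball f" and z: "norm z < 1"
      and M: "\<And>u. u \<in> bergman_region 4 z \<Longrightarrow> norm (f u) \<le> M"
  shows "defect z * norm (radial_deriv f z) \<le> 8 * M"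
proof -
  define r where "r = defect z / 4"
  have r: "r > 0" using defect_pos[OF z] by (simp add: r_def)
  have reg: "z + \<zeta> *s z \<in> bergman_region 4 z" if "norm \<zeta> < r" for \<zeta>
  proof (rule region_of_aniso_le[OF z])
    have "norm \<zeta> * norm z \<le> r * 1" using that z r by (intro mult_mono) auto
    then have "norm (\<zeta> *s z) / defect z \<le> 1 / 4"
      using defect_pos[OF z] by (simp add: norm_cscale r_def pos_divide_le_eq)
    then show "aniso z (\<zeta> *s z) \<le> 1/4" using aniso_le_norm[OF z, of "\<zeta> *s z"] by linarith
  qed
  have "norm (deriv (\<lambda>\<zeta>. f (z + \<zeta> *s z)) 0) \<le> 2 * M / r"
  proof (rule disc_bounds(1)[OF _ r])
    show "(\<lambda>\<zeta>. f (z + \<zeta> *s z)) holomorphic_on ball 0 r"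
      by (rule line_holomorphic_on[OF f]) (use reg bergman_regionD(1) in auto)
    show "norm (f (z + \<zeta> *s z)) \<le> M" if "norm \<zeta> < r" for \<zeta> using M reg[OF that] by blast
  qed (use r in auto)
  then have "norm (radial_deriv f z) \<le> 2 * M / r"
    by (simp only: deriv_line_0[OF f z] radial_deriv_eq_total_deriv[OF f z])
  then have "norm (radial_deriv f z) * r \<le> 2 * M" using r by (simp add: pos_le_divide_eq)
  then show ?thesis by (simp add: r_def mult.commute)
qed

lemma bergman_integral_radial_deriv_le:
  fixes \<alpha> p :: real
  assumes p: "p > 0"
  shows "dominated (holomorphic_functions :: (complex^'n \<Rightarrow> complex) set)
           (\<lambda>f. bergman_integral (\<alpha> + p) p (radial_deriv f)) (bergman_integral \<alpha> p)"
proof -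
  define C where "C = avg_const DIM(complex^'n) p"
  define L :: real where "L = 640000 * 4 ^ 3"
  have C: "C > 0" and L: "L \<ge> 1" by (simp_all add: C_def L_def avg_const_pos)
  have avg: "ennreal (norm (f w) powr p) \<le> ennreal C * local_avg L (pth_power p f) z"
    if "holomorphic_ball f" "norm z < 1" "w \<in> bergman_region 4 z" for f z and w :: "complex^'n"
    unfolding C_def L_def by (rule pth_power_le_local_avg[OF _ p]) (use that in auto)
  obtain C' where C': "C' > 0" and int:
    "\<And>h p c (f :: complex^'n \<Rightarrow> complex). holomorphic_ball f \<Longrightarrow> c > 0 \<Longrightarrow>
       (\<And>z. norm z < 1 \<Longrightarrow> h z \<le> ennreal (defect z powr \<alpha>) * (ennreal c * local_avg L (pth_power p f) z)) \<Longrightarrow>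
       (\<integral>\<^sup>+z. indicator (ball 0 1) z * h z \<partial>lborel) \<le> ennreal (c * C') * bergman_integral \<alpha> p f"
    using nn_integral_le_of_local_avg[OF L] by blast
  define c where "c = 8 powr p * C"
  have c: "c > 0" using C by (simp add: c_def)
  have "bergman_integral (\<alpha> + p) p (radial_deriv f) \<le> ennreal (c * C') * bergman_integral \<alpha> p f"
    if f: "holomorphic_ball f" for f :: "complex^'n \<Rightarrow> complex"
    unfolding bergman_integral_def[of "\<alpha> + p"] mult.assoc[of "indicator _ _"]
  proof (rule int[OF f c])
    fix z :: "complex^'n" assume z: "norm z < 1"
    have "ennreal ((defect z * norm (radial_deriv f z)) powr p) \<le> ennreal (8 powr p) * (ennreal C * local_avg L (pth_power p f) z)"
      using defect_pos[OF z]
      by (intro powr_le_of_sup_bound[where S = "bergman_region 4 z" and g = f] avg f z p radial_deriv_le_sup) auto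
    also have "\<dots> = ennreal c * local_avg L (pth_power p f) z"
      using C by (simp add: c_def ennreal_mult mult.assoc)
    finally have *: "ennreal ((defect z * norm (radial_deriv f z)) powr p) \<le> ennreal c * local_avg L (pth_power p f) z" .
    have "ennreal (defect z powr (\<alpha> + p)) * pth_power p (radial_deriv f) z
       = ennreal (defect z powr \<alpha>) * ennreal ((defect z * norm (radial_deriv f z)) powr p)"
      using defect_pos[OF z] z by (simp add: pth_power_def powr_add powr_mult mult_ac flip: ennreal_mult)
    also have "\<dots> \<le> ennreal (defect z powr \<alpha>) * (ennreal c * local_avg L (pth_power p f) z)"
      by (intro mult_left_mono *) auto
    finally show "ennreal (defect z powr (\<alpha> + p)) * pth_power p (radial_deriv f) z
       \<le> ennreal (defect z powr \<alpha>) * (ennreal c * local_avg L (pth_power p f) z)" .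
  qed
  then show ?thesis using c C' by (intro dominatedI[of "c * C'"]) auto
qed

text \<open>
  Bergman balls are relatively compact in the unit ball; this makes the real-valued supremum in the
  maximal function a genuine upper bound.
\<close>

lemma bdd_above_weighted:
  fixes g :: "complex^'n \<Rightarrow> complex"
  assumes g: "holomorphic_ball g" and z: "norm z < 1" and K: "K > 1"
  shows "bdd_above ((\<lambda>w. norm (complex_of_real (defect w ^ k) * g w)) ` bergman_region K z)"
proof -
  define \<delta> where "\<delta> = defect z / (4 * K)"
  have \<delta>: "0 < \<delta>" "\<delta> < 1"
    using defect_pos[OF z] defect_le_1[of z] K by (auto simp: \<delta>_def field_simps)
  define S where "S = cball (0 :: complex^'n) (sqrt (1 - \<delta>))"
  have "sqrt (1 - \<delta>) < 1" using \<delta> by simp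
  then have S: "S \<subseteq> ball 0 1" unfolding S_def by (auto simp del: real_sqrt_lt_1_iff)
  have "continuous_on S (\<lambda>w. norm (complex_of_real (defect w ^ k) * g w))"
    unfolding defect_def by (intro continuous_intros continuous_on_subset[OF holomorphic_ball_continuous_on[OF g] S])
  then have "compact ((\<lambda>w. norm (complex_of_real (defect w ^ k) * g w)) ` S)"
    by (rule compact_continuous_image) (simp add: S_def)
  then have "bdd_above ((\<lambda>w. norm (complex_of_real (defect w ^ k) * g w)) ` S)"
    by (intro bounded_imp_bdd_above compact_imp_bounded)
  moreover have "bergman_region K z \<subseteq> S"
  proof
    fix w assume w: "w \<in> bergman_region K z"
    have "\<delta> \<le> defect w" using bergman_region_defect_le[OF w z] K by (simp add: \<delta>_def field_simps)
    then show "w \<in> S" using \<delta> by (simp add: S_def defect_def real_le_rsqrt)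
  qed
  ultimately show ?thesis by (meson bdd_above_mono image_mono)
qed

lemma max_radial_eq:
  assumes "norm z < 1" "\<gamma> > 0"
  shows "max_radial k \<gamma> f z =
    (SUP w\<in>bergman_region ((cosh \<gamma>)\<^sup>2) z. norm (complex_of_real (defect w ^ k) * (radial_deriv ^^ k) f w))"
  by (simp add: max_radial_def bergman_ball_eq[OF assms] weighted_radial_def defect_def)

lemma cosh_square_gt_1: "\<gamma> > 0 \<Longrightarrow> (cosh \<gamma>)\<^sup>2 > (1 :: real)"
  by (simp add: cosh_square_eq)

lemma weighted_le_max_radial:
  fixes f :: "complex^'n \<Rightarrow> complex"
  assumes f: "holomorphic_ball f" and z: "norm z < 1" and \<gamma>: "\<gamma> > 0"
  shows "defect z ^ k * norm ((radial_deriv ^^ k) f z) \<le> max_radial k \<gamma> f z"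
proof -
  note K = cosh_square_gt_1[OF \<gamma>]
  have "norm (complex_of_real (defect z ^ k) * (radial_deriv ^^ k) f z) \<le> max_radial k \<gamma> f z"
    unfolding max_radial_eq[OF z \<gamma>]
    by (intro cSUP_upper bdd_above_weighted holomorphic_radial_deriv_iter f z K bergman_region_self)
  then show ?thesis using defect_pos[OF z] by (simp add: norm_mult norm_power)
qed

text \<open>
  On a Bergman ball the weight \<open>(1 - |w|\<^sup>2)\<^sup>k\<close> is comparable to its value at the centre, so the maximal
  function is controlled by the local average of \<open>|\<R>\<^sup>k f|\<^sup>p\<close>, and the average integrates out.
\<close>

lemma nn_integral_max_radial_le:
  fixes \<alpha> p \<gamma> :: real
  assumes p: "p > 0" and \<gamma>: "\<gamma> > 0"
  shows "dominated (holomorphic_functions :: (complex^'n \<Rightarrow> complex) set)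
           (\<lambda>f. ball_integral \<alpha> (\<lambda>z. ennreal (\<bar>max_radial k \<gamma> f z\<bar> powr p)))
           (\<lambda>f. bergman_integral (\<alpha> + p * real k) p ((radial_deriv ^^ k) f))"
proof -
  define K where "K = (cosh \<gamma>)\<^sup>2"
  have K: "K > 1" unfolding K_def by (rule cosh_square_gt_1[OF \<gamma>])
  define C where "C = avg_const DIM(complex^'n) p"
  define L where "L = 640000 * K ^ 3"
  have "1 \<le> K ^ 3" using K by (intro one_le_power) simp
  then have C: "C > 0" and L: "L \<ge> 1" by (simp_all add: C_def L_def avg_const_pos)
  have avg: "ennreal (norm (f w) powr p) \<le> ennreal C * local_avg L (pth_power p f) z"
    if "holomorphic_ball f" "norm z < 1" "w \<in> bergman_region K z" for f z and w :: "complex^'n"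
    unfolding C_def L_def by (rule pth_power_le_local_avg[OF _ p]) (use that K in auto)
  define \<beta> where "\<beta> = \<alpha> + p * real k"
  obtain C' where C': "C' > 0" and int:
    "\<And>h p c (f :: complex^'n \<Rightarrow> complex). holomorphic_ball f \<Longrightarrow> c > 0 \<Longrightarrow>
       (\<And>z. norm z < 1 \<Longrightarrow> h z \<le> ennreal (defect z powr \<beta>) * (ennreal c * local_avg L (pth_power p f) z)) \<Longrightarrow>
       (\<integral>\<^sup>+z. indicator (ball 0 1) z * h z \<partial>lborel) \<le> ennreal (c * C') * bergman_integral \<beta> p f"
    using nn_integral_le_of_local_avg[OF L] by blast
  define c where "c = ((4 * K) ^ k) powr p * C"
  have c: "c > 0" using C K by (simp add: c_def)
  have "ball_integral \<alpha> (\<lambda>z. ennreal (\<bar>max_radial k \<gamma> f z\<bar> powr p))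
       \<le> ennreal (c * C') * bergman_integral \<beta> p ((radial_deriv ^^ k) f)"
    if f: "holomorphic_ball f" for f :: "complex^'n \<Rightarrow> complex"
    unfolding mult.assoc[of "indicator _ _"]
  proof (rule int[OF holomorphic_radial_deriv_iter[OF f] c])
    fix z :: "complex^'n" assume z: "norm z < 1"
    define g where "g = (radial_deriv ^^ k) f"
    define A where "A = local_avg L (pth_power p g) z"
    have g: "holomorphic_ball g" unfolding g_def by (rule holomorphic_radial_deriv_iter[OF f])
    have dz: "defect z > 0" by (rule defect_pos[OF z])
    have "ennreal (\<bar>max_radial k \<gamma> f z\<bar> powr p) \<le> ennreal (((4 * K * defect z) ^ k) powr p) * (ennreal C * A)"
    proof (rule powr_le_of_sup_bound[where S = "bergman_region K z" and g = g])
      fix M assume M: "M \<ge> 0" "\<And>w. w \<in> bergman_region K z \<Longrightarrow> norm (g w) \<le> M"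
      have "0 \<le> max_radial k \<gamma> f z"
        by (rule order_trans[OF _ weighted_le_max_radial[OF f z \<gamma>, of k]]) (use dz in auto)
      moreover have "max_radial k \<gamma> f z \<le> (4 * K * defect z) ^ k * M"
        unfolding max_radial_eq[OF z \<gamma>] K_def[symmetric] g_def[symmetric]
      proof (rule cSUP_least)
        show "bergman_region K z \<noteq> {}" using bergman_region_self[OF z K] by blast
        fix w assume w: "w \<in> bergman_region K z"
        have dw: "defect w > 0" by (rule defect_pos[OF bergman_regionD(1)[OF w]])
        then have "defect w ^ k \<le> (4 * K * defect z) ^ k"
          using bergman_region_defect_ge[OF w z] by (intro power_mono) auto
        then show "norm (complex_of_real (defect w ^ k) * g w) \<le> (4 * K * defect z) ^ k * M"
          using dw dz K M(2)[OF w] by (simp add: norm_mult norm_power mult_mono)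
      qed
      ultimately show "\<bar>max_radial k \<gamma> f z\<bar> \<le> (4 * K * defect z) ^ k * M" by simp
    qed (use avg[OF g z] p K dz in \<open>auto simp: A_def\<close>)
    also have "((4 * K * defect z) ^ k) powr p = defect z powr (p * real k) * ((4 * K) ^ k) powr p"
      unfolding power_mult_distrib[of "4 * K"] defect_power_powr[OF z, symmetric]
      by (subst powr_mult) (use K dz in \<open>simp_all add: mult.commute\<close>)
    also have "ennreal (defect z powr (p * real k) * ((4 * K) ^ k) powr p) * (ennreal C * A)
       = ennreal (defect z powr (p * real k)) * (ennreal c * A)"
      using C by (simp add: c_def ennreal_mult mult.assoc)
    finally have *: "ennreal (\<bar>max_radial k \<gamma> f z\<bar> powr p) \<le> ennreal (defect z powr (p * real k)) * (ennreal c * A)" .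
    have "ennreal (defect z powr \<alpha>) * ennreal (\<bar>max_radial k \<gamma> f z\<bar> powr p)
       \<le> ennreal (defect z powr \<alpha>) * (ennreal (defect z powr (p * real k)) * (ennreal c * A))"
      by (intro mult_left_mono *) auto
    also have "\<dots> = ennreal (defect z powr \<beta>) * (ennreal c * A)"
      unfolding \<beta>_def by (simp add: powr_add ennreal_mult mult.assoc)
    finally show "ennreal (defect z powr \<alpha>) * ennreal (\<bar>max_radial k \<gamma> f z\<bar> powr p)
       \<le> ennreal (defect z powr \<beta>) * (ennreal c * local_avg L (pth_power p ((radial_deriv ^^ k) f)) z)"
      by (simp add: A_def g_def)
  qed
  then show ?thesis using c C' by (intro dominatedI[of "c * C'"]) (auto simp: \<beta>_def)
qed

lemma bergman_integral_le_max_radial: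
  fixes f :: "complex^'n \<Rightarrow> complex"
  assumes f: "holomorphic_ball f" and p: "p > 0" and \<gamma>: "\<gamma> > 0"
  shows "bergman_integral (\<alpha> + p * real k) p ((radial_deriv ^^ k) f) \<le>
    ball_integral \<alpha> (\<lambda>z. ennreal (\<bar>max_radial k \<gamma> f z\<bar> powr p))"
  unfolding bergman_integral_def
proof (rule nn_integral_mono)
  fix z :: "complex^'n"
  show "indicator (ball 0 1) z * ennreal (defect z powr (\<alpha> + p * real k)) * pth_power p ((radial_deriv ^^ k) f) z
    \<le> indicator (ball 0 1) z * ennreal (defect z powr \<alpha>) * ennreal (\<bar>max_radial k \<gamma> f z\<bar> powr p)"
  proof (cases "norm z < 1")
    case True
    define N where "N = norm ((radial_deriv ^^ k) f z)"
    have d: "defect z > 0" by (rule defect_pos[OF True])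
    have "defect z powr (\<alpha> + p * real k) * N powr p = defect z powr \<alpha> * (defect z ^ k * N) powr p"
      using d by (simp add: powr_add powr_mult N_def defect_power_powr[OF True])
    also have "\<dots> \<le> defect z powr \<alpha> * \<bar>max_radial k \<gamma> f z\<bar> powr p"
      using weighted_le_max_radial[OF f True \<gamma>, of k] d p
      by (intro mult_left_mono powr_mono2) (auto simp: N_def)
    finally have "ennreal (defect z powr (\<alpha> + p * real k) * N powr p)
        \<le> ennreal (defect z powr \<alpha> * \<bar>max_radial k \<gamma> f z\<bar> powr p)" by (rule ennreal_leI)
    then show ?thesis using True by (simp add: pth_power_def N_def ennreal_mult)
  qed simp
qed

section \<open>Polar coordinates\<close>

text \<open>
  The unit sphere is replaced by the shell \<open>1/2 \<le> |z| \<le> 1\<close>: dilations map Lebesgue measure to a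
  multiple of itself, so that Tonelli's theorem over the shell and the dilation factor produces
  polar integration; \<open>ln 2\<close> is the logarithmic thickness of the shell.
\<close>

definition shell_weight :: "'a::euclidean_space \<Rightarrow> real" where
  "shell_weight z = (if 1/2 \<le> norm z \<and> norm z \<le> 1 then 1 / (ln 2 * norm z ^ DIM('a)) else 0)"

lemma borel_measurable_shell_weight [measurable]: "shell_weight \<in> borel_measurable borel"
  unfolding shell_weight_def[abs_def] by measurable

lemma nn_integral_shell_scales:
  fixes x :: "'a::euclidean_space"
  assumes "x \<noteq> 0"
  shows "(\<integral>\<^sup>+t. indicator {0<..} t * ennreal (1 / t) * indicator {z::'a. 1/2 \<le> norm z \<and> norm z \<le> 1} ((1 / t) *\<^sub>R x) \<partial>lborel)
         = ennreal (ln 2)"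
proof -
  define a where "a = norm x"
  have a: "a > 0" using assms by (simp add: a_def)
  have "(\<integral>\<^sup>+t. indicator {0<..} t * ennreal (1 / t) * indicator {z::'a. 1/2 \<le> norm z \<and> norm z \<le> 1} ((1 / t) *\<^sub>R x) \<partial>lborel)
     = (\<integral>\<^sup>+t. ennreal (1 / t) * indicator {a..2 * a} t \<partial>lborel)"
  proof (rule nn_integral_cong)
    fix t :: real
    have "t > 0 \<and> 1/2 \<le> norm ((1 / t) *\<^sub>R x) \<and> norm ((1 / t) *\<^sub>R x) \<le> 1 \<longleftrightarrow> a \<le> t \<and> t \<le> 2 * a"
    proof (cases "t > 0")
      case True
      then show ?thesis by (auto simp: a_def[symmetric] field_simps)
    qed (use a in auto)
    then show "indicator {0<..} t * ennreal (1 / t) * indicator {z::'a. 1/2 \<le> norm z \<and> norm z \<le> 1} ((1 / t) *\<^sub>R x)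
       = ennreal (1 / t) * indicator {a..2 * a} t"
      by (auto simp: indicator_def)
  qed
  also have "\<dots> = ennreal (ln (2 * a) - ln a)"
    by (rule nn_integral_FTC_Icc) (use a in \<open>auto intro!: derivative_eq_intros\<close>)
  also have "ln (2 * a) - ln a = ln 2" using a by (simp add: ln_mult)
  finally show ?thesis .
qed

lemma nn_integral_polar:
  fixes F :: "'a::euclidean_space \<Rightarrow> ennreal"
  assumes F [measurable]: "F \<in> borel_measurable borel"
  shows "(\<integral>\<^sup>+x. F x \<partial>lborel) = (\<integral>\<^sup>+z. ennreal (shell_weight z) *
           (\<integral>\<^sup>+r. indicator {0<..} r * ennreal (r ^ (DIM('a) - 1)) * F (r *\<^sub>R sgn z) \<partial>lborel) \<partial>lborel)"
proof -
  define A where "A = {z::'a. 1/2 \<le> norm z \<and> norm z \<le> 1}"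
  have [measurable]: "A \<in> sets borel"
  proof -
    have "{z \<in> space borel. 1/2 \<le> norm (z::'a) \<and> norm z \<le> 1} \<in> sets borel" by measurable
    then show ?thesis by (simp add: A_def)
  qed
  define D where "D = DIM('a)"
  have D: "D = Suc (D - 1)" by (simp add: D_def)
  define H where "H = (\<lambda>z t. indicator A z * (indicator {0<..} t * ennreal (t ^ (D - 1)) * F (t *\<^sub>R z)))"
  have H [measurable]: "(\<lambda>(z, t). H z t) \<in> borel_measurable (lborel \<Otimes>\<^sub>M lborel)"
    unfolding H_def by measurable
  let ?ray = "\<lambda>z. \<integral>\<^sup>+r. indicator {0<..} r * ennreal (r ^ (D - 1)) * F (r *\<^sub>R sgn z) \<partial>lborel"
  let ?J = "\<lambda>t x. indicator {0<..} t * ennreal (1 / t) * indicator A ((1 / t) *\<^sub>R x)"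
  have "ennreal (shell_weight z) * ?ray z
      = ennreal (1 / ln 2) * (\<integral>\<^sup>+t. H z t \<partial>lborel)" for z
  proof (cases "z \<in> A")
    case True
    define a where "a = norm z"
    have a: "a > 0" using True by (auto simp: a_def A_def)
    let ?G = "\<lambda>t. indicator {0<..} (0 + a * t) * ennreal ((0 + a * t) ^ (D - 1)) * F ((0 + a * t) *\<^sub>R sgn z)"
    have "?ray z
      = ennreal a * (\<integral>\<^sup>+t. ?G t \<partial>lborel)"
      using a by (subst nn_integral_real_affine[where c = a and t = 0]) auto
    also have "(\<integral>\<^sup>+t. ?G t \<partial>lborel)
      = (\<integral>\<^sup>+t. ennreal (a ^ (D - 1)) * (indicator {0<..} t * ennreal (t ^ (D - 1)) * F (t *\<^sub>R z)) \<partial>lborel)"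
    proof (rule nn_integral_cong)
      fix t :: real
      have "(a * t) *\<^sub>R sgn z = t *\<^sub>R z" using a by (simp add: sgn_div_norm a_def)
      then show "?G t
        = ennreal (a ^ (D - 1)) * (indicator {0<..} t * ennreal (t ^ (D - 1)) * F (t *\<^sub>R z))"
        using a by (auto simp: indicator_def zero_less_mult_iff power_mult_distrib ennreal_mult mult.assoc)
    qed
    also have "\<dots> = ennreal (a ^ (D - 1)) * (\<integral>\<^sup>+t. H z t \<partial>lborel)"
      using True by (simp add: nn_integral_cmult H_def)
    also have "ennreal a * (ennreal (a ^ (D - 1)) * (\<integral>\<^sup>+t. H z t \<partial>lborel)) = ennreal (a ^ D) * (\<integral>\<^sup>+t. H z t \<partial>lborel)"
      using a by (subst (2) D) (simp add: ennreal_mult mult.assoc)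
    finally have *: "?ray z
       = ennreal (a ^ D) * (\<integral>\<^sup>+t. H z t \<partial>lborel)" .
    have "shell_weight z * a ^ D = 1 / ln 2"
      using True a by (simp add: shell_weight_def A_def a_def D_def)
    moreover have "shell_weight z \<ge> 0" by (simp add: shell_weight_def)
    ultimately have "ennreal (shell_weight z) * ennreal (a ^ D) = ennreal (1 / ln 2)"
      using a by (metis ennreal_mult less_imp_le zero_le_power)
    then show ?thesis unfolding * by (simp only: mult.assoc[symmetric])
  next
    case False
    then show ?thesis by (auto simp: shell_weight_def A_def H_def)
  qed
  then have "(\<integral>\<^sup>+z. ennreal (shell_weight z) * ?ray z \<partial>lborel)
     = ennreal (1 / ln 2) * (\<integral>\<^sup>+z. (\<integral>\<^sup>+t. H z t \<partial>lborel) \<partial>lborel)"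
    by (simp add: nn_integral_cmult)
  also have "(\<integral>\<^sup>+z. (\<integral>\<^sup>+t. H z t \<partial>lborel) \<partial>lborel) = (\<integral>\<^sup>+t. (\<integral>\<^sup>+z. H z t \<partial>lborel) \<partial>lborel)"
    by (rule lborel_pair.Fubini'[symmetric]) simp
  also have "\<dots> = (\<integral>\<^sup>+t. (\<integral>\<^sup>+x. ?J t x * F x \<partial>lborel) \<partial>lborel)"
  proof (rule nn_integral_cong)
    fix t :: real
    show "(\<integral>\<^sup>+z. H z t \<partial>lborel) = (\<integral>\<^sup>+x. ?J t x * F x \<partial>lborel)"
    proof (cases "t > 0")
      case True
      have "(\<integral>\<^sup>+x. ?J t x * F x \<partial>lborel)
         = ennreal (t ^ D) * (\<integral>\<^sup>+z. ennreal (1 / t) * (indicator A z * F (t *\<^sub>R z)) \<partial>lborel)"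
        unfolding D_def using True
        by (subst nn_integral_lborel_affine[where t = t and a = 0]) (auto simp: mult.assoc)
      also have "\<dots> = (ennreal (t ^ D) * ennreal (1 / t)) * (\<integral>\<^sup>+z. indicator A z * F (t *\<^sub>R z) \<partial>lborel)"
        by (simp add: nn_integral_cmult mult.assoc)
      also have "ennreal (t ^ D) * ennreal (1 / t) = ennreal (t ^ (D - 1))"
        using True by (subst D) (simp flip: ennreal_mult)
      also have "ennreal (t ^ (D - 1)) * (\<integral>\<^sup>+z. indicator A z * F (t *\<^sub>R z) \<partial>lborel) = (\<integral>\<^sup>+z. H z t \<partial>lborel)"
        using True by (simp add: H_def mult_ac flip: nn_integral_cmult)
      finally show ?thesis by simp
    qed (simp add: H_def)
  qed
  also have "\<dots> = (\<integral>\<^sup>+x. (\<integral>\<^sup>+t. ?J t x * F x \<partial>lborel) \<partial>lborel)"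
    by (rule lborel_pair.Fubini') measurable
  also have "\<dots> = (\<integral>\<^sup>+x. ennreal (ln 2) * F x \<partial>lborel)"
  proof (rule nn_integral_cong_AE)
    have "AE x in lborel. x \<noteq> (0 :: 'a)" by (rule AE_lborel_singleton)
    then show "AE x in lborel. (\<integral>\<^sup>+t. ?J t x * F x \<partial>lborel) = ennreal (ln 2) * F x"
    proof (rule AE_mp, intro AE_I2 impI)
      fix x :: 'a assume "x \<noteq> 0"
      have "(\<integral>\<^sup>+t. ?J t x * F x \<partial>lborel)
        = (\<integral>\<^sup>+t. ?J t x \<partial>lborel) * F x"
        by (intro nn_integral_multc) measurable
      then show "(\<integral>\<^sup>+t. ?J t x * F x \<partial>lborel) = ennreal (ln 2) * F x"
        unfolding A_def nn_integral_shell_scales[OF \<open>x \<noteq> 0\<close>] .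
    qed
  qed
  also have "\<dots> = ennreal (ln 2) * (\<integral>\<^sup>+x. F x \<partial>lborel)" by (intro nn_integral_cmult) measurable
  also have "ennreal (1 / ln 2) * (ennreal (ln 2) * (\<integral>\<^sup>+x. F x \<partial>lborel)) = (\<integral>\<^sup>+x. F x \<partial>lborel)"
    by (simp add: mult.assoc[symmetric] flip: ennreal_mult)
  finally show ?thesis by (simp add: D_def)
qed

section \<open>A Hardy inequality along rays\<close>

definition ray_weight :: "real \<Rightarrow> nat \<Rightarrow> real \<Rightarrow> real" where
  "ray_weight \<alpha> d r = (1 - r\<^sup>2) powr \<alpha> * r ^ d"

abbreviation ray_integral :: "real \<Rightarrow> nat \<Rightarrow> (real \<Rightarrow> ennreal) \<Rightarrow> ennreal" where
  "ray_integral \<alpha> d h \<equiv> (\<integral>\<^sup>+r. indicator {0<..<1} r * (ennreal (ray_weight \<alpha> d r) * h r) \<partial>lborel)"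

lemma borel_measurable_ray_weight [measurable]: "ray_weight \<alpha> d \<in> borel_measurable borel"
  unfolding ray_weight_def[abs_def] by measurable

lemma ray_weight_nonneg: "r \<ge> 0 \<Longrightarrow> ray_weight \<alpha> d r \<ge> 0"
  by (simp add: ray_weight_def)

lemma one_minus_square_pos: "0 \<le> r \<Longrightarrow> r < 1 \<Longrightarrow> 0 < 1 - (r::real)\<^sup>2"
  by (simp add: power_less_one_iff)

lemma ray_weight_le:
  fixes r \<rho> \<alpha> :: real
  assumes r: "0 < r" "r \<le> \<rho>" and \<rho>: "\<rho> < 1"
  shows "ray_weight \<alpha> d r \<le> max 1 ((1 - \<rho>\<^sup>2) powr \<alpha>)"
proof -
  have q: "1 - \<rho>\<^sup>2 \<le> 1 - r\<^sup>2" "0 < 1 - \<rho>\<^sup>2" "1 - r\<^sup>2 \<le> 1"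
    using r \<rho> one_minus_square_pos[of \<rho>] by (auto intro: power_mono)
  have "ray_weight \<alpha> d r \<le> (1 - r\<^sup>2) powr \<alpha>"
    using r \<rho> by (simp add: ray_weight_def mult_left_le power_le_one)
  also have "\<dots> \<le> max 1 ((1 - \<rho>\<^sup>2) powr \<alpha>)"
  proof (cases "\<alpha> \<ge> 0")
    case True
    then show ?thesis using q powr_mono2[of \<alpha> "1 - r\<^sup>2" 1] by simp
  next
    case False
    then show ?thesis using q powr_mono2'[of \<alpha> "1 - \<rho>\<^sup>2" "1 - r\<^sup>2"] by simp
  qed
  finally show ?thesis .
qed

text \<open>
  The weight changes by about \<open>\<Lambda> powr (-\<alpha>)\<close> under the step, while the substitution rule allows a
  factor \<open>\<Lambda>\<close>; the excess \<open>\<Lambda> powr (1 + \<alpha>)\<close> pays for all other constants.  It is here that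
  \<open>\<alpha> > -1\<close> enters.
\<close>

lemma ray_weight_shift:
  fixes \<alpha> P \<Lambda> r :: real
  assumes P: "P > 0" and \<alpha>: "\<alpha> > -1" and \<Lambda>: "\<Lambda> \<ge> 2" "2 * P * 2 powr \<bar>\<alpha>\<bar> * 2 ^ d \<le> \<Lambda> powr (1 + \<alpha>)"
      and r: "1 - 1 / (2 * \<Lambda>) \<le> r" "r < 1"
  shows "P * ray_weight \<alpha> d r \<le> \<Lambda> / 2 * ray_weight \<alpha> d (1 - \<Lambda> * (1 - r))"
proof -
  define v where "v = 1 - \<Lambda> * (1 - r)"
  have "\<Lambda> * (1 - r) \<le> \<Lambda> * (1 / (2 * \<Lambda>))" using r \<Lambda> by (intro mult_left_mono) auto
  then have v: "1/2 \<le> v" "v < 1" using r \<Lambda> by (auto simp: v_def)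
  have r0: "0 \<le> r" 
  proof -
    have "1 / (2 * \<Lambda>) \<le> 1" using \<Lambda> by simp
    then show ?thesis using r by linarith
  qed
  define a where "a = 1 - r\<^sup>2"
  define b where "b = 1 - v\<^sup>2"
  have ab: "a > 0" "b > 0" using one_minus_square_pos[of r] one_minus_square_pos[of v] v r r0 by (auto simp: a_def b_def)
  have a_eq: "a = (1 - r) * (1 + r)" by (simp add: a_def power2_eq_square algebra_simps)
  have "1 - v = \<Lambda> * (1 - r)" by (simp add: v_def)
  moreover have "b = (1 - v) * (1 + v)" by (simp add: b_def power2_eq_square algebra_simps)
  ultimately have b_eq: "b / \<Lambda> = (1 - r) * (1 + v)" using \<Lambda> by simp
  have "a \<le> 2 * (b / \<Lambda>)" "b / \<Lambda> \<le> 2 * a"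
    unfolding a_eq b_eq mult.left_commute[of 2] using v r r0 by (intro mult_left_mono; simp)+
  then have "a powr \<alpha> \<le> 2 powr \<bar>\<alpha>\<bar> * (b / \<Lambda>) powr \<alpha>"
    using ab \<Lambda> by (intro powr_le_comparable) auto
  also have "\<dots> = 2 powr \<bar>\<alpha>\<bar> * b powr \<alpha> / \<Lambda> powr \<alpha>" using ab \<Lambda> by (simp add: powr_divide)
  finally have a_le: "a powr \<alpha> \<le> 2 powr \<bar>\<alpha>\<bar> * b powr \<alpha> / \<Lambda> powr \<alpha>" .
  have "1 \<le> 2 ^ d * v ^ d"
  proof -
    have "1 \<le> (2 * v) ^ d" using v by (intro one_le_power) simp
    then show ?thesis by (simp add: power_mult_distrib)
  qed
  then have bd: "b powr \<alpha> \<le> b powr \<alpha> * (2 ^ d * v ^ d)" by (simp add: mult_le_cancel_left1)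
  have L0: "\<Lambda> powr \<alpha> > 0" using \<Lambda> by simp
  have "P * ray_weight \<alpha> d r \<le> P * a powr \<alpha>"
    using P r r0 by (simp add: ray_weight_def a_def mult_left_le power_le_one)
  also have "\<dots> \<le> P * (2 powr \<bar>\<alpha>\<bar> * (b powr \<alpha> * (2 ^ d * v ^ d)) / \<Lambda> powr \<alpha>)"
  proof -
    have "2 powr \<bar>\<alpha>\<bar> * b powr \<alpha> / \<Lambda> powr \<alpha> \<le> 2 powr \<bar>\<alpha>\<bar> * (b powr \<alpha> * (2 ^ d * v ^ d)) / \<Lambda> powr \<alpha>"
      using bd L0 by (intro divide_right_mono mult_left_mono) auto
    with a_le P show ?thesis by (intro mult_left_mono) auto
  qed
  also have "\<dots> = (2 * P * 2 powr \<bar>\<alpha>\<bar> * 2 ^ d) * (b powr \<alpha> * v ^ d) / (2 * \<Lambda> powr \<alpha>)"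
    by simp
  also have "\<dots> \<le> \<Lambda> powr (1 + \<alpha>) * (b powr \<alpha> * v ^ d) / (2 * \<Lambda> powr \<alpha>)"
    using \<Lambda>(2) v L0 by (intro divide_right_mono mult_right_mono) auto
  also have "\<Lambda> powr (1 + \<alpha>) = \<Lambda> * \<Lambda> powr \<alpha>" using \<Lambda> by (simp add: powr_add)
  also have "\<Lambda> * \<Lambda> powr \<alpha> * (b powr \<alpha> * v ^ d) / (2 * \<Lambda> powr \<alpha>) = \<Lambda> / 2 * ray_weight \<alpha> d v"
    using L0 by (simp add: ray_weight_def b_def)
  finally show ?thesis by (simp add: v_def)
qed

lemma nn_integral_up_to_1:
  fixes h :: "real \<Rightarrow> ennreal"
  assumes [measurable]: "h \<in> borel_measurable borel"
      and le: "\<And>\<rho>. 0 < \<rho> \<Longrightarrow> \<rho> < 1 \<Longrightarrow> (\<integral>\<^sup>+r. indicator {0<..<\<rho>} r * h r \<partial>lborel) \<le> X"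
  shows "(\<integral>\<^sup>+r. indicator {0<..<1} r * h r \<partial>lborel) \<le> X"
proof -
  define \<rho> where "\<rho> = (\<lambda>n. 1 - 1 / (real n + 2))"
  have \<rho>: "0 < \<rho> n" "\<rho> n < 1" for n by (auto simp: \<rho>_def field_simps)
  have "indicator {0<..<1} r * h r = (SUP n. indicator {0<..<\<rho> n} r * h r)" for r
  proof (cases "0 < r \<and> r < 1")
    case True
    then obtain n where "1 / (1 - r) < real n" using reals_Archimedean2 by blast
    then have "r < \<rho> n" using True by (simp add: \<rho>_def field_simps)
    then have "indicator {0<..<1} r * h r \<le> indicator {0<..<\<rho> n} r * h r" using True by simp
    then show ?thesis
      by (intro antisym SUP_least) (auto intro!: SUP_upper2[of n] simp: indicator_def True)
  next
    case False
    then have "indicator {0<..<\<rho> n} r = (0 :: ennreal)" for n using \<rho>(2)[of n] by (auto simp: indicator_def)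
    then show ?thesis using False by simp
  qed
  then have "(\<integral>\<^sup>+r. indicator {0<..<1} r * h r \<partial>lborel) = (\<integral>\<^sup>+r. (SUP n. indicator {0<..<\<rho> n} r * h r) \<partial>lborel)"
    by simp
  also have "\<dots> = (SUP n. \<integral>\<^sup>+r. indicator {0<..<\<rho> n} r * h r \<partial>lborel)"
  proof (rule nn_integral_monotone_convergence_SUP)
    show "incseq (\<lambda>n r. indicator {0<..<\<rho> n} r * h r)"
    proof (intro incseq_SucI le_funI mult_right_mono)
      fix n r
      have "\<rho> n \<le> \<rho> (Suc n)" by (simp add: \<rho>_def frac_le)
      then show "indicator {0<..<\<rho> n} r \<le> (indicator {0<..<\<rho> (Suc n)} r :: ennreal)"
        by (auto simp: indicator_def)
    qed simp
  qed measurable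
  also have "\<dots> \<le> X" by (intro SUP_least le \<rho>)
  finally show ?thesis .
qed

text \<open>
  The step \<open>r \<mapsto> 1 - \<Lambda> (1 - r)\<close> multiplies the distance to the boundary by \<open>\<Lambda>\<close>.  Because \<open>\<alpha> > -1\<close>,
  a large \<open>\<Lambda>\<close> makes the weighted integral of the shifted function at most \<open>1 / (2 P)\<close> times the
  integral of the function itself, so that the shifted term can be absorbed.  Absorbing requires a
  finite integral, whence the truncation to \<open>r < \<rho>\<close>, which the inward shift respects.
\<close>

lemma ray_absorption:
  fixes \<phi> W :: "real \<Rightarrow> ennreal" and \<alpha> P \<Lambda> :: real
  assumes [measurable]: "\<phi> \<in> borel_measurable borel" "W \<in> borel_measurable borel"
      and P: "P \<ge> 1" and \<alpha>: "\<alpha> > -1" and \<Lambda>: "\<Lambda> \<ge> 2" "2 * P * 2 powr \<bar>\<alpha>\<bar> * 2 ^ d \<le> \<Lambda> powr (1 + \<alpha>)"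
      and bounded: "\<And>\<rho>. 0 < \<rho> \<Longrightarrow> \<rho> < 1 \<Longrightarrow> \<exists>B::real. \<forall>r. 0 < r \<and> r < \<rho> \<longrightarrow> \<phi> r \<le> ennreal B"
      and inner: "\<And>r. 0 < r \<Longrightarrow> r < 1 - 1 / (2 * \<Lambda>) \<Longrightarrow> \<phi> r \<le> W r"
      and outer: "\<And>r. 1 - 1 / (2 * \<Lambda>) \<le> r \<Longrightarrow> r < 1 \<Longrightarrow> \<phi> r \<le> ennreal P * (\<phi> (1 - \<Lambda> * (1 - r)) + W r)"
  shows "ray_integral \<alpha> d \<phi>
     \<le> ennreal (2 * P) * ray_integral \<alpha> d W"
proof (rule nn_integral_up_to_1)
  show "(\<lambda>r. ennreal (ray_weight \<alpha> d r) * \<phi> r) \<in> borel_measurable borel" by measurable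
  fix \<rho> :: real assume \<rho>: "0 < \<rho>" "\<rho> < 1"
  define g where "g = (\<lambda>r. indicator {0<..<\<rho>} r * (ennreal (ray_weight \<alpha> d r) * \<phi> r))"
  have g [measurable]: "g \<in> borel_measurable borel" unfolding g_def by measurable
  define J where "J = (\<integral>\<^sup>+r. g r \<partial>lborel)"
  define Y where "Y = ray_integral \<alpha> d W"
  have shift: "(\<integral>\<^sup>+r. g (1 - \<Lambda> * (1 - r)) \<partial>lborel) = ennreal (1 / \<Lambda>) * J"
  proof -
    have "J = ennreal \<Lambda> * (\<integral>\<^sup>+r. g ((1 - \<Lambda>) + \<Lambda> * r) \<partial>lborel)"
      unfolding J_def using \<Lambda> by (subst nn_integral_real_affine[where c = \<Lambda> and t = "1 - \<Lambda>"]) auto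
    also have "(\<lambda>r. g ((1 - \<Lambda>) + \<Lambda> * r)) = (\<lambda>r. g (1 - \<Lambda> * (1 - r)))"
      by (simp add: algebra_simps)
    finally have "ennreal (1 / \<Lambda>) * J = (ennreal (1 / \<Lambda>) * ennreal \<Lambda>) * (\<integral>\<^sup>+r. g (1 - \<Lambda> * (1 - r)) \<partial>lborel)"
      by (simp only: mult.assoc)
    also have "ennreal (1 / \<Lambda>) * ennreal \<Lambda> = 1" using \<Lambda> by (simp flip: ennreal_mult)
    finally show ?thesis by simp
  qed
  have "g r \<le> ennreal P * (indicator {0<..<1} r * (ennreal (ray_weight \<alpha> d r) * W r))
              + ennreal (\<Lambda> / 2) * g (1 - \<Lambda> * (1 - r))" for r
  proof (cases "0 < r \<and> r < \<rho>")
    case True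
    show ?thesis
    proof (cases "r < 1 - 1 / (2 * \<Lambda>)")
      case r: True
      have "1 * (ennreal (ray_weight \<alpha> d r) * \<phi> r) \<le> ennreal P * (ennreal (ray_weight \<alpha> d r) * W r)"
        using P by (intro mult_mono inner r mult_left_mono) (use True in auto)
      then show ?thesis using True \<rho> by (simp add: g_def add_increasing2)
    next
      case False
      define v where "v = 1 - \<Lambda> * (1 - r)"
      have r1: "1 - 1 / (2 * \<Lambda>) \<le> r" "r < 1" using False True \<rho> by auto
      have "\<Lambda> * (1 - r) \<le> \<Lambda> * (1 / (2 * \<Lambda>))" using r1 \<Lambda> by (intro mult_left_mono) auto
      then have v0: "0 < v" using \<Lambda> by (simp add: v_def)
      have "1 * (1 - r) \<le> \<Lambda> * (1 - r)" using r1 \<Lambda> by (intro mult_right_mono) auto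
      then have v1: "v < \<rho>" using True by (simp add: v_def)
      have "ennreal (ray_weight \<alpha> d r) * \<phi> r
        \<le> ennreal (ray_weight \<alpha> d r) * (ennreal P * (\<phi> v + W r))"
        unfolding v_def by (intro mult_left_mono outer r1) auto
      also have "\<dots> = ennreal P * (ennreal (ray_weight \<alpha> d r) * W r) + ennreal (P * ray_weight \<alpha> d r) * \<phi> v"
        using P True by (simp add: ennreal_mult ray_weight_nonneg distrib_left mult_ac add.commute)
      also have "\<dots> \<le> ennreal P * (ennreal (ray_weight \<alpha> d r) * W r) + ennreal (\<Lambda> / 2 * ray_weight \<alpha> d v) * \<phi> v"
        unfolding v_def using P \<alpha> \<Lambda> r1
        by (intro add_left_mono mult_right_mono ennreal_leI ray_weight_shift) auto
      also have "ennreal (\<Lambda> / 2 * ray_weight \<alpha> d v) * \<phi> v = ennreal (\<Lambda> / 2) * g v"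
      proof -
        have "ennreal (\<Lambda> / 2 * ray_weight \<alpha> d v) = ennreal (\<Lambda> / 2) * ennreal (ray_weight \<alpha> d v)"
          using \<Lambda> v0 by (intro ennreal_mult ray_weight_nonneg) auto
        then show ?thesis using v0 v1 by (simp add: g_def mult.assoc)
      qed
      finally show ?thesis using True \<rho> by (simp add: g_def v_def)
    qed
  qed (auto simp: g_def)
  then have "J \<le> (\<integral>\<^sup>+r. ennreal P * (indicator {0<..<1} r * (ennreal (ray_weight \<alpha> d r) * W r))
              + ennreal (\<Lambda> / 2) * g (1 - \<Lambda> * (1 - r)) \<partial>lborel)"
    unfolding J_def by (rule nn_integral_mono)
  also have "\<dots> = ennreal P * Y + ennreal (\<Lambda> / 2) * (\<integral>\<^sup>+r. g (1 - \<Lambda> * (1 - r)) \<partial>lborel)"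
    unfolding Y_def by (subst nn_integral_add) (simp_all add: nn_integral_cmult)
  also have "ennreal (\<Lambda> / 2) * (\<integral>\<^sup>+r. g (1 - \<Lambda> * (1 - r)) \<partial>lborel) = ennreal (1/2) * J"
    unfolding shift using \<Lambda> by (simp add: mult.assoc[symmetric] flip: ennreal_mult)
  finally have J_le: "J \<le> ennreal P * Y + ennreal (1/2) * J" .
  have "J < \<infinity>"
  proof -
    obtain B where B: "\<And>r. 0 < r \<Longrightarrow> r < \<rho> \<Longrightarrow> \<phi> r \<le> ennreal B" using bounded[OF \<rho>] by blast
    define c where "c = max 1 ((1 - \<rho>\<^sup>2) powr \<alpha>)"
    have "ray_weight \<alpha> d r \<le> c" if "0 < r" "r < \<rho>" for r
      unfolding c_def using that \<rho> by (intro ray_weight_le) auto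
    then have "g r \<le> (ennreal c * ennreal B) * indicator {0..1} r" for r
      using B \<rho> by (cases "0 < r \<and> r < \<rho>") (auto simp: g_def intro!: mult_mono ennreal_leI)
    then have "J \<le> (\<integral>\<^sup>+r. (ennreal c * ennreal B) * indicator {0..1::real} r \<partial>lborel)"
      unfolding J_def by (rule nn_integral_mono)
    also have "\<dots> < \<infinity>" by (simp add: nn_integral_cmult ennreal_mult_less_top)
    finally show ?thesis .
  qed
  then obtain j where j: "j \<ge> 0" "J = ennreal j" by (rule ennreal_cases_finite)
  have "J \<le> ennreal (2 * P) * Y"
  proof (cases "Y < \<infinity>")
    case True
    then obtain y where y: "y \<ge> 0" "Y = ennreal y" by (rule ennreal_cases_finite)
    have "ennreal j \<le> ennreal (P * y + 1/2 * j)"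
    proof -
      have "ennreal (P * y + 1/2 * j) = ennreal P * Y + ennreal (1/2) * J"
        using y(1) j(1) P unfolding y(2) j(2)
        by (subst ennreal_plus, simp, simp, subst (1 2) ennreal_mult) simp_all
      with J_le show ?thesis by (simp only: j(2))
    qed
    then have "j \<le> P * y + 1/2 * j" using j y P by (subst (asm) ennreal_le_iff) auto
    then have "j \<le> 2 * P * y" by simp
    then show ?thesis using j y P by (simp add: ennreal_leI flip: ennreal_mult)
  next
    case False
    then show ?thesis using P by (simp add: less_top[symmetric] ennreal_mult_top)
  qed
  then show "(\<integral>\<^sup>+r. indicator {0<..<\<rho>} r * (ennreal (ray_weight \<alpha> d r) * \<phi> r) \<partial>lborel)
    \<le> ennreal (2 * P) * ray_integral \<alpha> d W"
    by (simp add: J_def g_def Y_def)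
qed

lemma large_step_exists:
  fixes \<alpha> P :: real
  assumes "P > 0" "\<alpha> > -1"
  obtains \<Lambda> where "\<Lambda> \<ge> 2" "2 * P * 2 powr \<bar>\<alpha>\<bar> * 2 ^ d \<le> \<Lambda> powr (1 + \<alpha>)"
proof
  define Q where "Q = 2 * P * 2 powr \<bar>\<alpha>\<bar> * 2 ^ d"
  have "Q > 0" using assms by (simp add: Q_def)
  then have "Q = (Q powr (1 / (1 + \<alpha>))) powr (1 + \<alpha>)" using assms by (simp add: powr_powr)
  also have "\<dots> \<le> max 2 (Q powr (1 / (1 + \<alpha>))) powr (1 + \<alpha>)" using assms by (intro powr_mono2) auto
  finally show "2 * P * 2 powr \<bar>\<alpha>\<bar> * 2 ^ d \<le> max 2 (Q powr (1 / (1 + \<alpha>))) powr (1 + \<alpha>)"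
    by (simp add: Q_def)
qed simp

lemma nn_integral_ball_polar:
  fixes H :: "complex^'n \<Rightarrow> ennreal"
  assumes "H \<in> borel_measurable borel"
  shows "ball_integral \<alpha> H
     = (\<integral>\<^sup>+z. ennreal (shell_weight z) * ray_integral \<alpha> (DIM(complex^'n) - 1) (\<lambda>r. H (r *\<^sub>R sgn z)) \<partial>lborel)"
proof -
  define d where "d = DIM(complex^'n) - 1"
  define F where "F = (\<lambda>z. indicator (ball 0 1) z * ennreal (defect z powr \<alpha>) * H z)"
  have "F \<in> borel_measurable borel"
    unfolding F_def by (rule borel_measurable_ball_integrand[OF assms])
  then have "(\<integral>\<^sup>+z. F z \<partial>lborel) = (\<integral>\<^sup>+z. ennreal (shell_weight z) *
        (\<integral>\<^sup>+r. indicator {0<..} r * ennreal (r ^ d) * F (r *\<^sub>R sgn z) \<partial>lborel) \<partial>lborel)"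
    unfolding d_def by (rule nn_integral_polar)
  also have "\<dots> = (\<integral>\<^sup>+z. ennreal (shell_weight z) * ray_integral \<alpha> d (\<lambda>r. H (r *\<^sub>R sgn z)) \<partial>lborel)"
  proof (rule nn_integral_cong)
    fix z :: "complex^'n"
    show "ennreal (shell_weight z) * (\<integral>\<^sup>+r. indicator {0<..} r * ennreal (r ^ d) * F (r *\<^sub>R sgn z) \<partial>lborel)
       = ennreal (shell_weight z) * ray_integral \<alpha> d (\<lambda>r. H (r *\<^sub>R sgn z))"
    proof (cases "z = 0")
      case False
      then have n: "norm (sgn z) = 1" by (simp add: norm_sgn)
      have "indicator {0<..} r * ennreal (r ^ d) * F (r *\<^sub>R sgn z)
          = indicator {0<..<1} r * (ennreal (ray_weight \<alpha> d r) * H (r *\<^sub>R sgn z))" for r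
      proof (cases "0 < r \<and> r < 1")
        case True
        then have "ennreal (r ^ d) * ennreal (defect (r *\<^sub>R sgn z) powr \<alpha>) = ennreal (ray_weight \<alpha> d r)"
          using n by (simp add: ray_weight_def defect_def mult.commute flip: ennreal_mult)
        then show ?thesis using True n by (simp add: F_def mult.assoc[symmetric])
      qed (use n in \<open>auto simp: F_def indicator_def\<close>)
      then show ?thesis by simp
    qed (simp add: shell_weight_def)
  qed
  finally show ?thesis by (simp add: F_def d_def)
qed

section \<open>The reverse inequality\<close>

text \<open>
  The parameter \<open>17 \<Lambda>\<^sup>2\<close> is large enough for both situations that occur along a ray: two points at
  distance at least \<open>1 / (2 \<Lambda>)\<close> from the boundary, and a point together with the segment to its
  inward shift.
\<close>

lemma inner_points_in_region:
  fixes \<Lambda> :: real and w z :: "complex^'n"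
  assumes \<Lambda>: "\<Lambda> \<ge> 2" and w: "norm w \<le> 1 - 1 / (2 * \<Lambda>)" and z: "norm z \<le> 1 - 1 / (2 * \<Lambda>)"
  shows "w \<in> bergman_region (17 * \<Lambda>\<^sup>2) z"
proof -
  define e where "e = 1 / (2 * \<Lambda>)"
  have e: "0 < e" "e < 1" using \<Lambda> by (auto simp: e_def field_simps)
  have d: "e \<le> defect u" if "norm u \<le> 1 - e" for u :: "complex^'n"
  proof -
    have "(norm u)\<^sup>2 \<le> norm u * 1" unfolding power2_eq_square using that e by (intro mult_left_mono) auto
    then show ?thesis using that by (simp add: defect_def)
  qed
  have dz: "e \<le> defect z" and dw: "e \<le> defect w" using d w z by (simp_all add: e_def)
  have "norm (herm w z) \<le> 1"
  proof -
    have "norm w \<le> 1" "norm z \<le> 1" using w z e by (simp_all only: e_def)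
    then have "norm w * norm z \<le> 1 * 1" by (intro mult_mono) auto
    then show ?thesis using norm_herm_le[of w z] by simp
  qed
  then have "norm (1 - herm w z) \<le> 2" using norm_triangle_ineq4[of 1 "herm w z"] by simp
  then have "(norm (1 - herm w z))\<^sup>2 \<le> 2\<^sup>2" by (intro power_mono) auto
  also have "\<dots> < 17 * \<Lambda>\<^sup>2 * (e * e)" using \<Lambda> by (simp add: e_def power2_eq_square)
  also have "\<dots> \<le> 17 * \<Lambda>\<^sup>2 * (defect z * defect w)"
  proof (intro mult_left_mono mult_mono dz dw)
    show "0 \<le> defect z" using dz e by linarith
  qed (use e in auto)
  finally have "(norm (1 - herm w z))\<^sup>2 < 17 * \<Lambda>\<^sup>2 * (defect z * defect w)" .
  moreover have "norm w < 1" using w e unfolding e_def by linarith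
  ultimately show ?thesis by (simp add: bergman_region_def mult.assoc)
qed

lemma ray_segment_in_region:
  fixes \<Lambda> r s :: real and \<zeta> :: "complex^'n"
  assumes \<Lambda>: "\<Lambda> \<ge> 2" and \<zeta>: "norm \<zeta> = 1" and r: "r < 1"
      and s: "0 \<le> 1 - \<Lambda> * (1 - r)" "1 - \<Lambda> * (1 - r) \<le> s" "s \<le> r"
  shows "s *\<^sub>R \<zeta> \<in> bergman_region (17 * \<Lambda>\<^sup>2) (r *\<^sub>R \<zeta>)"
proof -
  define v where "v = 1 - \<Lambda> * (1 - r)"
  have d: "1 - r \<le> defect (t *\<^sub>R \<zeta>)" if "0 \<le> t" "t \<le> r" for t
  proof -
    have "t\<^sup>2 \<le> t * 1" unfolding power2_eq_square using that r by (intro mult_left_mono) auto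
    then show ?thesis using that \<zeta> by (simp add: defect_def)
  qed
  have "herm (s *\<^sub>R \<zeta>) (r *\<^sub>R \<zeta>) = complex_of_real (s * r)"
  proof -
    have "herm (s *\<^sub>R \<zeta>) (r *\<^sub>R \<zeta>) = complex_of_real s * cnj (complex_of_real r * cnj (herm \<zeta> \<zeta>))"
      by (simp only: scaleR_eq_cscale herm_scale_left herm_commute[of \<zeta> "complex_of_real r *s \<zeta>"] herm_commute[of \<zeta> \<zeta>, symmetric])
    then show ?thesis by (simp add: herm_self \<zeta>)
  qed
  then have n: "norm (1 - herm (s *\<^sub>R \<zeta>) (r *\<^sub>R \<zeta>)) = \<bar>1 - s * r\<bar>"
    by (metis norm_of_real of_real_1 of_real_diff)
  have v: "0 \<le> v" "v \<le> s" using s by (auto simp: v_def)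
  have "v * v \<le> s * r" using v s by (intro mult_mono) auto
  then have "1 - s * r \<le> (1 - v) * (1 + v)" by (simp add: algebra_simps)
  also have "\<dots> \<le> (1 - v) * 2" using v s r by (intro mult_left_mono) auto
  also have "\<dots> = 2 * \<Lambda> * (1 - r)" by (simp add: v_def)
  finally have le: "1 - s * r \<le> 2 * \<Lambda> * (1 - r)" .
  have "s * r \<le> 1 * 1" using v s r by (intro mult_mono) auto
  then have "(norm (1 - herm (s *\<^sub>R \<zeta>) (r *\<^sub>R \<zeta>)))\<^sup>2 \<le> (2 * \<Lambda> * (1 - r))\<^sup>2"
    unfolding n using le by (intro power_mono) auto
  also have "\<dots> = 4 * \<Lambda>\<^sup>2 * ((1 - r) * (1 - r))" by (simp add: power2_eq_square)
  also have "\<dots> < 17 * \<Lambda>\<^sup>2 * ((1 - r) * (1 - r))"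
    using \<Lambda> r by (intro mult_strict_right_mono) auto
  also have "\<dots> \<le> 17 * \<Lambda>\<^sup>2 * (defect (r *\<^sub>R \<zeta>) * defect (s *\<^sub>R \<zeta>))"
    using d[of r] d[of s] v s r by (intro mult_left_mono mult_mono) auto
  finally show ?thesis using v s r \<zeta> by (simp add: bergman_region_def mult.assoc)
qed

text \<open>
  Along a ray the derivative of \<open>g\<close> at \<open>s\<close> is \<open>\<R> g (s \<zeta>) / s\<close>.  Near the origin, where this formula is of
  no use, the maximum modulus principle on the disc spanned by the ray takes its place.
\<close>

lemma ray_increment:
  fixes g :: "complex^'n \<Rightarrow> complex" and r v :: real
  assumes g: "holomorphic_ball g" and \<zeta>: "norm \<zeta> = 1" and v: "0 < v" "v \<le> r" "r < 1"
      and M: "\<And>s. v \<le> s \<Longrightarrow> s \<le> r \<Longrightarrow> norm (radial_deriv g (s *\<^sub>R \<zeta>)) \<le> M * s"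
  shows "norm (g (r *\<^sub>R \<zeta>) - g (v *\<^sub>R \<zeta>)) \<le> M * (r - v)"
proof -
  define S where "S = complex_of_real ` {v..r}"
  have S: "S = closed_segment (complex_of_real v) (complex_of_real r)"
    using v by (simp add: S_def closed_segment_of_real closed_segment_eq_real_ivl)
  have "norm (g (complex_of_real r *s \<zeta>) - g (complex_of_real v *s \<zeta>)) \<le> M * norm (complex_of_real r - complex_of_real v)"
  proof (rule field_differentiable_bound[where S = S and f' = "\<lambda>\<eta>. radial_deriv g (\<eta> *s \<zeta>) / \<eta>"])
    show "convex S" by (simp add: S)
    fix \<eta> assume "\<eta> \<in> S"
    then obtain s where s: "\<eta> = complex_of_real s" "v \<le> s" "s \<le> r" by (auto simp: S_def)
    have "norm (\<eta> *s \<zeta>) < 1" and nz: "\<eta> \<noteq> 0" using s v \<zeta> by (auto simp: norm_cscale)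
    then show "((\<lambda>\<eta>. g (\<eta> *s \<zeta>)) has_field_derivative radial_deriv g (\<eta> *s \<zeta>) / \<eta>) (at \<eta> within S)"
      by (rule has_field_derivative_at_within[OF ray_has_field_derivative[OF g]])
    have "norm \<eta> = s" using s v by (simp add: s(1))
    then show "norm (radial_deriv g (\<eta> *s \<zeta>) / \<eta>) \<le> M"
      using M[OF s(2,3)] nz by (simp add: norm_divide pos_divide_le_eq s(1) scaleR_eq_cscale)
  qed (use v in \<open>auto simp: S_def\<close>)
  also have "norm (complex_of_real r - complex_of_real v) = r - v"
    using v by (metis abs_of_nonneg diff_ge_0_iff_ge norm_of_real of_real_diff)
  finally show ?thesis by (simp add: scaleR_eq_cscale)
qed

lemma ray_increment_from_0:
  fixes g :: "complex^'n \<Rightarrow> complex" and r R :: real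
  assumes g: "holomorphic_ball g" and \<zeta>: "norm \<zeta> = 1" and R: "1/2 \<le> R" "R < 1" and r: "0 < r" "r < R"
      and M: "\<And>w. norm w \<le> R \<Longrightarrow> norm (radial_deriv g w) \<le> M"
  shows "norm (g (r *\<^sub>R \<zeta>) - g 0) \<le> 2 * M"
proof -
  define h where "h = (\<lambda>\<eta>. g (\<eta> *s \<zeta>))"
  have hol: "h holomorphic_on ball 0 1"
    using line_holomorphic_on[OF g, of "ball 0 1" 0 \<zeta>] \<zeta> by (simp add: h_def norm_cscale)
  have hol': "deriv h holomorphic_on ball 0 1" by (intro holomorphic_deriv hol) auto
  have "M \<ge> 0" using M[of 0] R by simp
  have bound: "norm (deriv h \<eta>) \<le> 2 * M" if "norm \<eta> \<le> R" for \<eta>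
  proof (rule maximum_modulus_frontier[where S = "cball 0 R" and f = "deriv h"])
    show "deriv h holomorphic_on interior (cball 0 R)" "continuous_on (closure (cball 0 R)) (deriv h)"
      using R by (auto intro!: holomorphic_on_imp_continuous_on intro: holomorphic_on_subset[OF hol'])
    fix \<xi> :: complex assume "\<xi> \<in> frontier (cball 0 R)"
    then have \<xi>: "norm \<xi> = R" using R by simp
    then have n: "norm (\<xi> *s \<zeta>) = R" "\<xi> \<noteq> 0" using \<zeta> R by (auto simp: norm_cscale)
    then have "deriv h \<xi> = radial_deriv g (\<xi> *s \<zeta>) / \<xi>"
      unfolding h_def using R by (intro DERIV_imp_deriv ray_has_field_derivative g) auto
    then have "norm (deriv h \<xi>) * R \<le> M" using M[of "\<xi> *s \<zeta>"] n R by (simp add: norm_divide \<xi>)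
    then have "norm (deriv h \<xi>) * R \<le> (2 * M) * R"
      using mult_left_mono[of "1/2" R "2 * M"] R \<open>M \<ge> 0\<close> by linarith
    moreover have "0 < R" using R by linarith
    ultimately show "norm (deriv h \<xi>) \<le> 2 * M" by (rule mult_right_le_imp_le)
  qed (use that in auto)
  have "norm (h (complex_of_real r) - h 0) \<le> 2 * M * norm (complex_of_real r - 0)"
  proof (rule field_differentiable_bound[where S = "cball 0 R" and f' = "deriv h"])
    show "(h has_field_derivative deriv h \<eta>) (at \<eta> within cball 0 R)" if "\<eta> \<in> cball 0 R" for \<eta>
      using that R by (intro has_field_derivative_at_within[OF holomorphic_derivI[OF hol]]) auto
  qed (use bound r R in auto)
  also have "\<dots> \<le> 2 * M * 1" using r R \<open>M \<ge> 0\<close> by (intro mult_left_mono) auto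
  finally show ?thesis by (simp add: h_def scaleR_eq_cscale)
qed

lemma powr_add_le:
  fixes a b p :: real
  assumes "0 \<le> a" "0 \<le> b" "p > 0"
  shows "(a + b) powr p \<le> 2 powr p * (a powr p + b powr p)"
proof -
  have "(a + b) powr p \<le> (2 * max a b) powr p" using assms by (intro powr_mono2) auto
  also have "\<dots> = 2 powr p * max a b powr p" using assms by (simp add: powr_mult)
  also have "\<dots> \<le> 2 powr p * (a powr p + b powr p)" by (intro mult_left_mono) (auto simp: max_def)
  finally show ?thesis .
qed

text \<open>
  A bound for the \<open>p\<close>-th power of the increments of \<open>g\<close> near \<open>z\<close>: the mean value inequality for \<open>\<R> g\<close> on
  the region \<open>17 \<Lambda>\<^sup>2\<close>, multiplied by a bound \<open>8 \<Lambda> (1 - |z|\<^sup>2)\<close> for the length of the path.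
\<close>

definition increment_bound :: "real \<Rightarrow> real \<Rightarrow> (complex^'n \<Rightarrow> complex) \<Rightarrow> complex^'n \<Rightarrow> ennreal" where
  "increment_bound p \<Lambda> g z = ennreal ((8 * \<Lambda>) powr p * avg_const DIM(complex^'n) p) *
     (ennreal (defect z powr p) * local_avg (640000 * (17 * \<Lambda>\<^sup>2) ^ 3) (pth_power p (radial_deriv g)) z)"

lemma increment_bound_of_sup:
  fixes z :: "complex^'n"
  assumes g: "holomorphic_ball g" and p: "p > 0" and \<Lambda>: "\<Lambda> \<ge> 2" and z: "norm z < 1" and x: "x \<ge> 0"
      and le: "\<And>M. M \<ge> 0 \<Longrightarrow> (\<And>w. w \<in> bergman_region (17 * \<Lambda>\<^sup>2) z \<Longrightarrow> norm (radial_deriv g w) \<le> M)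
                 \<Longrightarrow> x \<le> (8 * \<Lambda> * defect z) * M"
  shows "ennreal (x powr p) \<le> increment_bound p \<Lambda> g z"
proof -
  define K where "K = 17 * \<Lambda>\<^sup>2"
  have "2\<^sup>2 \<le> \<Lambda>\<^sup>2" using \<Lambda> by (intro power_mono) auto
  then have K: "K \<ge> 1" by (simp add: K_def)
  have "ennreal (x powr p) \<le> ennreal ((8 * \<Lambda> * defect z) powr p) *
      (ennreal (avg_const DIM(complex^'n) p) * local_avg (640000 * K ^ 3) (pth_power p (radial_deriv g)) z)"
    using \<Lambda> defect_pos[OF z]
    by (intro powr_le_of_sup_bound[where S = "bergman_region K z" and g = "radial_deriv g"]
          pth_power_le_local_avg holomorphic_radial_deriv g z p K x le) (auto simp: K_def)
  also have "\<dots> = increment_bound p \<Lambda> g z"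
    using \<Lambda> avg_const_pos[of "DIM(complex^'n)" p] defect_pos[OF z]
    by (simp add: increment_bound_def K_def powr_mult ennreal_mult mult_ac del: DIM_cart)
  finally show ?thesis .
qed

lemma ray_estimate_inner:
  fixes g :: "complex^'n \<Rightarrow> complex"
  assumes g: "holomorphic_ball g" and g0: "g 0 = 0" and p: "p > 0" and \<Lambda>: "\<Lambda> \<ge> 2"
      and \<zeta>: "norm \<zeta> = 1" and r: "0 < r" "r < 1 - 1 / (2 * \<Lambda>)"
  shows "pth_power p g (r *\<^sub>R \<zeta>) \<le> increment_bound p \<Lambda> g (r *\<^sub>R \<zeta>)"
proof -
  define R where "R = 1 - 1 / (2 * \<Lambda>)"
  have e4: "1 / (2 * \<Lambda>) \<le> 1/4" "1 / (2 * \<Lambda>) > 0" using \<Lambda> by (auto simp: field_simps)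
  have R: "1/2 \<le> R" "R < 1" using e4 by (auto simp: R_def)
  note r = r[folded R_def]
  have z: "norm (r *\<^sub>R \<zeta>) < 1" using \<zeta> r R by simp
  have "r\<^sup>2 \<le> r * 1" unfolding power2_eq_square using r R by (intro mult_left_mono) auto
  then have "1 / (2 * \<Lambda>) \<le> defect (r *\<^sub>R \<zeta>)" using r \<zeta> by (simp add: defect_def R_def)
  then have one_le: "1 \<le> 2 * \<Lambda> * defect (r *\<^sub>R \<zeta>)" using \<Lambda> by (simp add: pos_divide_le_eq mult.commute)
  have "ennreal (norm (g (r *\<^sub>R \<zeta>)) powr p) \<le> increment_bound p \<Lambda> g (r *\<^sub>R \<zeta>)"
  proof (rule increment_bound_of_sup[OF g p \<Lambda> z])
    fix M assume M: "M \<ge> 0" "\<And>w. w \<in> bergman_region (17 * \<Lambda>\<^sup>2) (r *\<^sub>R \<zeta>) \<Longrightarrow> norm (radial_deriv g w) \<le> M"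
    have "norm (g (r *\<^sub>R \<zeta>) - g 0) \<le> 2 * M"
    proof (rule ray_increment_from_0[OF g \<zeta> R r])
      fix w :: "complex^'n" assume "norm w \<le> R"
      then have "w \<in> bergman_region (17 * \<Lambda>\<^sup>2) (r *\<^sub>R \<zeta>)"
        using \<Lambda> r \<zeta> by (intro inner_points_in_region) (auto simp: R_def)
      then show "norm (radial_deriv g w) \<le> M" by (rule M(2))
    qed
    also have "\<dots> \<le> 8 * \<Lambda> * defect (r *\<^sub>R \<zeta>) * M"
      using one_le M(1) by (intro mult_right_mono) auto
    finally show "norm (g (r *\<^sub>R \<zeta>)) \<le> 8 * \<Lambda> * defect (r *\<^sub>R \<zeta>) * M" using g0 by simp
  qed simp
  then show ?thesis using z by (simp add: pth_power_def)
qed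

lemma ray_estimate_outer:
  fixes g :: "complex^'n \<Rightarrow> complex"
  assumes g: "holomorphic_ball g" and p: "p > 0" and \<Lambda>: "\<Lambda> \<ge> 2"
      and \<zeta>: "norm \<zeta> = 1" and r: "1 - 1 / (2 * \<Lambda>) \<le> r" "r < 1"
  shows "pth_power p g (r *\<^sub>R \<zeta>) \<le> ennreal (2 powr p) *
           (pth_power p g ((1 - \<Lambda> * (1 - r)) *\<^sub>R \<zeta>) + increment_bound p \<Lambda> g (r *\<^sub>R \<zeta>))"
proof -
  define R where "R = 1 - 1 / (2 * \<Lambda>)"
  have e4: "1 / (2 * \<Lambda>) \<le> 1/4" "1 / (2 * \<Lambda>) > 0" using \<Lambda> by (auto simp: field_simps)
  have R: "1/2 \<le> R" "R < 1" using e4 by (auto simp: R_def)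
  note r = r[folded R_def]
  define v where "v = 1 - \<Lambda> * (1 - r)"
  have z: "norm (r *\<^sub>R \<zeta>) < 1" using \<zeta> r R by simp
  have "\<Lambda> * (1 - r) \<le> \<Lambda> * (1 / (2 * \<Lambda>))" using r \<Lambda> by (intro mult_left_mono) (auto simp: R_def)
  then have v0: "1/2 \<le> v" using \<Lambda> by (simp add: v_def)
  have "1 * (1 - r) \<le> \<Lambda> * (1 - r)" using r \<Lambda> by (intro mult_right_mono) auto
  then have v1: "v \<le> r" by (simp add: v_def)
  have zv: "norm (v *\<^sub>R \<zeta>) < 1" using \<zeta> v0 v1 r by simp
  define D where "D = norm (g (r *\<^sub>R \<zeta>) - g (v *\<^sub>R \<zeta>))"
  have D: "ennreal (D powr p) \<le> increment_bound p \<Lambda> g (r *\<^sub>R \<zeta>)"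
    unfolding D_def
  proof (rule increment_bound_of_sup[OF g p \<Lambda> z])
    fix M assume M: "M \<ge> 0" "\<And>w. w \<in> bergman_region (17 * \<Lambda>\<^sup>2) (r *\<^sub>R \<zeta>) \<Longrightarrow> norm (radial_deriv g w) \<le> M"
    have "norm (g (r *\<^sub>R \<zeta>) - g (v *\<^sub>R \<zeta>)) \<le> (2 * M) * (r - v)"
    proof (rule ray_increment[OF g \<zeta> _ v1 r(2)])
      fix s assume s: "v \<le> s" "s \<le> r"
      then have "s *\<^sub>R \<zeta> \<in> bergman_region (17 * \<Lambda>\<^sup>2) (r *\<^sub>R \<zeta>)"
        using \<Lambda> r \<zeta> v0 by (intro ray_segment_in_region) (auto simp: v_def)
      then have "norm (radial_deriv g (s *\<^sub>R \<zeta>)) \<le> M" by (rule M(2))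
      also have "M * 1 \<le> M * (2 * s)" using M(1) v0 s by (intro mult_left_mono) auto
      finally show "norm (radial_deriv g (s *\<^sub>R \<zeta>)) \<le> 2 * M * s" by (simp add: mult_ac)
    qed (use v0 in simp)
    also have "\<dots> \<le> (2 * M) * (4 * \<Lambda> * defect (r *\<^sub>R \<zeta>))"
    proof (intro mult_left_mono)
      have "r\<^sup>2 \<le> r * 1" unfolding power2_eq_square using r R by (intro mult_left_mono) auto
      then have "1 - r \<le> defect (r *\<^sub>R \<zeta>)" using \<zeta> by (simp add: defect_def)
      then have "\<Lambda> * (1 - r) \<le> \<Lambda> * defect (r *\<^sub>R \<zeta>)" using \<Lambda> by (intro mult_left_mono) auto
      moreover have "0 \<le> \<Lambda> * defect (r *\<^sub>R \<zeta>)" using \<Lambda> defect_pos[OF z] by simp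
      moreover have "r - v \<le> \<Lambda> * (1 - r)" using r by (simp add: v_def)
      ultimately show "r - v \<le> 4 * \<Lambda> * defect (r *\<^sub>R \<zeta>)" by (simp add: mult.assoc)
    qed (use M(1) in simp)
    finally show "norm (g (r *\<^sub>R \<zeta>) - g (v *\<^sub>R \<zeta>)) \<le> (8 * \<Lambda> * defect (r *\<^sub>R \<zeta>)) * M" by (simp add: mult_ac)
  qed simp
  have "norm (g (r *\<^sub>R \<zeta>)) \<le> norm (g (v *\<^sub>R \<zeta>)) + D"
    unfolding D_def by (rule norm_triangle_sub)
  then have "norm (g (r *\<^sub>R \<zeta>)) powr p \<le> (norm (g (v *\<^sub>R \<zeta>)) + D) powr p"
    using p by (intro powr_mono2) auto
  also have "\<dots> \<le> 2 powr p * (norm (g (v *\<^sub>R \<zeta>)) powr p + D powr p)"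
    using p by (intro powr_add_le) (auto simp: D_def)
  finally have "ennreal (norm (g (r *\<^sub>R \<zeta>)) powr p) \<le> ennreal (2 powr p) * (ennreal (norm (g (v *\<^sub>R \<zeta>)) powr p) + ennreal (D powr p))"
    by (simp add: ennreal_leI flip: ennreal_mult ennreal_plus)
  also have "\<dots> \<le> ennreal (2 powr p) * (ennreal (norm (g (v *\<^sub>R \<zeta>)) powr p) + increment_bound p \<Lambda> g (r *\<^sub>R \<zeta>))"
    by (intro mult_left_mono add_left_mono D) auto
  finally show ?thesis using z zv by (simp add: pth_power_def v_def)
qed

text \<open>
  On every ray the two estimates above are the hypotheses of the absorption lemma; polar coordinates
  put the rays together, and the local averages integrate out as before.
\<close>

theorem bergman_integral_le_radial_deriv:
  fixes \<alpha> p :: real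
  assumes p: "p > 0" and \<alpha>: "\<alpha> > -1"
  shows "dominated (holomorphic_functions0 :: (complex^'n \<Rightarrow> complex) set)
           (bergman_integral \<alpha> p) (\<lambda>g. bergman_integral (\<alpha> + p) p (radial_deriv g))"
proof -
  define P where "P = 2 powr p"
  have P: "P \<ge> 1" unfolding P_def using p by (intro ge_one_powr_ge_zero) auto
  define d where "d = DIM(complex^'n) - 1"
  obtain \<Lambda> where \<Lambda>2: "\<Lambda> \<ge> 2" and \<Lambda>Q: "2 * P * 2 powr \<bar>\<alpha>\<bar> * 2 ^ d \<le> \<Lambda> powr (1 + \<alpha>)"
    using large_step_exists[OF _ \<alpha>, of P d] P by auto
  define C where "C = (8 * \<Lambda>) powr p * avg_const DIM(complex^'n) p"
  define L where "L = 640000 * (17 * \<Lambda>\<^sup>2) ^ 3"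
  have "2\<^sup>2 \<le> \<Lambda>\<^sup>2" using \<Lambda>2 by (intro power_mono) auto
  then have "1 \<le> (17 * \<Lambda>\<^sup>2) ^ 3" by (intro one_le_power) simp
  then have C: "C > 0" and L: "L \<ge> 1" using \<Lambda>2 by (simp_all add: C_def L_def avg_const_pos)
  obtain C' where C': "C' > 0" and int:
    "\<And>h q c (f :: complex^'n \<Rightarrow> complex). holomorphic_ball f \<Longrightarrow> c > 0 \<Longrightarrow>
       (\<And>z. norm z < 1 \<Longrightarrow> h z \<le> ennreal (defect z powr (\<alpha> + p)) * (ennreal c * local_avg L (pth_power q f) z)) \<Longrightarrow>
       (\<integral>\<^sup>+z. indicator (ball 0 1) z * h z \<partial>lborel) \<le> ennreal (c * C') * bergman_integral (\<alpha> + p) q f"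
    using nn_integral_le_of_local_avg[OF L] by blast
  have "bergman_integral \<alpha> p g \<le> ennreal (2 * P * (C * C')) * bergman_integral (\<alpha> + p) p (radial_deriv g)"
    if g: "holomorphic_ball g" "g 0 = 0" for g :: "complex^'n \<Rightarrow> complex"
  proof -
    note h = holomorphic_radial_deriv[OF g(1)]
    define W where "W = increment_bound p \<Lambda> g"
    have W_eq: "W z = ennreal C * (ennreal (defect z powr p) * local_avg L (pth_power p (radial_deriv g)) z)" for z
      by (simp add: W_def increment_bound_def C_def L_def)
    note [measurable] = borel_measurable_local_avg[OF borel_measurable_pth_power[OF h], of L p]
      borel_measurable_pth_power[OF g(1), of p]
    have W [measurable]: "W \<in> borel_measurable borel" unfolding W_eq[abs_def] by measurable
    define ray_int where "ray_int = (\<lambda>(H :: complex^'n \<Rightarrow> ennreal) \<zeta>.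
        ray_integral \<alpha> d (\<lambda>r. H (r *\<^sub>R \<zeta>)))"
    have polar: "ball_integral \<alpha> H
        = (\<integral>\<^sup>+z. ennreal (shell_weight z) * ray_int H (sgn z) \<partial>lborel)" if "H \<in> borel_measurable borel" for H
      unfolding ray_int_def d_def by (rule nn_integral_ball_polar[OF that])
    have ray: "ray_int (pth_power p g) \<zeta> \<le> ennreal (2 * P) * ray_int W \<zeta>" if \<zeta>: "norm \<zeta> = 1" for \<zeta>
      unfolding ray_int_def
    proof (rule ray_absorption[OF _ _ P \<alpha> \<Lambda>2 \<Lambda>Q])
      show "(\<lambda>r. pth_power p g (r *\<^sub>R \<zeta>)) \<in> borel_measurable borel" "(\<lambda>r. W (r *\<^sub>R \<zeta>)) \<in> borel_measurable borel"
        by measurable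
      show "pth_power p g (r *\<^sub>R \<zeta>) \<le> W (r *\<^sub>R \<zeta>)" if "0 < r" "r < 1 - 1 / (2 * \<Lambda>)" for r
        unfolding W_def by (rule ray_estimate_inner[OF g p \<Lambda>2 \<zeta> that])
      show "pth_power p g (r *\<^sub>R \<zeta>) \<le> ennreal P * (pth_power p g ((1 - \<Lambda> * (1 - r)) *\<^sub>R \<zeta>) + W (r *\<^sub>R \<zeta>))"
        if "1 - 1 / (2 * \<Lambda>) \<le> r" "r < 1" for r
        unfolding W_def P_def by (rule ray_estimate_outer[OF g(1) p \<Lambda>2 \<zeta> that])
      fix \<rho> :: real assume \<rho>: "0 < \<rho>" "\<rho> < 1"
      have "continuous_on (cball 0 \<rho>) g"
        by (rule continuous_on_subset[OF holomorphic_ball_continuous_on[OF g(1)]]) (use \<rho> in auto)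
      then have "bounded (g ` cball 0 \<rho>)"
        by (intro compact_imp_bounded compact_continuous_image) auto
      then obtain B where B: "\<And>w. w \<in> cball 0 \<rho> \<Longrightarrow> norm (g w) \<le> B"
        unfolding bounded_iff by blast
      have "pth_power p g (r *\<^sub>R \<zeta>) \<le> ennreal (B powr p)" if "0 < r" "r < \<rho>" for r
      proof -
        have "norm (g (r *\<^sub>R \<zeta>)) \<le> B" using that \<zeta> by (intro B) simp
        then have "norm (g (r *\<^sub>R \<zeta>)) powr p \<le> B powr p" using p by (intro powr_mono2) auto
        then show ?thesis by (auto simp: pth_power_def indicator_def intro: ennreal_leI)
      qed
      then show "\<exists>B::real. \<forall>r. 0 < r \<and> r < \<rho> \<longrightarrow> pth_power p g (r *\<^sub>R \<zeta>) \<le> ennreal B" by blast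
    qed
    have "bergman_integral \<alpha> p g = (\<integral>\<^sup>+z. ennreal (shell_weight z) * ray_int (pth_power p g) (sgn z) \<partial>lborel)"
      unfolding bergman_integral_def by (rule polar) measurable
    also have "\<dots> \<le> (\<integral>\<^sup>+z. ennreal (2 * P) * (ennreal (shell_weight z) * ray_int W (sgn z)) \<partial>lborel)"
    proof (rule nn_integral_mono)
      fix z :: "complex^'n"
      show "ennreal (shell_weight z) * ray_int (pth_power p g) (sgn z)
        \<le> ennreal (2 * P) * (ennreal (shell_weight z) * ray_int W (sgn z))"
      proof (cases "z = 0")
        case False
        then have "norm (sgn z) = 1" by (simp add: norm_sgn)
        from mult_left_mono[OF ray[OF this], of "ennreal (shell_weight z)"] show ?thesis
          by (simp add: mult.left_commute)
      qed (simp add: shell_weight_def)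
    qed
    also have "\<dots> = ennreal (2 * P) * (\<integral>\<^sup>+z. ennreal (shell_weight z) * ray_int W (sgn z) \<partial>lborel)"
      unfolding ray_int_def by (intro nn_integral_cmult) measurable
    also have "(\<integral>\<^sup>+z. ennreal (shell_weight z) * ray_int W (sgn z) \<partial>lborel)
        = (\<integral>\<^sup>+z. indicator (ball 0 1) z * (ennreal (defect z powr \<alpha>) * W z) \<partial>lborel)"
      by (simp add: polar[OF W, symmetric] mult.assoc)
    also have "\<dots> \<le> ennreal (C * C') * bergman_integral (\<alpha> + p) p (radial_deriv g)"
      by (rule int[OF h C]) (simp add: W_eq powr_add ennreal_mult mult_ac)
    finally have "bergman_integral \<alpha> p g \<le> ennreal (2 * P) * (ennreal (C * C') * bergman_integral (\<alpha> + p) p (radial_deriv g))"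
      by (simp add: mult_left_mono)
    then show ?thesis using C C' P by (simp add: ennreal_mult mult.assoc)
  qed
  then show ?thesis using P C C' by (intro dominatedI[of "2 * P * (C * C')"]) auto
qed

section \<open>Changing the order of the derivative\<close>

text \<open>
  Only for \<open>\<alpha> > -1\<close> are constants integrable; membership of \<open>f\<close> at order \<open>0\<close> depends on this.
\<close>

lemma bergman_integral_const_finite:
  fixes \<alpha> p :: real
  assumes \<alpha>: "\<alpha> > -1"
  shows "bergman_integral \<alpha> p (\<lambda>_ :: complex^'n. c) < \<infinity>"
proof -
  define d where "d = DIM(complex^'n) - 1"
  define cp where "cp = norm c powr p"
  obtain \<Lambda> where \<Lambda>2: "\<Lambda> \<ge> 2" and \<Lambda>Q: "2 * 1 * 2 powr \<bar>\<alpha>\<bar> * 2 ^ d \<le> \<Lambda> powr (1 + \<alpha>)"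
    using large_step_exists[OF _ \<alpha>, of 1 d] by auto
  define R where "R = 1 - 1 / (2 * \<Lambda>)"
  have R: "R < 1" using \<Lambda>2 by (simp add: R_def)
  define b where "b = max 1 ((1 - R\<^sup>2) powr \<alpha>)"
  let ?X = "ray_integral \<alpha> d (\<lambda>r. ennreal cp)"
  (* A constant is dominated by its own inward shift, so that absorption leaves r <= R only,
     where the weight is comparable to that for exponent 0. *)
  have "?X \<le> ennreal (2 * 1) * ray_integral \<alpha> d (\<lambda>r. ennreal cp * indicator {..R} r)"
    by (rule ray_absorption[OF _ _ _ \<alpha> \<Lambda>2 \<Lambda>Q]) (auto simp: R_def)
  also have "\<dots> \<le> ennreal (2 * 1) * ray_integral 0 d (\<lambda>r. ennreal (b * cp))"
  proof (rule mult_left_mono, rule nn_integral_mono)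
    fix r :: real
    have "ray_weight \<alpha> d r \<le> ray_weight 0 d r * b" if r: "0 < r" "r < 1" "r \<le> R"
    proof -
      have "(1 - r\<^sup>2) powr \<alpha> \<le> b" using ray_weight_le[of r R \<alpha> 0] r R by (simp add: ray_weight_def b_def)
      then show ?thesis using r one_minus_square_pos[of r] by (simp add: ray_weight_def mult.commute mult_left_mono)
    qed
    then show "indicator {0<..<1} r * (ennreal (ray_weight \<alpha> d r) * (ennreal cp * indicator {..R} r))
      \<le> indicator {0<..<1} r * (ennreal (ray_weight 0 d r) * ennreal (b * cp))"
      by (auto simp: indicator_def b_def cp_def ray_weight_nonneg mult.assoc[symmetric] intro!: ennreal_leI mult_right_mono
          simp flip: ennreal_mult)
  qed simp
  finally have X: "?X \<le> ennreal 2 * ray_integral 0 d (\<lambda>r. ennreal (b * cp))" by simp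
  have polar: "ball_integral \<beta> (\<lambda>_ :: complex^'n. ennreal e)
     = (\<integral>\<^sup>+z. ennreal (shell_weight (z :: complex^'n)) * ray_integral \<beta> d (\<lambda>r. ennreal e) \<partial>lborel)" for \<beta> e
    unfolding d_def by (rule nn_integral_ball_polar) simp
  have "bergman_integral \<alpha> p (\<lambda>_ :: complex^'n. c) = ball_integral \<alpha> (\<lambda>_ :: complex^'n. ennreal cp)"
    unfolding bergman_integral_def cp_def by (intro nn_integral_cong) (simp add: pth_power_def indicator_def)
  also have "\<dots> \<le> (\<integral>\<^sup>+z. ennreal 2 * (ennreal (shell_weight (z :: complex^'n)) * ray_integral 0 d (\<lambda>r. ennreal (b * cp))) \<partial>lborel)"
    unfolding polar by (intro nn_integral_mono order_trans[OF mult_left_mono[OF X]]) (auto simp: mult.left_commute)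
  also have "\<dots> = ennreal 2 * ball_integral 0 (\<lambda>_ :: complex^'n. ennreal (b * cp))"
    unfolding polar by (intro nn_integral_cmult) measurable
  also have "\<dots> \<le> ennreal 2 * (\<integral>\<^sup>+z. ennreal (b * cp) * indicator (ball (0 :: complex^'n) 1) z \<partial>lborel)"
    by (intro mult_left_mono nn_integral_mono) (auto simp: indicator_def)
  also have "\<dots> < \<infinity>"
    using emeasure_lborel_ball_finite[of "0 :: complex^'n" 1] by (simp add: nn_integral_cmult_indicator ennreal_mult_less_top)
  finally show ?thesis .
qed

lemma radial_deriv_iter_0: "f 0 = 0 \<Longrightarrow> (radial_deriv ^^ m) f 0 = 0"
  by (cases m) auto

text \<open>
  Up to normalisation, the \<open>p\<close>-th power of the norm of \<open>f\<close> computed with \<open>m\<close> derivatives.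
\<close>

definition order_integral :: "real \<Rightarrow> real \<Rightarrow> nat \<Rightarrow> (complex^'n \<Rightarrow> complex) \<Rightarrow> ennreal" where
  "order_integral \<alpha> p m f = bergman_integral (\<alpha> + p * real m) p ((radial_deriv ^^ m) f)"

lemma order_integral_diff_const: "m > 0 \<Longrightarrow> order_integral \<alpha> p m (\<lambda>z. f z - c) = order_integral \<alpha> p m f"
  by (simp add: order_integral_def radial_deriv_iter_diff_const)

lemma order_integral_raise:
  assumes p: "p > 0"
  shows "dominated (holomorphic_functions :: (complex^'n \<Rightarrow> complex) set)
           (order_integral \<alpha> p (m + j)) (order_integral \<alpha> p m)"
proof (induction j)
  case (Suc j)
  have "dominated holomorphic_functions
      (\<lambda>f :: complex^'n \<Rightarrow> complex. bergman_integral (\<alpha> + p * real (m + j) + p) p (radial_deriv ((radial_deriv ^^ (m + j)) f)))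
      (\<lambda>f. bergman_integral (\<alpha> + p * real (m + j)) p ((radial_deriv ^^ (m + j)) f))"
    by (rule dominated_compose[OF bergman_integral_radial_deriv_le[OF p]])
       (auto intro: holomorphic_radial_deriv_iter)
  then have "dominated holomorphic_functions (order_integral \<alpha> p (m + Suc j) :: (complex^'n \<Rightarrow> complex) \<Rightarrow> ennreal)
      (order_integral \<alpha> p (m + j))"
    by (simp add: order_integral_def[abs_def] algebra_simps)
  then show ?case by (rule dominated_trans[OF _ Suc.IH])
qed (simp add: dominated_refl)

lemma order_integral_lower:
  assumes p: "p > 0" and m: "p * real m + \<alpha> > -1"
  shows "dominated (holomorphic_functions0 :: (complex^'n \<Rightarrow> complex) set)
           (order_integral \<alpha> p m) (order_integral \<alpha> p (m + j))"
proof (induction j)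
  case (Suc j)
  have "p * real m \<le> p * real (m + j)" using p by (intro mult_left_mono) auto
  then have "\<alpha> + p * real (m + j) > -1" using m by linarith
  then have "dominated holomorphic_functions0
      (\<lambda>f :: complex^'n \<Rightarrow> complex. bergman_integral (\<alpha> + p * real (m + j)) p ((radial_deriv ^^ (m + j)) f))
      (\<lambda>f. bergman_integral (\<alpha> + p * real (m + j) + p) p (radial_deriv ((radial_deriv ^^ (m + j)) f)))"
    by (intro dominated_compose[OF bergman_integral_le_radial_deriv[OF p]])
       (auto intro: holomorphic_radial_deriv_iter radial_deriv_iter_0)
  then have "dominated holomorphic_functions0 (order_integral \<alpha> p (m + j) :: (complex^'n \<Rightarrow> complex) \<Rightarrow> ennreal)
      (order_integral \<alpha> p (m + Suc j))"
    by (simp add: order_integral_def[abs_def] algebra_simps)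
  then show ?case by (rule dominated_trans[OF Suc.IH])
qed (simp add: dominated_refl)

text \<open>
  Derivatives are added by Cauchy's estimate and removed by the Hardy inequality.  The latter is
  applied to \<open>\<R>\<^sup>j f\<close> with weight exponent \<open>\<alpha> + p j\<close> for \<open>m \<le> j < k\<close>, which exceeds \<open>-1\<close> as soon as
  \<open>\<alpha> + p m\<close> does.
\<close>

theorem order_integral_equivalent:
  assumes p: "p > 0" and m: "p * real m + \<alpha> > -1"
  shows "dominated (holomorphic_functions0 :: (complex^'n \<Rightarrow> complex) set)
           (order_integral \<alpha> p m) (order_integral \<alpha> p k)"
proof (cases "m \<le> k")
  case True
  then show ?thesis using order_integral_lower[OF p m, of "k - m"] by simp
next
  case False
  then have "dominated (holomorphic_functions :: (complex^'n \<Rightarrow> complex) set)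
       (order_integral \<alpha> p m) (order_integral \<alpha> p k)"
    using order_integral_raise[OF p, of \<alpha> k "m - k"] by simp
  from dominated_compose[OF this, of holomorphic_functions0 "\<lambda>f. f"] show ?thesis by simp
qed

lemma order_integral_0_finite_diff_const:
  fixes f :: "complex^'n \<Rightarrow> complex"
  assumes f: "holomorphic_ball f" and p: "p > 0" and \<alpha>: "\<alpha> > -1"
      and fin: "order_integral \<alpha> p 0 (\<lambda>z. f z - c) < \<infinity>"
  shows "order_integral \<alpha> p 0 f < \<infinity>"
proof -
  note hol = holomorphic_ball_diff_const[OF f, of c]
  have meas: "(\<lambda>z. indicator (ball 0 1) z * ennreal (defect z powr \<alpha>) * pth_power p g z) \<in> borel_measurable borel"
    if "holomorphic_ball g" for g :: "complex^'n \<Rightarrow> complex"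
    by (intro borel_measurable_ball_integrand borel_measurable_pth_power that)
  have c: "holomorphic_ball (\<lambda>_ :: complex^'n. c)"
    unfolding holomorphic_ball_def by (intro ballI exI[of _ "\<lambda>_. 0"]) auto
  have "bergman_integral \<alpha> p f \<le> (\<integral>\<^sup>+z. ennreal (2 powr p) *
      (indicator (ball 0 1) z * ennreal (defect z powr \<alpha>) * pth_power p (\<lambda>z. f z - c) z +
       indicator (ball 0 1) z * ennreal (defect z powr \<alpha>) * pth_power p (\<lambda>_. c) z) \<partial>lborel)"
    unfolding bergman_integral_def
  proof (rule nn_integral_mono)
    fix z :: "complex^'n"
    show "indicator (ball 0 1) z * ennreal (defect z powr \<alpha>) * pth_power p f z
      \<le> ennreal (2 powr p) * (indicator (ball 0 1) z * ennreal (defect z powr \<alpha>) * pth_power p (\<lambda>z. f z - c) z +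
       indicator (ball 0 1) z * ennreal (defect z powr \<alpha>) * pth_power p (\<lambda>_. c) z)"
    proof (cases "norm z < 1")
      case True
      have "norm (f z) powr p \<le> (norm (f z - c) + norm c) powr p"
        using p norm_triangle_sub[of "f z" c] by (intro powr_mono2) (auto simp: add.commute)
      also have "\<dots> \<le> 2 powr p * (norm (f z - c) powr p + norm c powr p)"
        using p by (intro powr_add_le) auto
      finally have "ennreal (norm (f z) powr p) \<le> ennreal (2 powr p) * (ennreal (norm (f z - c) powr p) + ennreal (norm c powr p))"
        by (simp add: ennreal_leI flip: ennreal_mult ennreal_plus)
      from mult_left_mono[OF this, of "ennreal (defect z powr \<alpha>)"] show ?thesis
        using True by (simp add: pth_power_def distrib_left mult.left_commute)
    qed simp
  qed
  also have "\<dots> = ennreal (2 powr p) * (bergman_integral \<alpha> p (\<lambda>z. f z - c) + bergman_integral \<alpha> p (\<lambda>_ :: complex^'n. c))"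
    unfolding bergman_integral_def using meas[OF hol] meas[OF c]
    by (simp add: nn_integral_cmult nn_integral_add)
  also have "\<dots> < \<infinity>"
    using fin bergman_integral_const_finite[OF \<alpha>, of p c, where 'n = 'n]
    by (simp add: order_integral_def ennreal_mult_less_top)
  finally show ?thesis by (simp add: order_integral_def)
qed

section \<open>Weighted Lebesgue measure\<close>

definition mass_const :: "'n::finite itself \<Rightarrow> real \<Rightarrow> real" where
  "mass_const _ \<alpha> = bergman_const CARD('n) \<alpha> / measure lborel (ball (0 :: complex^'n) 1)"

lemma mass_const_pos: "mass_const TYPE('n::finite) \<alpha> > 0"
proof -
  have "bergman_const CARD('n) \<alpha> > 0"
    by (simp add: bergman_const_def Gamma_real_pos)
  then show ?thesis
    unfolding mass_const_def by (intro divide_pos_pos content_ball_pos) auto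
qed

lemma sets_weighted_measure:
  "sets (weighted_measure \<alpha>) = sets (restrict_space lborel (ball 0 1))"
  by (simp add: weighted_measure_def ball_measure_def)

lemma borel_measurable_weighted_measure_iff:
  "f \<in> borel_measurable (weighted_measure \<alpha>) \<longleftrightarrow> f \<in> borel_measurable (restrict_space lborel (ball 0 1))"
  by (simp add: measurable_cong_sets[OF sets_weighted_measure refl])

lemma nn_integral_weighted_measure:
  fixes h :: "complex^'n \<Rightarrow> ennreal"
  assumes h: "h \<in> borel_measurable (restrict_space lborel (ball 0 1))"
  shows "(\<integral>\<^sup>+z. h z \<partial>weighted_measure \<alpha>) = ennreal (mass_const TYPE('n) \<alpha>) *
     ball_integral \<alpha> h"
proof -
  define V where "V = measure lborel (ball (0 :: complex^'n) 1)"
  have V: "V > 0" unfolding V_def by (rule content_ball_pos) simp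
  have eV: "emeasure lborel (ball (0 :: complex^'n) 1) = ennreal V"
    unfolding V_def using emeasure_lborel_ball_finite[of "0 :: complex^'n" 1]
    by (intro emeasure_eq_ennreal_measure) auto
  define b where "b = bergman_const CARD('n) \<alpha>"
  have b: "b > 0" using mass_const_pos[where 'n = 'n, of \<alpha>] V
    by (simp add: mass_const_def b_def V_def zero_less_divide_iff)
  define M where "M = restrict_space lborel (ball (0 :: complex^'n) 1)"
  have [measurable]: "(\<lambda>z. ennreal (b * defect z powr \<alpha>)) \<in> borel_measurable M"
    unfolding M_def by (intro measurable_restrict_space1) measurable
  note [measurable] = h[folded M_def]
  have "(\<integral>\<^sup>+z. h z \<partial>weighted_measure \<alpha>) = (\<integral>\<^sup>+z. ennreal (b * defect z powr \<alpha>) * h z \<partial>scale_measure (ennreal (1 / V)) M)"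
    unfolding weighted_measure_def ball_measure_def eV M_def[symmetric] b_def[symmetric] defect_def[symmetric]
    using V by (subst nn_integral_density) (simp_all add: inverse_ennreal inverse_eq_divide)
  also have "\<dots> = ennreal (1 / V) * (\<integral>\<^sup>+z. ennreal (b * defect z powr \<alpha>) * h z \<partial>M)"
    by (intro nn_integral_scale_measure) measurable
  also have "(\<integral>\<^sup>+z. ennreal (b * defect z powr \<alpha>) * h z \<partial>M)
     = (\<integral>\<^sup>+z. ennreal b * (ennreal (defect z powr \<alpha>) * h z) \<partial>M)"
    using b by (simp add: ennreal_mult mult.assoc)
  also have "\<dots> = ennreal b * (\<integral>\<^sup>+z. ennreal (defect z powr \<alpha>) * h z \<partial>M)"
  proof (rule nn_integral_cmult)
    have "(\<lambda>z. ennreal (defect z powr \<alpha>)) \<in> borel_measurable M"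
      unfolding M_def by (intro measurable_restrict_space1) measurable
    then show "(\<lambda>z. ennreal (defect z powr \<alpha>) * h z) \<in> borel_measurable M" by measurable
  qed
  also have "(\<integral>\<^sup>+z. ennreal (defect z powr \<alpha>) * h z \<partial>M)
      = ball_integral \<alpha> h"
    unfolding M_def by (subst nn_integral_restrict_space) (simp_all add: mult_ac)
  also have "ennreal (1 / V) * (ennreal b * ball_integral \<alpha> h)
      = ennreal (b / V) * ball_integral \<alpha> h"
    using V b by (simp add: mult.assoc[symmetric] flip: ennreal_mult)
  finally show ?thesis by (simp add: mass_const_def b_def V_def)
qed

lemma borel_measurable_weighted_radial:
  assumes "holomorphic_ball f"
  shows "weighted_radial m f \<in> borel_measurable (restrict_space lborel (ball 0 1))"
proof -
  have "continuous_on (ball 0 1) (weighted_radial m f)"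
    unfolding weighted_radial_def[abs_def]
    by (intro continuous_intros holomorphic_ball_continuous_on holomorphic_radial_deriv_iter assms)
  then have "weighted_radial m f \<in> borel_measurable (restrict_space borel (ball 0 1))"
    by (rule borel_measurable_continuous_on_restrict)
  then show ?thesis by (simp add: measurable_cong_sets[OF sets_restrict_space_cong[OF sets_lborel] refl])
qed

text \<open>The maximal function is lower semicontinuous, because \<open>w \<in> D(z,\<gamma>)\<close> is an open condition on \<open>z\<close>.\<close>

lemma borel_measurable_max_radial:
  fixes f :: "complex^'n \<Rightarrow> complex"
  assumes f: "holomorphic_ball f" and \<gamma>: "\<gamma> > 0"
  shows "max_radial k \<gamma> f \<in> borel_measurable (restrict_space lborel (ball 0 1))"
  unfolding borel_measurable_iff_greater
proof
  fix a :: real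
  define K where "K = (cosh \<gamma>)\<^sup>2"
  have K: "K > 1" unfolding K_def by (rule cosh_square_gt_1[OF \<gamma>])
  define h where "h = (\<lambda>w. norm (complex_of_real (defect w ^ k) * (radial_deriv ^^ k) f w))"
  define U where "U = (\<Union>w \<in> {w. norm w < 1 \<and> a < h w}. {z. norm z < 1 \<and> (norm (1 - herm w z))\<^sup>2 < K * defect z * defect w})"
  have "open U"
    unfolding U_def defect_def by (intro open_UN ballI open_Collect_conj open_Collect_less continuous_intros)
  moreover have "{z \<in> space (restrict_space lborel (ball 0 1)). a < max_radial k \<gamma> f z} = U"
  proof -
    have "a < max_radial k \<gamma> f z \<longleftrightarrow> (\<exists>w\<in>bergman_region K z. a < h w)" if z: "norm z < 1" for z
      unfolding max_radial_eq[OF z \<gamma>] K_def[symmetric] h_def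
      using bergman_region_self[OF z K]
      by (intro less_cSUP_iff bdd_above_weighted holomorphic_radial_deriv_iter f z K) auto
    then show ?thesis
      by (auto simp: U_def space_restrict_space bergman_region_def)
  qed
  moreover have "U \<subseteq> ball 0 1" by (auto simp: U_def)
  ultimately show "{z \<in> space (restrict_space lborel (ball 0 1)). a < max_radial k \<gamma> f z} \<in> sets (restrict_space lborel (ball 0 1))"
    by (subst sets_restrict_space_iff) auto
qed

lemma norm_weighted_radial_powr:
  assumes "norm z < 1"
  shows "norm (weighted_radial m f z) powr p = defect z powr (p * real m) * norm ((radial_deriv ^^ m) f z) powr p"
proof -
  have "norm (weighted_radial m f z) = defect z ^ m * norm ((radial_deriv ^^ m) f z)"
    using defect_pos[OF assms] by (simp add: weighted_radial_def defect_def norm_mult norm_power flip: of_real_power)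
  then show ?thesis using defect_pos[OF assms] by (simp add: powr_mult defect_power_powr[OF assms])
qed

lemma nn_integral_weighted_radial:
  fixes f :: "complex^'n \<Rightarrow> complex"
  assumes f: "holomorphic_ball f" and p: "p > 0"
  shows "(\<integral>\<^sup>+z. ennreal (norm (weighted_radial m f z) powr p) \<partial>weighted_measure \<alpha>)
     = ennreal (mass_const TYPE('n) \<alpha>) * order_integral \<alpha> p m f"
proof -
  note [measurable] = borel_measurable_weighted_radial[OF f, of m]
  have "(\<integral>\<^sup>+z. ennreal (norm (weighted_radial m f z) powr p) \<partial>weighted_measure \<alpha>)
    = ennreal (mass_const TYPE('n) \<alpha>) *
     ball_integral \<alpha> (\<lambda>z. ennreal (norm (weighted_radial m f z) powr p))"
    by (rule nn_integral_weighted_measure) measurable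
  also have "ball_integral \<alpha> (\<lambda>z. ennreal (norm (weighted_radial m f z) powr p))
     = order_integral \<alpha> p m f"
    unfolding order_integral_def bergman_integral_def
  proof (rule nn_integral_cong)
    fix z :: "complex^'n"
    show "indicator (ball 0 1) z * ennreal (defect z powr \<alpha>) * ennreal (norm (weighted_radial m f z) powr p)
      = indicator (ball 0 1) z * ennreal (defect z powr (\<alpha> + p * real m)) * pth_power p ((radial_deriv ^^ m) f) z"
    proof (cases "norm z < 1")
      case True
      then show ?thesis by (simp add: norm_weighted_radial_powr pth_power_def powr_add ennreal_mult mult.assoc)
    qed simp
  qed
  finally show ?thesis .
qed

lemma nn_integral_bergman_norm:
  fixes f :: "complex^'n \<Rightarrow> complex"
  assumes f: "holomorphic_ball f" and p: "p > 0"
  shows "(\<integral>\<^sup>+z. ennreal ((1 - (norm z)\<^sup>2) powr (p * real m) * norm ((radial_deriv ^^ m) f z) powr p) \<partial>weighted_measure \<alpha>)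
     = ennreal (mass_const TYPE('n) \<alpha>) * order_integral \<alpha> p m f"
  unfolding nn_integral_weighted_radial[OF f p, symmetric]
  by (intro nn_integral_cong)
     (simp add: sets_eq_imp_space_eq[OF sets_weighted_measure] space_restrict_space norm_weighted_radial_powr defect_def)

lemma max_radial_integral_equivalent:
  fixes \<alpha> p \<gamma> :: real and k :: nat
  defines "S \<equiv> (\<lambda>f :: complex^'n \<Rightarrow> complex. \<integral>\<^sup>+z. ennreal (\<bar>max_radial k \<gamma> f z\<bar> powr p) \<partial>weighted_measure \<alpha>)"
  assumes p: "p > 0" and \<gamma>: "\<gamma> > 0"
  shows "dominated holomorphic_functions S (order_integral \<alpha> p k)"
        "dominated holomorphic_functions (order_integral \<alpha> p k) S"
proof -
  define T where "T = (\<lambda>f :: complex^'n \<Rightarrow> complex. ball_integral \<alpha> (\<lambda>z. ennreal (\<bar>max_radial k \<gamma> f z\<bar> powr p)))"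
  have S: "S f = ennreal (mass_const TYPE('n) \<alpha>) * T f" if f: "holomorphic_ball f" for f
  proof -
    note [measurable] = borel_measurable_max_radial[OF f \<gamma>, of k]
    show ?thesis unfolding S_def T_def by (rule nn_integral_weighted_measure) measurable
  qed
  have "dominated holomorphic_functions T (order_integral \<alpha> p k)"
    unfolding T_def order_integral_def[abs_def] by (rule nn_integral_max_radial_le[OF p \<gamma>])
  from dominated_cmult(1)[OF this mass_const_pos[where 'n = 'n]]
  show "dominated holomorphic_functions S (order_integral \<alpha> p k)" by (simp add: dominated_def S)
  have "dominated holomorphic_functions (order_integral \<alpha> p k) T"
    by (rule dominatedI[of 1]) (auto simp: T_def order_integral_def intro!: bergman_integral_le_max_radial p \<gamma>)
  from dominated_cmult(2)[OF this mass_const_pos[where 'n = 'n]]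
  show "dominated holomorphic_functions (order_integral \<alpha> p k) S" by (simp add: dominated_def S)
qed

section \<open>The characterization by maximal functions\<close>

lemma ennreal_powr_mono:
  assumes "x \<le> y" "a > 0" shows "ennreal_powr x a \<le> ennreal_powr y a"
proof (cases "y = \<infinity>")
  case False
  then have "x \<noteq> \<infinity>" using assms(1) by (auto simp: top_unique)
  have "enn2real x \<le> enn2real y" using assms(1) False by (intro enn2real_mono) (auto simp: less_top)
  then show ?thesis using False \<open>x \<noteq> \<infinity>\<close> assms(2)
    by (auto simp: ennreal_powr_def intro!: ennreal_leI powr_mono2)
qed (simp add: ennreal_powr_def)

lemma ennreal_powr_cmult:
  assumes "c > 0" shows "ennreal_powr (ennreal c * x) a = ennreal (c powr a) * ennreal_powr x a"
proof (cases x)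
  case (real r)
  then have "ennreal c * x = ennreal (c * r)" using assms by (simp add: ennreal_mult)
  then have "ennreal_powr (ennreal c * x) a = ennreal ((c * r) powr a)"
    using real assms by (simp add: ennreal_powr_def del: ennreal_mult)
  moreover have "ennreal_powr x a = ennreal (r powr a)" using real by (simp add: ennreal_powr_def)
  ultimately show ?thesis using real assms by (simp add: powr_mult ennreal_mult)
qed (use assms in \<open>simp add: ennreal_powr_def ennreal_mult_top\<close>)

lemma dominated_powr:
  assumes "dominated F A B" "a > 0"
  shows "dominated F (\<lambda>f. ennreal_powr (A f) a) (\<lambda>f. ennreal_powr (B f) a)"
proof -
  obtain C where C: "C > 0" "\<forall>f\<in>F. A f \<le> ennreal C * B f" using assms unfolding dominated_def by blast
  have "ennreal_powr (A f) a \<le> ennreal (C powr a) * ennreal_powr (B f) a" if "f \<in> F" for f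
    using ennreal_powr_mono[of "A f" "ennreal C * B f" a] C that assms(2) by (simp add: ennreal_powr_cmult)
  then show ?thesis using C by (intro dominatedI[of "C powr a"]) auto
qed

lemma dominated_two_sided:
  assumes "dominated F A B" "dominated F B A"
  shows "\<exists>C>0. \<forall>f\<in>F. ennreal (inverse C) * B f \<le> A f \<and> A f \<le> ennreal C * B f"
proof -
  obtain a b where a: "a > 0" "\<forall>f\<in>F. A f \<le> ennreal a * B f" and b: "b > 0" "\<forall>f\<in>F. B f \<le> ennreal b * A f"
    using assms unfolding dominated_def by blast
  define C where "C = max a b"
  have C: "C > 0" "a \<le> C" "b \<le> C" using a b by (auto simp: C_def)
  show ?thesis
  proof (intro exI[of _ C] conjI[OF C(1)] ballI)
    fix f assume f: "f \<in> F"
    have "A f \<le> ennreal C * B f"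
      using a(2) f C by (meson ennreal_leI mult_right_mono order_trans zero_le)
    moreover have "B f \<le> ennreal C * A f"
      using b(2) f C by (meson ennreal_leI mult_right_mono order_trans zero_le)
    then have "ennreal (inverse C) * B f \<le> ennreal (inverse C) * (ennreal C * A f)"
      by (intro mult_left_mono) auto
    then have "ennreal (inverse C) * B f \<le> A f"
      using C by (simp add: mult.assoc[symmetric] flip: ennreal_mult)
    ultimately show "ennreal (inverse C) * B f \<le> A f \<and> A f \<le> ennreal C * B f" by blast
  qed
qed

lemma min_order_admissible:
  assumes "p * real k + \<alpha> > - 1" shows "p * real (min_order p \<alpha>) + \<alpha> > - 1"
  unfolding min_order_def using assms by (rule LeastI)

theorem corollary1p1:
  fixes \<gamma> \<alpha> p :: real and k :: nat
  assumes "\<gamma> > 0" and "0 < p" and "k > 0" and "p * real k + \<alpha> > - 1"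
  shows "(\<forall>(f :: complex^'n \<Rightarrow> complex) m :: nat.
            holomorphic_ball f \<longrightarrow> p * real m + \<alpha> > - 1 \<longrightarrow>
              (f \<in> bergman_space m p \<alpha> \<longleftrightarrow>
               in_Lp p (weighted_measure \<alpha>) (max_radial k \<gamma> f))) \<and>
         (\<exists>C::real. C > 0 \<and>
            (\<forall>f :: complex^'n \<Rightarrow> complex. holomorphic_ball f \<longrightarrow>
              (let X = bergman_norm p \<alpha> (\<lambda>z. f z - f 0);
                   Y = ennreal_powr
                         (\<integral>\<^sup>+z. ennreal (\<bar>max_radial k \<gamma> f z\<bar> powr p) \<partial>weighted_measure \<alpha>) (1 / p)
               in ennreal (inverse C) * Y \<le> X \<and> X \<le> ennreal C * Y)))"
proof -
  note \<gamma> = assms(1) and p = assms(2) and k = assms(3) and adm = assms(4)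
  define S where "S = (\<lambda>f :: complex^'n \<Rightarrow> complex.
     \<integral>\<^sup>+z. ennreal (\<bar>max_radial k \<gamma> f z\<bar> powr p) \<partial>weighted_measure \<alpha>)"
  define M where "M = mass_const TYPE('n) \<alpha>"
  have M: "M > 0" unfolding M_def by (rule mass_const_pos)
  define centre where "centre = (\<lambda>(f :: complex^'n \<Rightarrow> complex) z. f z - f 0)"
  have centre: "centre f \<in> holomorphic_functions0" if "f \<in> holomorphic_functions" for f
    using that holomorphic_ball_diff_const by (auto simp: centre_def)
  have S_le: "dominated holomorphic_functions S (order_integral \<alpha> p k)"
    and S_ge: "dominated holomorphic_functions (order_integral \<alpha> p k) S"
    unfolding S_def by (rule max_radial_integral_equivalent[OF p \<gamma>])+
  (* The constant f 0 is invisible at every positive order, so order 0 alone needs a separate argument. *)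
  have shift: "order_integral \<alpha> p m (centre f) = order_integral \<alpha> p m f" if "m > 0" for m f
    by (simp add: centre_def order_integral_diff_const[OF that])
  have to_k: "dominated holomorphic_functions (\<lambda>f. order_integral \<alpha> p m (centre f)) (order_integral \<alpha> p k)"
    and from_k: "dominated holomorphic_functions (order_integral \<alpha> p k) (\<lambda>f. order_integral \<alpha> p m (centre f))"
    if "p * real m + \<alpha> > - 1" for m
    using dominated_compose[where T = centre and G = holomorphic_functions, OF order_integral_equivalent[OF p that, of k] centre]
      dominated_compose[where T = centre and G = holomorphic_functions, OF order_integral_equivalent[OF p adm, of m] centre]
    by (simp_all add: shift[OF k])
  have "f \<in> bergman_space m p \<alpha> \<longleftrightarrow> in_Lp p (weighted_measure \<alpha>) (max_radial k \<gamma> f)"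
    if f: "holomorphic_ball f" and m: "p * real m + \<alpha> > - 1" for f :: "complex^'n \<Rightarrow> complex" and m
  proof -
    have f': "f \<in> holomorphic_functions" using f by simp
    have "f \<in> bergman_space m p \<alpha> \<longleftrightarrow> order_integral \<alpha> p m f < \<infinity>"
      using f borel_measurable_weighted_radial[OF f, of m] M
      by (auto simp: bergman_space_def in_Lp_def borel_measurable_weighted_measure_iff
            nn_integral_weighted_radial[OF f p] M_def ennreal_mult_less_top)
    also have "\<dots> \<longleftrightarrow> order_integral \<alpha> p k f < \<infinity>"
    proof
      assume "order_integral \<alpha> p k f < \<infinity>"
      then have fin: "order_integral \<alpha> p m (centre f) < \<infinity>"
        by (rule dominated_finite[OF to_k[OF m] f'])
      show "order_integral \<alpha> p m f < \<infinity>"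
      proof (cases "m = 0")
        case True
        then show ?thesis
          using order_integral_0_finite_diff_const[OF f p, of \<alpha> "f 0"] fin m by (simp add: centre_def)
      qed (use fin shift in simp)
    next
      assume fin: "order_integral \<alpha> p m f < \<infinity>"
      show "order_integral \<alpha> p k f < \<infinity>"
      proof (cases "m = 0")
        case True
        then show ?thesis using dominated_finite[OF order_integral_raise[OF p, where m = m and j = k and \<alpha> = \<alpha>], OF f' fin] by simp
      next
        case False
        then have "order_integral \<alpha> p m (centre f) < \<infinity>" using fin by (simp add: shift)
        then show ?thesis by (rule dominated_finite[OF from_k[OF m] f'])
      qed
    qed
    also have "\<dots> \<longleftrightarrow> S f < \<infinity>"
      using dominated_finite[OF S_le f'] dominated_finite[OF S_ge f'] by blast
    also have "\<dots> \<longleftrightarrow> in_Lp p (weighted_measure \<alpha>) (max_radial k \<gamma> f)"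
      using borel_measurable_max_radial[OF f \<gamma>, of k]
      by (simp add: in_Lp_def borel_measurable_weighted_measure_iff S_def)
    finally show ?thesis .
  qed
  moreover have "\<exists>C::real. C > 0 \<and>
            (\<forall>f :: complex^'n \<Rightarrow> complex. holomorphic_ball f \<longrightarrow>
               ennreal (inverse C) * ennreal_powr (S f) (1 / p) \<le> bergman_norm p \<alpha> (\<lambda>z. f z - f 0) \<and>
               bergman_norm p \<alpha> (\<lambda>z. f z - f 0) \<le> ennreal C * ennreal_powr (S f) (1 / p))"
  proof -
    define N where "N = min_order p \<alpha>"
    have N: "p * real N + \<alpha> > - 1" unfolding N_def by (rule min_order_admissible[OF adm])
    define T where "T = (\<lambda>f. ennreal M * order_integral \<alpha> p N (centre f))"
    have "dominated holomorphic_functions T S" "dominated holomorphic_functions S T"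
      unfolding T_def
      by (rule dominated_cmult(1)[OF dominated_trans[OF to_k[OF N] S_ge] M]
               dominated_cmult(2)[OF dominated_trans[OF S_le from_k[OF N]] M])+
    then have d: "dominated holomorphic_functions (\<lambda>f. ennreal_powr (T f) (1 / p)) (\<lambda>f. ennreal_powr (S f) (1 / p))"
      "dominated holomorphic_functions (\<lambda>f. ennreal_powr (S f) (1 / p)) (\<lambda>f. ennreal_powr (T f) (1 / p))"
      using p by (auto intro: dominated_powr)
    obtain C where C: "C > 0" and two: "\<And>f. f \<in> holomorphic_functions \<Longrightarrow>
        ennreal (inverse C) * ennreal_powr (S f) (1 / p) \<le> ennreal_powr (T f) (1 / p) \<and>
        ennreal_powr (T f) (1 / p) \<le> ennreal C * ennreal_powr (S f) (1 / p)"
      using dominated_two_sided[OF d] by blast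
    have "bergman_norm p \<alpha> (\<lambda>z. f z - f 0) = ennreal_powr (T f) (1 / p)" if "holomorphic_ball f" for f :: "complex^'n \<Rightarrow> complex"
      using nn_integral_bergman_norm[OF holomorphic_ball_diff_const[OF that, of "f 0"] p, where m = N and \<alpha> = \<alpha>]
      by (simp add: bergman_norm_def N_def[symmetric] T_def M_def centre_def)
    then show ?thesis using C two by (intro exI[of _ C]) auto
  qed
  ultimately show ?thesis unfolding S_def Let_def by blast
qed

end
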